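(* Let $n \ge 1$ be an integer and $s \in (0,1)$. Let $E \subset \mathbb{R}^{n+1}$ be a nonempty open set which is contained in a half-space and whose boundary $\partial E$ is a smooth nonlocal $s$-minimal surface, i.e., $\partial E$ is smooth and $\mathrm{H}_{s,E}(x) = 0$ for every $x \in \partial E$. Then, $E$ is a half-space.
   Context: For a measurable set $E \subset \mathbb{R}^{n+1}$ and $x \in \partial E$, the fractional $s$-mean curvature is $$\mathrm{H}_{s,E}(x) := \mathrm{P.V.} \int_{\mathbb{R}^{n+1}} \frac{\chi_{\mathbb{R}^{n+1}\setminus E}(y) - \chi_E(y)}{|x-y|^{n+1+s}}\, dy = \lim_{\varepsilon \to 0^+} \int_{\mathbb{R}^{n+1}\setminus B_\varepsilon(x)} \frac{\chi_{\mathbb{R}^{n+1}\setminus E}(y) - \chi_E(y)}{|x-y|^{n+1+s}}\, dy,$$ which is well-defined pointwise when $\partial E$ is smooth near $x$. Sets are understood up to Lebesgue null sets (equality of sets means that the symmetric difference has measure zero), and $\partial E$ coincides with the measure theoretic boundary of $E$, i.e., $\partial E = \{x \in \mathbb{R}^{n+1} : 0 < |E \cap B_r(x)| < |B_r| \text{ for all } r>0\}$. A half-space is a set of the form $\{x \in \mathbb{R}^{n+1} : x\cdot \omega < a\}$ with $|\omega| = 1$ and $a \in \mathbb{R}$. The boundary $\partial E$ is not assumed to be connected. *)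

theory Defs
  imports "HOL-Analysis.Analysis"
begin

definition half_space :: "'a::euclidean_space set \<Rightarrow> bool" where
  "half_space H \<longleftrightarrow> (\<exists>\<omega> a. norm \<omega> = 1 \<and> H = {x. x \<bullet> \<omega> < a})"

text \<open>Inclusion and equality of sets up to Lebesgue null sets.\<close>

definition ae_subset :: "'a::euclidean_space set \<Rightarrow> 'a set \<Rightarrow> bool" where
  "ae_subset A B \<longleftrightarrow> A - B \<in> null_sets lebesgue"

definition ae_equal :: "'a::euclidean_space set \<Rightarrow> 'a set \<Rightarrow> bool" where
  "ae_equal A B \<longleftrightarrow> (A - B) \<union> (B - A) \<in> null_sets lebesgue"

definition measure_boundary :: "'a::euclidean_space set \<Rightarrow> 'a set" where
  "measure_boundary E = {x. \<forall>r>0.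
     0 < measure lebesgue (E \<inter> ball x r) \<and>
     measure lebesgue (E \<inter> ball x r) < measure lebesgue (ball x r)}"

text \<open>On an open set, the following is continuous differentiability of order \<open>k\<close>:
  all directional derivatives are required to be of order \<open>k - 1\<close>.\<close>

primrec C_k_on :: "nat \<Rightarrow> ('a::euclidean_space \<Rightarrow> 'b::real_normed_vector) \<Rightarrow> 'a set \<Rightarrow> bool" where
  "C_k_on 0 f U \<longleftrightarrow> continuous_on U f"
| "C_k_on (Suc k) f U \<longleftrightarrow>
     (\<forall>x\<in>U. f differentiable (at x)) \<and>
     (\<forall>v. C_k_on k (\<lambda>x. frechet_derivative f (at x) v) U)"

definition smooth_on :: "('a::euclidean_space \<Rightarrow> 'b::real_normed_vector) \<Rightarrow> 'a set \<Rightarrow> bool" where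
  "smooth_on f U \<longleftrightarrow> (\<forall>k. C_k_on k f U)"

text \<open>A smooth embedded hypersurface, not necessarily connected: locally the zero set of a
  smooth function without critical points.\<close>

definition smooth_hypersurface :: "'a::euclidean_space set \<Rightarrow> bool" where
  "smooth_hypersurface S \<longleftrightarrow>
     (\<forall>p\<in>S. \<exists>U (\<phi> :: 'a \<Rightarrow> real). open U \<and> p \<in> U \<and> smooth_on \<phi> U \<and>
        (\<forall>x\<in>U. frechet_derivative \<phi> (at x) \<noteq> (\<lambda>v. 0)) \<and>
        S \<inter> U = {x \<in> U. \<phi> x = 0})"

text \<open>The ambient dimension \<open>DIM('a)\<close> is the number written \<open>n + 1\<close> in the usual notation for the
  fractional mean curvature of a set with \<open>n\<close>-dimensional boundary.\<close>

definition truncated_frac_mean_curvature ::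
    "real \<Rightarrow> 'a::euclidean_space set \<Rightarrow> 'a \<Rightarrow> real \<Rightarrow> real" where
  "truncated_frac_mean_curvature s E x \<epsilon> =
     (LINT y:(- ball x \<epsilon>)|lebesgue.
        (indicator (- E) y - indicator E y) / norm (x - y) powr (real DIM('a) + s))"

text \<open>The principal value exists and equals \<open>h\<close>. This is a relation, rather than a function built
  on \<open>Lim\<close>, so that nothing is asserted about the value of a limit that does not exist.\<close>

definition has_frac_mean_curvature ::
    "real \<Rightarrow> 'a::euclidean_space set \<Rightarrow> 'a \<Rightarrow> real \<Rightarrow> bool" where
  "has_frac_mean_curvature s E x h \<longleftrightarrow>
     (truncated_frac_mean_curvature s E x \<longlongrightarrow> h) (at_right 0)"

definition smooth_nonlocal_minimal_boundary :: "real \<Rightarrow> 'a::euclidean_space set \<Rightarrow> bool" where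
  "smooth_nonlocal_minimal_boundary s E \<longleftrightarrow>
     smooth_hypersurface (measure_boundary E) \<and>
     (\<forall>x\<in>measure_boundary E. has_frac_mean_curvature s E x 0)"

end

(* The proof touches E from outside and from inside by balls and tests the equation at the contact points.

   Let E lie in the half-space H = {y. y . omega < a} with a optimal. Lower a large ball onto E near a
   point of E close to the hyperplane. At the contact point z the kernel mass of the ball cancels up to
   curvature, that of H up to a thin slab, so vanishing mean curvature shows that H - E has small kernel
   mass around z.

   Suppose that H - E is not null; then the measure theoretic complement of E contains a point p of H at
   positive depth tau. Grow a ball inside E, from a tiny one at a contact point z (available since the boundary
   is smooth) up to a huge one that comes within tau/2 of the hyperplane and so contains p. It must touch
   the complement of E at some x. At x the strip between the hyperplane and its reflection in x
   contributes a negative amount to the mean curvature, of order min t r / r^(1+s) at scale r and depth t,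
   which neither the curvature of the ball nor the small mass of H - E can balance. *)

theory Submission
  imports Defs
begin

section \<open>Volumes of slabs and dyadic sums\<close>

text \<open>The obstacle: at an interior contact point \<open>x\<close> nothing is known about
  \<open>E\<close> nearby except the touching ball, and \<open>H - E\<close> is known to be small
  only around another point \<open>z\<close>. Both touching estimates therefore cut at a scale
  \<open>r\<close>. Inside \<open>ball x r\<close> only the ball is used, at a cost of order
  \<open>r powr (1 - s) / R\<close>; outside only the half-space is used, and there the kernel may
  be recentred from \<open>z\<close> to \<open>x\<close> as long as their distance is at most a
  constant times \<open>r\<close>. The gain \<open>min t r * r powr (- 1 - s)\<close> has to beat
  all errors, so \<open>r\<close> must follow the contact point, and the growth splits into two
  stages. Up to radius \<open>T / 4\<close> the scale is proportional to the radius and the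
  half-space is the tangent one at \<open>z\<close>. Beyond that the centre is fixed, the half-space
  is \<open>H\<close>, and the exterior ball with its contact point \<open>z\<close> is chosen only
  after \<open>x\<close> is known. The inner balls are stopped by \<open>ess_support (- E)\<close>
  and not by \<open>- E\<close>: the open set \<open>E\<close> may omit a null set, and the equation
  holds only at the measure theoretic boundary.\<close>

lemma emeasure_lborel_translate:
  fixes A :: "'a::euclidean_space set"
  assumes "A \<in> sets borel"
  shows "emeasure lborel ((\<lambda>x. v + x) -` A) = emeasure lborel A"
proof -
  have "emeasure lborel A = emeasure (distr lborel borel ((+) v)) A"
    by (simp add: lborel_distr_plus)
  also have "\<dots> = emeasure lborel ((\<lambda>x. v + x) -` A)"
    using assms by (subst emeasure_distr) auto
  finally show ?thesis ..
qed

lemma packing_by_translates: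
  fixes S W :: "'a::euclidean_space set"
  assumes S: "S \<in> sets borel" and W: "W \<in> sets borel"
    and disj: "disjoint_family_on (\<lambda>j::nat. (\<lambda>x. real j *\<^sub>R v + x) -` S) {..<N}"
    and sub: "\<And>j. j < N \<Longrightarrow> (\<lambda>x. real j *\<^sub>R v + x) -` S \<subseteq> W"
  shows "of_nat N * emeasure lborel S \<le> emeasure lborel W"
proof -
  have m: "(\<lambda>x. real j *\<^sub>R v + x) -` S \<in> sets borel" for j
    by (rule measurable_sets_borel[OF _ S]) simp
  have "of_nat N * emeasure lborel S = (\<Sum>j<N. emeasure lborel ((\<lambda>x. real j *\<^sub>R v + x) -` S))"
    by (simp add: emeasure_lborel_translate[OF S])
  also have "\<dots> = emeasure lborel (\<Union>j<N. (\<lambda>x. real j *\<^sub>R v + x) -` S)"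
    using disj m by (intro sum_emeasure) auto
  also have "\<dots> \<le> emeasure lborel W"
    using sub W by (intro emeasure_mono) auto
  finally show ?thesis .
qed

text \<open>Translates of the slab piece by multiples of \<open>2 * h\<close> along
  \<open>\<nu>\<close> are disjoint, and about \<open>\<rho> / (2 * h)\<close> of them fit into a
  ball of radius \<open>4 * \<rho>\<close>. Comparing volumes takes the place of slicing by
  hyperplanes.\<close>

lemma slab_ball_volume:
  "\<exists>C>0. \<forall>(z::'a::euclidean_space) \<nu> a h \<rho>. norm \<nu> = 1 \<longrightarrow> 0 < h \<longrightarrow> 0 < \<rho> \<longrightarrow>
     emeasure lborel ({y. a \<le> (y - z) \<bullet> \<nu> \<and> (y - z) \<bullet> \<nu> \<le> a + h} \<inter> ball z \<rho>)
       \<le> ennreal (C * (h * \<rho> powr (real DIM('a) - 1)))"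
proof (intro exI[of _ "2 * 4 ^ DIM('a) * unit_ball_vol (real DIM('a))"] conjI allI impI)
  show "0 < 2 * 4 ^ DIM('a) * unit_ball_vol (real DIM('a))" by simp
next
  fix z \<nu> :: 'a and a h \<rho> :: real
  assume \<nu>: "norm \<nu> = 1" and h: "0 < h" and \<rho>: "0 < \<rho>"
  define \<omega> where "\<omega> = unit_ball_vol (real DIM('a))"
  have \<omega>: "\<omega> > 0" by (simp add: \<omega>_def)
  define S where "S = {y. a \<le> (y - z) \<bullet> \<nu> \<and> (y - z) \<bullet> \<nu> \<le> a + h} \<inter> ball z \<rho>"
  have mS: "S \<in> sets borel"
    unfolding S_def by measurable
  have p: "\<rho> ^ DIM('a) = \<rho> * \<rho> powr (real DIM('a) - 1)"
    using \<rho> by (simp add: powr_realpow powr_diff)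
  show "emeasure lborel S \<le> ennreal (2 * 4 ^ DIM('a) * unit_ball_vol (real DIM('a)) * (h * \<rho> powr (real DIM('a) - 1)))"
  proof (cases "h \<ge> \<rho>")
    case True
    have "emeasure lborel S \<le> emeasure lborel (ball z \<rho>)"
      by (intro emeasure_mono) (auto simp: S_def)
    also have "\<dots> = ennreal (\<omega> * \<rho> ^ DIM('a))"
      using \<rho> by (simp add: emeasure_ball \<omega>_def)
    also have "\<dots> \<le> ennreal (2 * 4 ^ DIM('a) * \<omega> * (h * \<rho> powr (real DIM('a) - 1)))"
    proof (intro ennreal_leI)
      have "(1::real) * \<omega> \<le> (2 * 4 ^ DIM('a)) * \<omega>"
        using \<omega> one_le_power[of "4::real" "DIM('a)"] by (intro mult_right_mono) linarith+
      moreover have "\<rho> ^ DIM('a) \<le> h * \<rho> powr (real DIM('a) - 1)"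
        unfolding p using True by (intro mult_right_mono) auto
      ultimately show "\<omega> * \<rho> ^ DIM('a) \<le> 2 * 4 ^ DIM('a) * \<omega> * (h * \<rho> powr (real DIM('a) - 1))"
        using \<rho> \<omega> by (intro mult_mono) auto
    qed
    finally show ?thesis by (simp add: \<omega>_def)
  next
    case False
    define N where "N = nat \<lceil>\<rho> / (2 * h)\<rceil>"
    have N1: "real N \<ge> \<rho> / (2 * h)" unfolding N_def by linarith
    have "real N < \<rho> / (2 * h) + 1" unfolding N_def using h \<rho> by (smt (verit) divide_nonneg_pos of_int_ceiling_le_add_one of_nat_nat zero_le_ceiling ceiling_correct)
    hence N2: "real N * (2 * h) < \<rho> + 2 * h"
      using h by (simp add: field_simps)
    have Npos: "0 < real N" using N1 h \<rho> by (smt (verit) divide_pos_pos)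
    \<comment> \<open>The slab is closed, so a spacing of exactly \<open>h\<close> would let
      neighbours share a face. Taking preimages moves the set by \<open>- v\<close>, hence the
      sign.\<close>
    define v where "v = (- 2 * h) *\<^sub>R \<nu>"
    have nn: "\<nu> \<bullet> \<nu> = 1" using \<nu> by (simp add: dot_square_norm)
    have "of_nat N * emeasure lborel S \<le> emeasure lborel (ball z (4 * \<rho>))"
    proof (rule packing_by_translates[OF mS, where v = v])
      show "disjoint_family_on (\<lambda>j::nat. (\<lambda>x. real j *\<^sub>R v + x) -` S) {..<N}"
      proof (unfold disjoint_family_on_def, intro ballI impI, rule ccontr)
        fix i j :: nat assume ij: "i \<noteq> j"
        assume "(\<lambda>x. real i *\<^sub>R v + x) -` S \<inter> (\<lambda>x. real j *\<^sub>R v + x) -` S \<noteq> {}"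
        then obtain x where x: "real i *\<^sub>R v + x \<in> S" "real j *\<^sub>R v + x \<in> S" by auto
        define X where "X = (x - z) \<bullet> \<nu>"
        have e: "(real k *\<^sub>R v + x - z) \<bullet> \<nu> = X - real k * (2 * h)" for k
          by (simp add: v_def X_def inner_add_left inner_diff_left nn)
        have 1: "a \<le> X - real k * (2 * h)" "X - real k * (2 * h) \<le> a + h" if "k \<in> {i, j}" for k
          using x that by (auto simp: S_def e)
        have "\<bar>real i - real j\<bar> \<ge> 1" using ij by linarith
        hence "\<bar>real i - real j\<bar> * (2 * h) \<ge> 2 * h" using h by simp
        moreover have "\<bar>real i - real j\<bar> * (2 * h) = \<bar>real i * (2 * h) - real j * (2 * h)\<bar>"
          using h by (simp add: abs_mult left_diff_distrib[symmetric])
        ultimately show False using 1[of i] 1[of j] h by simp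
      qed
      fix j assume "j < N"
      show "(\<lambda>x. real j *\<^sub>R v + x) -` S \<subseteq> ball z (4 * \<rho>)"
      proof safe
        fix x assume "real j *\<^sub>R v + x \<in> S"
        hence "norm (z - (real j *\<^sub>R v + x)) < \<rho>" by (simp add: S_def dist_norm)
        moreover have "norm (z - x) \<le> norm (z - (real j *\<^sub>R v + x)) + norm (real j *\<^sub>R v)"
          using norm_triangle_ineq[of "z - (real j *\<^sub>R v + x)" "real j *\<^sub>R v"] by simp
        moreover have "norm (real j *\<^sub>R v) = real j * (2 * h)"
          using h by (simp add: v_def \<nu>)
        moreover have "real j * (2 * h) \<le> real N * (2 * h)"
          using \<open>j < N\<close> h by (intro mult_right_mono) auto
        ultimately have "norm (z - x) < 4 * \<rho>"
          using N2 False by linarith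
        thus "x \<in> ball z (4 * \<rho>)"
          by (simp add: dist_norm)
      qed
    qed simp
    also have "\<dots> = ennreal (\<omega> * (4 * \<rho>) ^ DIM('a))"
      using \<rho> by (simp add: emeasure_ball \<omega>_def)
    finally have le: "of_nat N * emeasure lborel S \<le> ennreal (\<omega> * (4 * \<rho>) ^ DIM('a))" .
    have fin: "emeasure lborel S \<noteq> \<infinity>"
      using le Npos by (auto simp: top_unique ennreal_mult_top)
    then obtain m where m: "m \<ge> 0" "emeasure lborel S = ennreal m"
      by (cases "emeasure lborel S") auto
    have "real N * m \<le> \<omega> * (4 * \<rho>) ^ DIM('a)"
      using le \<omega> \<rho> m by (simp add: ennreal_of_nat_eq_real_of_nat ennreal_mult[symmetric])
    moreover have "\<rho> / (2 * h) * m \<le> real N * m"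
      using N1 m by (intro mult_right_mono)
    ultimately have "\<rho> / (2 * h) * m \<le> \<omega> * (4 * \<rho>) ^ DIM('a)" by linarith
    hence "m \<le> \<omega> * (4 * \<rho>) ^ DIM('a) * (2 * h) / \<rho>"
      using \<rho> h by (simp add: field_simps)
    also have "\<dots> = 2 * 4 ^ DIM('a) * \<omega> * (h * \<rho> powr (real DIM('a) - 1))"
      using \<rho> by (simp add: power_mult_distrib p)
    finally show ?thesis using m by (simp add: \<omega>_def ennreal_leI)
  qed
qed

section \<open>The kernel as a Borel measure and its dyadic summation\<close>

definition kernel_measure :: "real \<Rightarrow> 'a::euclidean_space \<Rightarrow> 'a measure" where
  "kernel_measure s z = density lborel (\<lambda>y. ennreal (norm (z - y) powr - (real DIM('a) + s)))"

lemma sets_kernel_measure [simp, measurable_cong]: "sets (kernel_measure s z) = sets borel"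
  by (simp add: kernel_measure_def)

lemma space_kernel_measure [simp]: "space (kernel_measure s z) = UNIV"
  by (simp add: kernel_measure_def)

lemma emeasure_kernel_measure:
  fixes z :: "'a::euclidean_space"
  assumes "A \<in> sets borel"
  shows "emeasure (kernel_measure s z) A =
    (\<integral>\<^sup>+y. ennreal (norm (z - y) powr - (real DIM('a) + s)) * indicator A y \<partial>lborel)"
  unfolding kernel_measure_def using assms by (subst emeasure_density) auto

text \<open>On each shell the kernel is at most its value at the inner radius, and the volume
  hypothesis turns the sum into a geometric series of ratio
  \<open>b powr (\<alpha> - d - s)\<close>. Leaving \<open>b\<close> free serves both directions:
  \<open>b = 1/2\<close> sums towards \<open>z\<close>, \<open>b = 2\<close> towards
  infinity.\<close>

lemma kernel_measure_shells:
  fixes z :: "'a::euclidean_space"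
  defines "d \<equiv> real DIM('a)"
  assumes A: "A \<in> sets borel" and M: "0 \<le> M" and b: "0 < b" "b powr (\<alpha> - d - s) < 1"
    and l: "0 < l" and u: "0 < u"
    and cover: "\<And>y. y \<in> A \<Longrightarrow> y \<noteq> z \<Longrightarrow> \<exists>j::nat. l * b ^ j \<le> norm (z - y) \<and> norm (z - y) < u * b ^ j"
    and vol: "\<And>j::nat. emeasure lborel (A \<inter> ball z (u * b ^ j)) \<le> ennreal (M * (u * b ^ j) powr \<alpha>)"
    and s: "0 < s"
  shows "emeasure (kernel_measure s z) A
     \<le> ennreal (M * l powr - (d + s) * u powr \<alpha> / (1 - b powr (\<alpha> - d - s)))"
proof -
  define q where "q = b powr (\<alpha> - d - s)"
  have q: "0 \<le> q" "q < 1" using b by (auto simp: q_def)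
  have "emeasure (kernel_measure s z) A =
      (\<integral>\<^sup>+y. ennreal (norm (z - y) powr - (d + s)) * indicator A y \<partial>lborel)"
    unfolding d_def by (rule emeasure_kernel_measure[OF A])
  also have "\<dots> \<le> (\<integral>\<^sup>+y. (\<Sum>j. ennreal ((l * b ^ j) powr - (d + s)) *
        indicator (A \<inter> ball z (u * b ^ j)) y) \<partial>lborel)"
  proof (rule nn_integral_mono)
    fix y
    show "ennreal (norm (z - y) powr - (d + s)) * indicator A y \<le>
      (\<Sum>j. ennreal ((l * b ^ j) powr - (d + s)) * indicator (A \<inter> ball z (u * b ^ j)) y)"
    proof (cases "y \<in> A \<and> y \<noteq> z")
      case True
      then obtain j where j: "l * b ^ j \<le> norm (z - y)" "norm (z - y) < u * b ^ j"
        using cover by blast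
      have "norm (z - y) powr - (d + s) \<le> (l * b ^ j) powr - (d + s)"
        using j l b s by (intro powr_mono2') (auto simp: d_def)
      hence "ennreal (norm (z - y) powr - (d + s)) * indicator A y \<le>
        (\<Sum>i\<in>{j}. ennreal ((l * b ^ i) powr - (d + s)) * indicator (A \<inter> ball z (u * b ^ i)) y)"
        using True j by (simp add: dist_norm ennreal_leI)
      also have "\<dots> \<le> (\<Sum>i. ennreal ((l * b ^ i) powr - (d + s)) * indicator (A \<inter> ball z (u * b ^ i)) y)"
        by (intro sum_le_suminf) auto
      finally show ?thesis .
    next
      \<comment> \<open>If \<open>y = z\<close>, the convention \<open>0 powr x = 0\<close> makes
        the left side vanish.\<close>
      case False
      then show ?thesis by auto
    qed
  qed
  also have "\<dots> = (\<Sum>j. \<integral>\<^sup>+y. ennreal ((l * b ^ j) powr - (d + s)) *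
        indicator (A \<inter> ball z (u * b ^ j)) y \<partial>lborel)"
    using A by (intro nn_integral_suminf borel_measurable_times_ennreal borel_measurable_const
      borel_measurable_indicator) simp
  also have "\<dots> = (\<Sum>j. ennreal ((l * b ^ j) powr - (d + s)) * emeasure lborel (A \<inter> ball z (u * b ^ j)))"
    using A by (intro suminf_cong nn_integral_cmult_indicator) auto
  also have "\<dots> \<le> (\<Sum>j. ennreal (M * l powr - (d + s) * u powr \<alpha> * q ^ j))"
  proof (intro suminf_le allI)
    fix j
    have "ennreal ((l * b ^ j) powr - (d + s)) * emeasure lborel (A \<inter> ball z (u * b ^ j))
      \<le> ennreal ((l * b ^ j) powr - (d + s)) * ennreal (M * (u * b ^ j) powr \<alpha>)"
      by (intro mult_left_mono vol) auto
    also have "\<dots> = ennreal ((l * b ^ j) powr - (d + s) * (M * (u * b ^ j) powr \<alpha>))"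
      by (simp add: ennreal_mult')
    also have "(l * b ^ j) powr - (d + s) * (M * (u * b ^ j) powr \<alpha>) =
        M * l powr - (d + s) * u powr \<alpha> * ((b ^ j) powr - (d + s) * (b ^ j) powr \<alpha>)"
      using l u b by (simp add: powr_mult)
    also have "(b ^ j) powr - (d + s) * (b ^ j) powr \<alpha> = q ^ j"
      using b by (simp add: q_def powr_add[symmetric] powr_realpow[symmetric] powr_powr algebra_simps)
    finally show "ennreal ((l * b ^ j) powr - (d + s)) * emeasure lborel (A \<inter> ball z (u * b ^ j))
      \<le> ennreal (M * l powr - (d + s) * u powr \<alpha> * q ^ j)" .
  qed (rule summableI)+
  also have "\<dots> = ennreal (\<Sum>j. M * l powr - (d + s) * u powr \<alpha> * q ^ j)"
    using q M by (intro suminf_ennreal2 summable_mult summable_geometric) auto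
  also have "(\<Sum>j. M * l powr - (d + s) * u powr \<alpha> * q ^ j) = M * l powr - (d + s) * u powr \<alpha> / (1 - q)"
    using q by (subst suminf_mult) (auto simp: suminf_geometric summable_geometric)
  finally show ?thesis by (simp add: q_def)
qed

lemma dyadic_shell_inner:
  fixes x r :: real
  assumes "0 < x" "x < r"
  shows "\<exists>j::nat. r / 2 * (1/2) ^ j \<le> x \<and> x < r * (1/2) ^ j"
proof -
  obtain n where n: "(1/2::real) ^ n < x / r"
    using assms real_arch_pow_inv[of "x / r" "1/2"] by auto
  define k where "k = (LEAST n. r * (1/2::real) ^ n \<le> x)"
  have ex: "r * (1/2::real) ^ n \<le> x" using n assms by (simp add: field_simps)
  hence k: "r * (1/2::real) ^ k \<le> x" unfolding k_def by (rule LeastI)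
  have "k \<noteq> 0" using k assms by (intro notI) simp
  then obtain j where j: "k = Suc j" using not0_implies_Suc by blast
  have "\<not> r * (1/2::real) ^ j \<le> x"
    using not_less_Least[of j "\<lambda>n. r * (1/2::real) ^ n \<le> x"] j by (simp add: k_def)
  thus ?thesis using k j by (intro exI[of _ j]) auto
qed

text \<open>The inversion of \<open>x\<close> to \<open>r\<^sup>2 / x\<close> reduces this to the
  inner shells. It exchanges the closed and the open end of a shell, so the endpoint
  \<open>2 * r * 2 ^ j\<close> passes to the next index.\<close>

lemma dyadic_shell_outer:
  fixes x r :: real
  assumes "0 < r" "r \<le> x"
  shows "\<exists>j::nat. r * 2 ^ j \<le> x \<and> x < 2 * r * 2 ^ j"
proof -
  have "0 < r / x" "r / x < 2" using assms by (auto simp: field_simps)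
  then consider "x = r" | "0 < r / x * r" "r / x * r < r"
    using assms by (cases "x = r") (auto simp: field_simps)
  thus ?thesis
  proof cases
    case 1 thus ?thesis using assms by (intro exI[of _ 0]) auto
  next
    case 2
    from dyadic_shell_inner[OF this] obtain j where
      "r / 2 * (1/2) ^ j \<le> r / x * r" "r / x * r < r * (1/2) ^ j" by auto
    hence "x \<le> 2 * r * 2 ^ j" "r * 2 ^ j < x"
      using assms by (auto simp: field_simps)
    thus ?thesis using assms
      by (cases "x = 2 * r * 2 ^ j") (auto intro: exI[of _ j] exI[of _ "Suc j"])
  qed
qed

text \<open>Summing into the singularity needs volume growth of an order above \<open>d + s\<close>.
  A full ball fails this, but the region between two tangent paraboloids has order
  \<open>d + 1\<close>.\<close>

lemma kernel_measure_inner: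
  fixes z :: "'a::euclidean_space"
  defines "d \<equiv> real DIM('a)"
  assumes A: "A \<in> sets borel" and M: "0 \<le> M" and r: "0 < r" and s: "0 < s" and \<alpha>: "d + s < \<alpha>"
    and vol: "\<And>\<rho>. 0 < \<rho> \<Longrightarrow> emeasure lborel (A \<inter> ball z \<rho>) \<le> ennreal (M * \<rho> powr \<alpha>)"
  shows "emeasure (kernel_measure s z) (A \<inter> ball z r)
     \<le> ennreal (2 powr (d + s) / (1 - (1/2) powr (\<alpha> - d - s)) * M * r powr (\<alpha> - d - s))"
proof -
  have "emeasure (kernel_measure s z) (A \<inter> ball z r)
     \<le> ennreal (M * (r/2) powr - (d + s) * r powr \<alpha> / (1 - (1/2) powr (\<alpha> - d - s)))"
    unfolding d_def
  proof (rule kernel_measure_shells)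
    have "(1/2) powr (\<alpha> - d - s) < (1/2::real) powr 0"
      using \<alpha> by (intro powr_less_mono') auto
    thus "(1/2) powr (\<alpha> - real DIM('a) - s) < (1::real)" by (simp add: d_def)
    fix j :: nat
    have "emeasure lborel (A \<inter> ball z r \<inter> ball z (r * (1/2) ^ j)) \<le> emeasure lborel (A \<inter> ball z (r * (1/2) ^ j))"
      using A by (intro emeasure_mono) auto
    also have "\<dots> \<le> ennreal (M * (r * (1/2) ^ j) powr \<alpha>)" using r by (intro vol) auto
    finally show "emeasure lborel (A \<inter> ball z r \<inter> ball z (r * (1/2) ^ j)) \<le> ennreal (M * (r * (1/2) ^ j) powr \<alpha>)" .
  next
    fix y assume "y \<in> A \<inter> ball z r" "y \<noteq> z"
    thus "\<exists>j::nat. r / 2 * (1/2) ^ j \<le> norm (z - y) \<and> norm (z - y) < r * (1/2) ^ j"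
      by (intro dyadic_shell_inner) (auto simp: dist_norm)
  qed (use A M r s in auto)
  also have "M * (r/2) powr - (d + s) * r powr \<alpha> = 2 powr (d + s) * M * r powr (\<alpha> - d - s)"
  proof -
    have "(r/2) powr - (d + s) = r powr - (d + s) * 2 powr (d + s)"
      by (simp only: powr_divide powr_minus[of 2] divide_inverse[of _ "inverse (2 powr (d + s))"] inverse_inverse_eq)
    moreover have "r powr - (d + s) * r powr \<alpha> = r powr (\<alpha> - d - s)"
      by (simp add: powr_add[symmetric] algebra_simps)
    ultimately show ?thesis by (simp add: mult_ac)
  qed
  finally show ?thesis by (simp add: mult_ac)
qed

text \<open>Applied with \<open>\<alpha> = d\<close> to the whole space and with
  \<open>\<alpha> = d - 1\<close> to slabs, where the decay improves by one power of
  \<open>r\<close>.\<close>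

lemma kernel_measure_outer:
  fixes z :: "'a::euclidean_space"
  defines "d \<equiv> real DIM('a)"
  assumes A: "A \<in> sets borel" and M: "0 \<le> M" and r: "0 < r" and s: "0 < s" and \<alpha>: "\<alpha> < d + s"
    and vol: "\<And>\<rho>. 0 < \<rho> \<Longrightarrow> emeasure lborel (A \<inter> ball z \<rho>) \<le> ennreal (M * \<rho> powr \<alpha>)"
  shows "emeasure (kernel_measure s z) (A - ball z r)
     \<le> ennreal (2 powr \<alpha> / (1 - 2 powr (\<alpha> - d - s)) * M * r powr (\<alpha> - d - s))"
proof -
  have "emeasure (kernel_measure s z) (A - ball z r)
     \<le> ennreal (M * r powr - (d + s) * (2 * r) powr \<alpha> / (1 - 2 powr (\<alpha> - d - s)))"
    unfolding d_def
  proof (rule kernel_measure_shells)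
    have "2 powr (\<alpha> - d - s) < (2::real) powr 0"
      using \<alpha> by (intro powr_less_mono) auto
    thus "2 powr (\<alpha> - real DIM('a) - s) < (1::real)" by (simp add: d_def)
    fix j :: nat
    have "emeasure lborel ((A - ball z r) \<inter> ball z (2 * r * 2 ^ j)) \<le> emeasure lborel (A \<inter> ball z (2 * r * 2 ^ j))"
      using A by (intro emeasure_mono) auto
    also have "\<dots> \<le> ennreal (M * (2 * r * 2 ^ j) powr \<alpha>)" using r by (intro vol) auto
    finally show "emeasure lborel ((A - ball z r) \<inter> ball z (2 * r * 2 ^ j)) \<le> ennreal (M * (2 * r * 2 ^ j) powr \<alpha>)" .
  next
    fix y assume "y \<in> A - ball z r" "y \<noteq> z"
    thus "\<exists>j::nat. r * 2 ^ j \<le> norm (z - y) \<and> norm (z - y) < 2 * r * 2 ^ j"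
      using r by (intro dyadic_shell_outer) (auto simp: dist_norm)
  qed (use A M r s in auto)
  also have "M * r powr - (d + s) * (2 * r) powr \<alpha> = 2 powr \<alpha> * M * r powr (\<alpha> - d - s)"
  proof -
    have "r powr - (d + s) * r powr \<alpha> = r powr (\<alpha> - d - s)"
      by (simp add: powr_add[symmetric] algebra_simps)
    thus ?thesis using r by (simp add: powr_mult mult_ac)
  qed
  finally show ?thesis by (simp add: mult_ac)
qed

section \<open>The kernel of the fractional mean curvature\<close>

lemma kernel_measure_reflect:
  fixes z :: "'a::euclidean_space"
  assumes A: "A \<in> sets borel"
  shows "emeasure (kernel_measure s z) ((\<lambda>y. 2 *\<^sub>R z - y) -` A) = emeasure (kernel_measure s z) A"
proof -
  have m: "(\<lambda>y. 2 *\<^sub>R z - y) -` A \<in> sets borel"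
    by (rule measurable_sets_borel[OF _ A]) simp
  have l: "lborel = distr lborel borel (\<lambda>y. 2 *\<^sub>R z - y)"
    using lborel_affine[of "-1" "2 *\<^sub>R z"] by (simp add: density_1)
  have "emeasure (kernel_measure s z) A =
    (\<integral>\<^sup>+y. ennreal (norm (z - y) powr - (real DIM('a) + s)) * indicator A y \<partial>lborel)"
    by (rule emeasure_kernel_measure[OF A])
  also have "\<dots> = (\<integral>\<^sup>+y. ennreal (norm (z - (2 *\<^sub>R z - y)) powr - (real DIM('a) + s)) *
      indicator A (2 *\<^sub>R z - y) \<partial>lborel)"
    using A by (subst l, subst nn_integral_distr) simp_all
  also have "\<dots> = (\<integral>\<^sup>+y. ennreal (norm (z - y) powr - (real DIM('a) + s)) *
      indicator ((\<lambda>y. 2 *\<^sub>R z - y) -` A) y \<partial>lborel)"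
  proof (intro nn_integral_cong)
    fix y
    have "z - (2 *\<^sub>R z - y) = - (z - y)" by (simp add: scaleR_2)
    hence "norm (z - (2 *\<^sub>R z - y)) = norm (z - y)" by (metis norm_minus_cancel)
    thus "ennreal (norm (z - (2 *\<^sub>R z - y)) powr - (real DIM('a) + s)) * indicator A (2 *\<^sub>R z - y) =
      ennreal (norm (z - y) powr - (real DIM('a) + s)) * indicator ((\<lambda>y. 2 *\<^sub>R z - y) -` A) y"
      by (simp add: indicator_def)
  qed
  also have "\<dots> = emeasure (kernel_measure s z) ((\<lambda>y. 2 *\<^sub>R z - y) -` A)"
    by (rule emeasure_kernel_measure[OF m, symmetric])
  finally show ?thesis ..
qed

lemma kernel_measure_tail:
  assumes s: "0 < s"
  shows "\<exists>C>0. \<forall>(z::'a::euclidean_space) r. 0 < r \<longrightarrow>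
    emeasure (kernel_measure s z) (- ball z r) \<le> ennreal (C * r powr - s)"
proof -
  define d where "d = real DIM('a)"
  define \<omega> where "\<omega> = unit_ball_vol d"
  have \<omega>: "0 < \<omega>" by (simp add: \<omega>_def d_def)
  define C where "C = 2 powr d / (1 - 2 powr (d - d - s)) * \<omega>"
  have "(2::real) powr (d - d - s) < 2 powr 0"
    using s by (intro powr_less_mono) auto
  hence "0 < C" using \<omega> by (auto simp: C_def intro!: mult_pos_pos divide_pos_pos)
  moreover have "emeasure (kernel_measure s z) (- ball z r) \<le> ennreal (C * r powr - s)" if "0 < r" for z :: 'a and r
  proof -
    have "emeasure (kernel_measure s z) (UNIV - ball z r) \<le> ennreal (C * r powr (d - d - s))"
      unfolding C_def d_def
      using s that \<omega> by (intro kernel_measure_outer) (auto simp: emeasure_ball powr_realpow \<omega>_def d_def)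
    thus ?thesis by (simp add: Compl_eq_Diff_UNIV)
  qed
  ultimately show ?thesis by blast
qed

lemma kernel_measure_slab_outer:
  assumes s: "0 < s"
  shows "\<exists>C>0. \<forall>(z::'a::euclidean_space) \<nu> a h r. norm \<nu> = 1 \<longrightarrow> 0 < h \<longrightarrow> 0 < r \<longrightarrow>
    emeasure (kernel_measure s z) ({y. a \<le> (y - z) \<bullet> \<nu> \<and> (y - z) \<bullet> \<nu> \<le> a + h} - ball z r)
      \<le> ennreal (C * h * r powr (- 1 - s))"
proof -
  define d where "d = real DIM('a)"
  obtain C0 where C0: "0 < C0" "\<And>(z::'a) \<nu> a h \<rho>. norm \<nu> = 1 \<Longrightarrow> 0 < h \<Longrightarrow> 0 < \<rho> \<Longrightarrow>
     emeasure lborel ({y. a \<le> (y - z) \<bullet> \<nu> \<and> (y - z) \<bullet> \<nu> \<le> a + h} \<inter> ball z \<rho>)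
       \<le> ennreal (C0 * (h * \<rho> powr (d - 1)))"
    using slab_ball_volume[where 'a='a] unfolding d_def by blast
  define C where "C = 2 powr (d - 1) / (1 - 2 powr (d - 1 - d - s)) * C0"
  have "(2::real) powr (d - 1 - d - s) < 2 powr 0"
    using s by (intro powr_less_mono) auto
  hence "0 < C" using C0(1) by (auto simp: C_def intro!: mult_pos_pos divide_pos_pos)
  moreover have "emeasure (kernel_measure s z) ({y. a \<le> (y - z) \<bullet> \<nu> \<and> (y - z) \<bullet> \<nu> \<le> a + h} - ball z r)
      \<le> ennreal (C * h * r powr (- 1 - s))"
    if "norm \<nu> = 1" "0 < h" "0 < r" for z \<nu> :: 'a and a h r
  proof -
    have "emeasure (kernel_measure s z) ({y. a \<le> (y - z) \<bullet> \<nu> \<and> (y - z) \<bullet> \<nu> \<le> a + h} - ball z r)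
      \<le> ennreal (2 powr (d - 1) / (1 - 2 powr (d - 1 - d - s)) * (C0 * h) * r powr (d - 1 - d - s))"
      unfolding d_def
    proof (rule kernel_measure_outer)
      show "{y. a \<le> (y - z) \<bullet> \<nu> \<and> (y - z) \<bullet> \<nu> \<le> a + h} \<in> sets borel" by measurable
      fix \<rho> :: real assume "0 < \<rho>"
      thus "emeasure lborel ({y. a \<le> (y - z) \<bullet> \<nu> \<and> (y - z) \<bullet> \<nu> \<le> a + h} \<inter> ball z \<rho>)
        \<le> ennreal (C0 * h * \<rho> powr (real DIM('a) - 1))"
        using C0(2)[of \<nu> h \<rho> a z] that by (simp add: d_def mult.assoc)
    qed (use that C0 s in \<open>auto simp: d_def\<close>)
    thus ?thesis by (simp add: C_def mult_ac)
  qed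
  ultimately show ?thesis by blast
qed

text \<open>The points outside the ball whose reflections in the boundary point \<open>z\<close> are also outside
  lie between two paraboloids tangent at \<open>z\<close>; this is where the singularity of the kernel cancels.\<close>

lemma reflected_ball_complement:
  fixes c z y :: "'a::real_inner"
  assumes "norm (z - c) = T" "0 < T" and "y \<notin> ball c T" "2 *\<^sub>R z - y \<notin> ball c T"
  shows "\<bar>(y - z) \<bullet> ((c - z) /\<^sub>R T)\<bar> \<le> (norm (y - z))\<^sup>2 / (2 * T)"
proof -
  define w where "w = y - z"
  have nz: "norm (c - z) = T" using assms(1) by (simp add: norm_minus_commute)
  have "T \<le> norm (w - (c - z))" "T \<le> norm (- w - (c - z))"
    using assms(3,4) by (auto simp: dist_norm w_def norm_minus_commute scaleR_2 algebra_simps)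
  hence "T\<^sup>2 \<le> (norm (w - (c - z)))\<^sup>2" "T\<^sup>2 \<le> (norm (- w - (c - z)))\<^sup>2"
    using assms(2) by (auto intro!: power_mono)
  moreover have "(norm (w - (c - z)))\<^sup>2 = (norm w)\<^sup>2 - 2 * (w \<bullet> (c - z)) + T\<^sup>2"
    "(norm (- w - (c - z)))\<^sup>2 = (norm w)\<^sup>2 + 2 * (w \<bullet> (c - z)) + T\<^sup>2"
    unfolding nz[symmetric]
    by (simp_all only: power2_norm_eq_inner) (simp_all add: inner_diff_left inner_diff_right inner_commute)
  ultimately have "\<bar>w \<bullet> (c - z)\<bar> \<le> (norm w)\<^sup>2 / 2" by linarith
  hence "\<bar>w \<bullet> (c - z)\<bar> / T \<le> (norm w)\<^sup>2 / 2 / T" using assms(2) by (intro divide_right_mono) auto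
  moreover have "\<bar>w \<bullet> ((c - z) /\<^sub>R T)\<bar> = \<bar>w \<bullet> (c - z)\<bar> / T"
    using assms(2) by (simp add: abs_mult divide_inverse)
  ultimately show ?thesis by (simp add: w_def)
qed

text \<open>At scale \<open>\<rho>\<close> the paraboloids confine the set to a slab of thickness
  \<open>\<rho>\<^sup>2 / T\<close>, so its volume there is of order
  \<open>\<rho> powr (d + 1) / T\<close>. The dyadic sum towards \<open>z\<close> converges because
  \<open>s < 1\<close>.\<close>

lemma kernel_measure_ball_curvature:
  assumes s: "0 < s" "s < 1"
  shows "\<exists>C>0. \<forall>(z::'a::euclidean_space) c T r. norm (z - c) = T \<longrightarrow> 0 < T \<longrightarrow> 0 < r \<longrightarrow>
    emeasure (kernel_measure s z) ({y. y \<notin> ball c T \<and> 2 *\<^sub>R z - y \<notin> ball c T} \<inter> ball z r)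
      \<le> ennreal (C * r powr (1 - s) / T)"
proof -
  define d where "d = real DIM('a)"
  obtain C0 where C0: "0 < C0" "\<And>(z::'a) \<nu> a h \<rho>. norm \<nu> = 1 \<Longrightarrow> 0 < h \<Longrightarrow> 0 < \<rho> \<Longrightarrow>
     emeasure lborel ({y. a \<le> (y - z) \<bullet> \<nu> \<and> (y - z) \<bullet> \<nu> \<le> a + h} \<inter> ball z \<rho>)
       \<le> ennreal (C0 * (h * \<rho> powr (d - 1)))"
    using slab_ball_volume[where 'a='a] unfolding d_def by blast
  define C where "C = 2 powr (d + s) / (1 - (1/2) powr (d + 1 - d - s)) * C0"
  have "(1/2) powr (d + 1 - d - s) < (1/2::real) powr 0"
    using s by (intro powr_less_mono') auto
  hence "0 < C" using C0(1) by (auto simp: C_def intro!: mult_pos_pos divide_pos_pos)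
  moreover have "emeasure (kernel_measure s z) ({y. y \<notin> ball c T \<and> 2 *\<^sub>R z - y \<notin> ball c T} \<inter> ball z r)
      \<le> ennreal (C * r powr (1 - s) / T)"
    if zc: "norm (z - c) = T" "0 < T" "0 < r" for z c :: 'a and T r
  proof -
    define \<nu> where "\<nu> = (c - z) /\<^sub>R T"
    have \<nu>: "norm \<nu> = 1" using zc by (simp add: \<nu>_def norm_minus_commute)
    define N where "N = {y. y \<notin> ball c T \<and> 2 *\<^sub>R z - y \<notin> ball c T}"
    have mN: "N \<in> sets borel" unfolding N_def ball_def mem_Collect_eq by measurable
    have "emeasure (kernel_measure s z) (N \<inter> ball z r)
      \<le> ennreal (2 powr (d + s) / (1 - (1/2) powr (d + 1 - d - s)) * (C0 / T) * r powr (d + 1 - d - s))"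
      unfolding d_def
    proof (rule kernel_measure_inner[OF mN])
      fix \<rho> :: real assume \<rho>: "0 < \<rho>"
      define h where "h = \<rho>\<^sup>2 / T"
      have h: "0 < h" using \<rho> zc by (simp add: h_def)
      define B where "B = {y. - (h / 2) \<le> (y - z) \<bullet> \<nu> \<and> (y - z) \<bullet> \<nu> \<le> - (h / 2) + h} \<inter> ball z \<rho>"
      have mB: "B \<in> sets lborel" unfolding B_def by measurable
      have "N \<inter> ball z \<rho> \<subseteq> B"
      proof
        fix y assume y: "y \<in> N \<inter> ball z \<rho>"
        have "\<bar>(y - z) \<bullet> \<nu>\<bar> \<le> (norm (y - z))\<^sup>2 / (2 * T)"
          unfolding \<nu>_def using y zc by (intro reflected_ball_complement) (auto simp: N_def)
        also have "\<dots> \<le> \<rho>\<^sup>2 / (2 * T)"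
          using y zc by (intro divide_right_mono power_mono) (auto simp: dist_norm norm_minus_commute)
        also have "\<dots> = h / 2" by (simp add: h_def)
        finally have "\<bar>(y - z) \<bullet> \<nu>\<bar> \<le> h / 2" .
        hence "- (h / 2) \<le> (y - z) \<bullet> \<nu>" "(y - z) \<bullet> \<nu> \<le> - (h / 2) + h" by linarith+
        thus "y \<in> B" using y unfolding B_def by blast
      qed
      hence "emeasure lborel (N \<inter> ball z \<rho>) \<le> emeasure lborel B"
        using mB by (rule emeasure_mono)
      also have "\<dots> \<le> ennreal (C0 * (h * \<rho> powr (d - 1)))"
        unfolding B_def using \<nu> h \<rho> by (rule C0(2))
      also have "h * \<rho> powr (d - 1) = \<rho> powr (d + 1) / T"
      proof -
        have "\<rho>\<^sup>2 * \<rho> powr (d - 1) = \<rho> powr 2 * \<rho> powr (d - 1)"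
          using \<rho> by simp
        also have "\<dots> = \<rho> powr (d + 1)" unfolding powr_add[symmetric] by (simp add: algebra_simps)
        finally show ?thesis by (simp add: h_def)
      qed
      finally show "emeasure lborel (N \<inter> ball z \<rho>) \<le> ennreal (C0 / T * \<rho> powr (real DIM('a) + 1))"
        by (simp add: d_def)
    qed (use zc C0 s in \<open>auto simp: d_def\<close>)
    thus ?thesis by (simp add: C_def N_def mult_ac)
  qed
  ultimately show ?thesis by blast
qed

lemma norm_orthogonal_part_le:
  fixes u \<nu> :: "'a::real_inner"
  assumes "norm \<nu> = 1"
  shows "norm (u - (u \<bullet> \<nu>) *\<^sub>R \<nu>) \<le> norm u"
proof -
  have nn: "\<nu> \<bullet> \<nu> = 1" using assms by (simp add: dot_square_norm)
  have "(norm (u - (u \<bullet> \<nu>) *\<^sub>R \<nu>))\<^sup>2 = (norm u)\<^sup>2 - (u \<bullet> \<nu>)\<^sup>2"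
    unfolding power2_norm_eq_inner
    by (simp add: inner_diff_left inner_diff_right inner_commute[of \<nu> u] nn power2_eq_square)
  hence "(norm (u - (u \<bullet> \<nu>) *\<^sub>R \<nu>))\<^sup>2 \<le> (norm u)\<^sup>2" by simp
  thus ?thesis by (rule power2_le_imp_le) simp
qed

text \<open>A covering argument, opposite to the packing for the upper bound: translates along
  \<open>\<nu>\<close> of the part of the strip with distance between \<open>r\<close> and
  \<open>3 * r\<close> from \<open>z\<close> cover a ball of radius \<open>r / 2\<close>, which
  bounds its volume from below. That ball is centred away from \<open>z\<close> in a direction
  orthogonal to \<open>\<nu>\<close>, which exists in dimension at least two.\<close>

lemma kernel_measure_slab_lower:
  assumes s: "0 < s" and dim: "2 \<le> DIM('a::euclidean_space)"
  shows "\<exists>c>0. \<forall>(z::'a) \<nu> t r. norm \<nu> = 1 \<longrightarrow> 0 < t \<longrightarrow> 0 < r \<longrightarrow>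
    ennreal (c * min t r * r powr (- 1 - s)) \<le>
      emeasure (kernel_measure s z) ({y. \<bar>(y - z) \<bullet> \<nu>\<bar> < t} - ball z r)"
proof -
  define d where "d = real DIM('a)"
  define \<omega> where "\<omega> = unit_ball_vol d"
  have \<omega>: "0 < \<omega>" by (simp add: \<omega>_def d_def)
  define c where "c = 3 powr - (d + s) * \<omega> * (1/2) powr d / 4"
  have "0 < c" using \<omega> by (simp add: c_def)
  moreover have "ennreal (c * min t r * r powr (- 1 - s)) \<le>
      emeasure (kernel_measure s z) ({y. \<bar>(y - z) \<bullet> \<nu>\<bar> < t} - ball z r)"
    if \<nu>: "norm \<nu> = 1" and t0: "0 < t0" "t0 \<le> t" "t0 = min t r" and r: "0 < r" for z \<nu> :: 'a and t r t0
  proof -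
    have t0r: "t0 \<le> r" using t0 by simp
    obtain e :: 'a where e0: "e \<noteq> 0" "orthogonal \<nu> e"
      using orthogonal_to_vector_exists[OF dim] by metis
    \<comment> \<open>With this length the part orthogonal to \<open>\<nu>\<close> of any point in
      the ball of radius \<open>r / 2\<close> around \<open>z + b\<close>, seen from
      \<open>z\<close>, has norm above \<open>r\<close>. Moving the point along \<open>\<nu>\<close>
      therefore never brings it into \<open>ball z r\<close>.\<close>
    define b where "b = (3 * r / 2 / norm e) *\<^sub>R e"
    have b: "norm b = 3 * r / 2" "b \<bullet> \<nu> = 0"
      using e0 r by (auto simp: b_def orthogonal_def inner_commute)
    have nn: "\<nu> \<bullet> \<nu> = 1" using \<nu> by (simp add: dot_square_norm)
    define S where "S = {y. 0 \<le> (y - z) \<bullet> \<nu> \<and> (y - z) \<bullet> \<nu> < t0} \<inter> (ball z (3 * r) - ball z r)"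
    have mS: "S \<in> sets borel" unfolding S_def by measurable
    define N where "N = nat \<lceil>r / (2 * t0)\<rceil>"
    have N1: "real N \<ge> r / (2 * t0)" unfolding N_def by linarith
    have "real N \<le> r / (2 * t0) + 1" unfolding N_def using r t0 
      by (smt (verit) divide_nonneg_pos of_int_ceiling_le_add_one of_nat_nat zero_le_ceiling ceiling_correct)
    hence N2: "real N * t0 \<le> 3 / 2 * r"
      using t0(1) t0r by (simp add: field_simps)
    define f where "f j = (\<lambda>x. (- (real_of_int j * t0) *\<^sub>R \<nu>) + x) -` S" for j
    have mf: "f j \<in> sets borel" for j
      unfolding f_def by (rule measurable_sets_borel[OF _ mS]) simp
    \<comment> \<open>Heights over the covered ball lie strictly between \<open>- r / 2\<close> and
      \<open>r / 2\<close>; these \<open>2 * N\<close> layers of thickness \<open>t0\<close> contain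
      them.\<close>
    define J where "J = {- int N..<int N}"
    have cover: "ball (z + b) (r / 2) \<subseteq> (\<Union>j\<in>J. f j)"
    proof
      fix x assume "x \<in> ball (z + b) (r / 2)"
      hence x: "norm (x - z - b) < r / 2" by (simp add: dist_norm norm_minus_commute algebra_simps)
      define X where "X = (x - z) \<bullet> \<nu>"
      have Xb: "X = (x - z - b) \<bullet> \<nu>" using b by (simp add: X_def inner_diff_left)
      have X: "\<bar>X\<bar> < r / 2"
        using Cauchy_Schwarz_ineq2[of "x - z - b" \<nu>] x \<nu> by (simp add: Xb)
      define j where "j = \<lfloor>X / t0\<rfloor>"
      have j: "real_of_int j * t0 \<le> X" "X < (real_of_int j + 1) * t0"
        using t0(1) floor_correct[of "X / t0"] unfolding j_def
        by (simp_all only: pos_le_divide_eq pos_divide_less_eq of_int_add of_int_1)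
      have "real N * t0 \<ge> r / 2" using N1 t0(1) by (simp add: field_simps)
      hence "real_of_int j * t0 < real N * t0" "- real N * t0 < (real_of_int j + 1) * t0"
        using j X by linarith+
      hence "real_of_int j < real N" "- real N < real_of_int j + 1"
        using t0(1) by (simp_all only: mult_less_cancel_right_pos)
      hence jJ: "j \<in> J" unfolding J_def by auto
      define w where "w = - (real_of_int j * t0) *\<^sub>R \<nu> + x - z"
      have w\<nu>: "w \<bullet> \<nu> = X - real_of_int j * t0"
        by (simp add: w_def X_def inner_diff_left inner_add_left nn)
      define q where "q = (x - z - b) - X *\<^sub>R \<nu>"
      have wq: "w - (w \<bullet> \<nu>) *\<^sub>R \<nu> = b + q"
        unfolding w\<nu> by (simp add: q_def w_def algebra_simps)
      have q: "norm q < r / 2"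
        using norm_orthogonal_part_le[OF \<nu>, of "x - z - b"] x by (simp add: q_def Xb)
      have "w - b = q + (w \<bullet> \<nu>) *\<^sub>R \<nu>"
        using wq by (simp add: algebra_simps)
      hence "norm (w - b) \<le> norm q + norm ((w \<bullet> \<nu>) *\<^sub>R \<nu>)"
        by (simp only: norm_triangle_ineq)
      moreover have "norm ((w \<bullet> \<nu>) *\<^sub>R \<nu>) \<le> t0" using j w\<nu> \<nu> by (simp add: algebra_simps)
      ultimately have "norm (w - b) < 3 / 2 * r" using q t0r by linarith
      hence w3: "norm w < 3 * r" using norm_triangle_ineq[of "w - b" b] b by simp
      have "norm b - norm q \<le> norm (b + q)"
        by (rule norm_diff_ineq)
      hence "r < norm (b + q)" using q b by linarith
      also have "norm (b + q) \<le> norm w"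
        unfolding wq[symmetric] by (rule norm_orthogonal_part_le[OF \<nu>])
      finally have wr: "r < norm w" .
      have "0 \<le> w \<bullet> \<nu>" "w \<bullet> \<nu> < t0" using j unfolding w\<nu> by (simp_all add: algebra_simps)
      hence "z + w \<in> S"
        using w3 wr by (simp add: S_def dist_norm)
      hence "- (real_of_int j * t0) *\<^sub>R \<nu> + x \<in> S" by (simp add: w_def)
      thus "x \<in> (\<Union>j\<in>J. f j)" using jJ by (auto simp: f_def)
    qed
    have "ennreal (\<omega> * (r / 2) powr d) = emeasure lborel (ball (z + b) (r / 2))"
      using r by (simp add: emeasure_ball \<omega>_def d_def powr_realpow)
    also have "\<dots> \<le> emeasure lborel (\<Union>j\<in>J. f j)"
      using cover mf by (intro emeasure_mono) (auto simp: J_def)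
    also have "\<dots> \<le> (\<Sum>j\<in>J. emeasure lborel (f j))"
      using mf by (intro emeasure_subadditive_finite) (auto simp: J_def)
    also have "\<dots> = (\<Sum>j\<in>J. emeasure lborel S)"
      unfolding f_def by (intro sum.cong refl emeasure_lborel_translate[OF mS])
    also have "\<dots> = ennreal (2 * real N) * emeasure lborel S"
      by (simp add: J_def ennreal_of_nat_eq_real_of_nat nat_mult_distrib mult_ac ennreal_mult)
    finally have volS: "ennreal (\<omega> * (r / 2) powr d) \<le> ennreal (2 * real N) * emeasure lborel S" .
    have Sfin: "emeasure lborel S \<noteq> \<infinity>"
    proof -
      have "emeasure lborel S \<le> emeasure lborel (ball z (3 * r))"
        by (intro emeasure_mono) (auto simp: S_def)
      thus ?thesis using r by (auto simp: emeasure_ball top_unique)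
    qed
    then obtain m where m: "m \<ge> 0" "emeasure lborel S = ennreal m"
      by (cases "emeasure lborel S") auto
    have "\<omega> * (r / 2) powr d \<le> 2 * real N * m"
      using volS m by (simp add: ennreal_mult[symmetric])
    hence "\<omega> * (r / 2) powr d * t0 \<le> 2 * (real N * t0) * m"
      using t0(1) by (simp add: mult_ac)
    also have "\<dots> \<le> 2 * (3 / 2 * r) * m"
      using N2 m by (intro mult_right_mono mult_left_mono) auto
    finally have "\<omega> * (r / 2) powr d * t0 \<le> 3 * r * m" by simp
    hence "\<omega> * (r / 2) powr d * t0 \<le> 4 * r * m" using m r mult_nonneg_nonneg[of r m] by linarith
    hence mlow: "\<omega> * (r / 2) powr d * t0 / (4 * r) \<le> m"
      using r by (simp add: field_simps)
    have "ennreal (c * min t r * r powr (- 1 - s)) =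
        ennreal ((3 * r) powr - (d + s)) * ennreal (\<omega> * (r / 2) powr d * t0 / (4 * r))"
    proof -
      have "r powr (- 1 - s) = r powr - (d + s) * (r powr d) * (r powr - 1)"
        unfolding powr_add[symmetric] by (simp add: algebra_simps)
      also have "r powr - 1 = 1 / r" using r by (simp add: powr_minus_divide)
      finally have "c * min t r * r powr (- 1 - s) = (3 * r) powr - (d + s) * (\<omega> * (r / 2) powr d * t0 / (4 * r))"
        using r by (simp add: c_def powr_mult powr_divide t0(3)[symmetric] mult_ac)
      thus ?thesis by (metis ennreal_mult' powr_ge_zero)
    qed
    also have "\<dots> \<le> ennreal ((3 * r) powr - (d + s)) * emeasure lborel S"
      using mlow m by (intro mult_left_mono) (auto intro: ennreal_leI)
    also have "\<dots> = (\<integral>\<^sup>+y. ennreal ((3 * r) powr - (d + s)) * indicator S y \<partial>lborel)"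
      using mS by (subst nn_integral_cmult_indicator) auto
    also have "\<dots> \<le> (\<integral>\<^sup>+y. ennreal (norm (z - y) powr - (d + s)) * indicator S y \<partial>lborel)"
    proof (intro nn_integral_mono)
      fix y
      show "ennreal ((3 * r) powr - (d + s)) * indicator S y \<le> ennreal (norm (z - y) powr - (d + s)) * indicator S y"
      proof (cases "y \<in> S")
        case True
        hence "r \<le> norm (z - y)" "norm (z - y) < 3 * r" by (auto simp: S_def dist_norm)
        hence "(3 * r) powr - (d + s) \<le> norm (z - y) powr - (d + s)"
          using r s by (intro powr_mono2') (auto simp: d_def)
        thus ?thesis by (intro mult_right_mono ennreal_leI) auto
      qed auto
    qed
    also have "\<dots> = emeasure (kernel_measure s z) S"
      unfolding d_def by (rule emeasure_kernel_measure[OF mS, symmetric])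
    also have "\<dots> \<le> emeasure (kernel_measure s z) ({y. \<bar>(y - z) \<bullet> \<nu>\<bar> < t} - ball z r)"
      using t0 by (intro emeasure_mono) (auto simp: S_def)
    finally show ?thesis .
  qed
  ultimately show ?thesis by (metis min.cobounded1 min_less_iff_conj)
qed

text \<open>Outside \<open>ball x r\<close> one has
  \<open>norm (z - y) \<le> (1 + K) * norm (x - y)\<close>, so the kernels are comparable there.
  This carries mass bounds from the contact point \<open>z\<close> of an exterior ball to the
  contact point \<open>x\<close> of an interior one.\<close>

lemma kernel_measure_change_center:
  fixes x z :: "'a::euclidean_space"
  assumes S: "S \<in> sets borel" and sub: "S \<inter> ball x r = {}" and r: "0 < r" and s: "0 < s"
    and xz: "norm (x - z) \<le> K * r" and K: "0 \<le> K"
  shows "emeasure (kernel_measure s x) S \<le> ennreal ((1 + K) powr (real DIM('a) + s)) * emeasure (kernel_measure s z) S"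
proof -
  define p where "p = real DIM('a) + s"
  have p: "0 < p" using s by (simp add: p_def add_nonneg_pos)
  have "emeasure (kernel_measure s x) S = (\<integral>\<^sup>+y. ennreal (norm (x - y) powr - p) * indicator S y \<partial>lborel)"
    unfolding p_def by (rule emeasure_kernel_measure[OF S])
  also have "\<dots> \<le> (\<integral>\<^sup>+y. ennreal ((1 + K) powr p) * (ennreal (norm (z - y) powr - p) * indicator S y) \<partial>lborel)"
  proof (rule nn_integral_mono_AE)
    \<comment> \<open>At \<open>y = z\<close> the kernel on the right is
      \<open>0 powr - p = 0\<close>, and the pointwise inequality can fail.\<close>
    have "AE y in lborel. y \<noteq> z" by (rule AE_lborel_singleton)
    thus "AE y in lborel. ennreal (norm (x - y) powr - p) * indicator S y \<le>
      ennreal ((1 + K) powr p) * (ennreal (norm (z - y) powr - p) * indicator S y)"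
    proof eventually_elim
      case (elim y)
      show ?case
      proof (cases "y \<in> S")
        case True
        hence ry: "r \<le> norm (x - y)" using sub by (auto simp: dist_norm)
        have "norm (z - y) \<le> norm (x - y) + norm (x - z)"
          using norm_triangle_ineq4[of "x - y" "x - z"] by simp
        also have "\<dots> \<le> norm (x - y) + K * norm (x - y)"
          using xz ry K by (smt (verit) mult_left_mono)
        finally have le: "norm (z - y) \<le> (1 + K) * norm (x - y)" by (simp add: algebra_simps)
        have "((1 + K) * norm (x - y)) powr - p \<le> norm (z - y) powr - p"
          using le elim p by (intro powr_mono2') auto
        moreover have "norm (x - y) powr - p = (1 + K) powr p * ((1 + K) * norm (x - y)) powr - p"
          using K by (simp add: powr_mult powr_minus)
        ultimately have "norm (x - y) powr - p \<le> (1 + K) powr p * norm (z - y) powr - p"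
          by (simp add: mult_left_mono)
        hence "ennreal (norm (x - y) powr - p) \<le> ennreal ((1 + K) powr p) * ennreal (norm (z - y) powr - p)"
          by (subst ennreal_mult'[symmetric]) (auto intro: ennreal_leI)
        thus ?thesis using True by simp
      qed auto
    qed
  qed
  also have "\<dots> = ennreal ((1 + K) powr p) * (\<integral>\<^sup>+y. ennreal (norm (z - y) powr - p) * indicator S y \<partial>lborel)"
    using S by (intro nn_integral_cmult) simp
  also have "(\<integral>\<^sup>+y. ennreal (norm (z - y) powr - p) * indicator S y \<partial>lborel) = emeasure (kernel_measure s z) S"
    unfolding p_def by (rule emeasure_kernel_measure[OF S, symmetric])
  finally show ?thesis by (simp add: p_def)
qed

section \<open>Touching balls\<close>

text \<open>Without the small ball the total mass is finite, so masses can be subtracted as real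
  numbers; the untruncated kernel then gives bounds uniform in \<open>\<epsilon>\<close>.\<close>

definition truncated_kernel_measure :: "real \<Rightarrow> 'a::euclidean_space \<Rightarrow> real \<Rightarrow> 'a measure" where
  "truncated_kernel_measure s z \<epsilon> =
     density lborel (\<lambda>y. ennreal (indicator (- ball z \<epsilon>) y * norm (z - y) powr - (real DIM('a) + s)))"

lemma sets_truncated_kernel_measure [simp, measurable_cong]:
  "sets (truncated_kernel_measure s z \<epsilon>) = sets borel"
  by (simp add: truncated_kernel_measure_def)

lemma space_truncated_kernel_measure [simp]: "space (truncated_kernel_measure s z \<epsilon>) = UNIV"
  by (simp add: truncated_kernel_measure_def)

lemma emeasure_truncated_kernel_measure:
  fixes z :: "'a::euclidean_space"
  assumes A: "A \<in> sets borel"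
  shows "emeasure (truncated_kernel_measure s z \<epsilon>) A = emeasure (kernel_measure s z) (A - ball z \<epsilon>)"
proof -
  have "emeasure (truncated_kernel_measure s z \<epsilon>) A =
    (\<integral>\<^sup>+y. ennreal (indicator (- ball z \<epsilon>) y * norm (z - y) powr - (real DIM('a) + s)) * indicator A y \<partial>lborel)"
    unfolding truncated_kernel_measure_def using A by (subst emeasure_density) auto
  also have "\<dots> = (\<integral>\<^sup>+y. ennreal (norm (z - y) powr - (real DIM('a) + s)) * indicator (A - ball z \<epsilon>) y \<partial>lborel)"
    by (intro nn_integral_cong) (simp split: split_indicator)
  also have "\<dots> = emeasure (kernel_measure s z) (A - ball z \<epsilon>)"
    using A by (intro emeasure_kernel_measure[symmetric]) simp
  finally show ?thesis .
qed

lemma emeasure_truncated_kernel_measure_le: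
  assumes "A \<in> sets borel"
  shows "emeasure (truncated_kernel_measure s z \<epsilon>) A \<le> emeasure (kernel_measure s z) A"
  unfolding emeasure_truncated_kernel_measure[OF assms] using assms by (intro emeasure_mono) auto

lemma kernel_measure_null_sets:
  fixes A :: "'a::euclidean_space set"
  assumes "A \<in> null_sets lborel"
  shows "emeasure (kernel_measure s z) A = 0"
  using assms by (subst emeasure_kernel_measure) (auto intro: nn_integral_null_set)

lemma finite_truncated_kernel_measure:
  fixes z :: "'a::euclidean_space"
  assumes "0 < s" "0 < \<epsilon>"
  shows "finite_measure (truncated_kernel_measure s z \<epsilon>)"
proof
  obtain C where "emeasure (kernel_measure s z) (- ball z \<epsilon>) \<le> ennreal (C * \<epsilon> powr - s)"
    using kernel_measure_tail[where 'a='a, OF assms(1)] assms(2) by blast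
  thus "emeasure (truncated_kernel_measure s z \<epsilon>) (space (truncated_kernel_measure s z \<epsilon>)) \<noteq> \<infinity>"
    by (auto simp: emeasure_truncated_kernel_measure Compl_eq_Diff_UNIV top_unique)
qed

lemma truncated_frac_mean_curvature_eq:
  fixes E :: "'a::euclidean_space set" and z :: 'a
  assumes E: "E \<in> sets borel" and "0 < s" "0 < \<epsilon>"
  defines "M \<equiv> truncated_kernel_measure s z \<epsilon>"
  shows "truncated_frac_mean_curvature s E z \<epsilon> = measure M UNIV - 2 * measure M E"
proof -
  interpret finite_measure M
    unfolding M_def using assms by (intro finite_truncated_kernel_measure)
  define g where "g y = indicator (- ball z \<epsilon>) y * norm (z - y) powr - (real DIM('a) + s)" for y
  have g: "g \<in> borel_measurable borel" unfolding g_def by simp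
  define f :: "'a \<Rightarrow> real" where "f y = indicator (- E) y - indicator E y" for y
  have f: "f \<in> borel_measurable borel" unfolding f_def using E by simp
  have M: "M = density lborel (\<lambda>y. ennreal (g y))"
    by (simp add: M_def truncated_kernel_measure_def g_def)
  have "truncated_frac_mean_curvature s E z \<epsilon> = (LINT y|lebesgue. g y *\<^sub>R f y)"
    unfolding truncated_frac_mean_curvature_def set_lebesgue_integral_def
    unfolding g_def f_def powr_minus
    by (intro Bochner_Integration.integral_cong) (simp_all add: divide_inverse mult_ac)
  also have "\<dots> = (LINT y|lborel. g y *\<^sub>R f y)"
    using f g by (intro integral_completion) simp
  also have "\<dots> = (LINT y|M. f y)"
    unfolding M using f g by (intro integral_density[symmetric]) (auto simp: g_def)
  also have "\<dots> = measure M (- E) - measure M E"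
    unfolding f_def using E by (subst Bochner_Integration.integral_diff) (auto simp: M_def less_top[symmetric] emeasure_finite[unfolded M_def])
  also have "measure M (- E) = measure M UNIV - measure M E"
    using finite_measure_compl[of E] E by (simp add: M_def Compl_eq_Diff_UNIV)
  finally show ?thesis by simp
qed

text \<open>Odd symmetrisation under the reflection \<open>y \<mapsto> 2 z - y\<close>: only points whose reflection lies
  on the same side contribute.\<close>

lemma truncated_kernel_measure_symmetrize:
  fixes z :: "'a::euclidean_space"
  assumes s: "0 < s" "0 < \<epsilon>" and G: "G \<in> sets borel" and B: "B \<in> sets borel"
    and Bsym: "(\<lambda>y. 2 *\<^sub>R z - y) -` B = B" and disj: "\<And>y. y \<in> G \<Longrightarrow> 2 *\<^sub>R z - y \<notin> G"
  defines "M \<equiv> truncated_kernel_measure s z \<epsilon>"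
  shows "measure M B - 2 * measure M (G \<inter> B) = measure M ({y. y \<notin> G \<and> 2 *\<^sub>R z - y \<notin> G} \<inter> B)"
proof -
  interpret finite_measure M
    unfolding M_def using s by (intro finite_truncated_kernel_measure)
  have sM[simp]: "sets M = sets borel" by (simp add: M_def)
  define R where "R = (\<lambda>y. 2 *\<^sub>R z - y)"
  have mR: "R -` A \<in> sets borel" if "A \<in> sets borel" for A
    unfolding R_def by (rule measurable_sets_borel[OF _ that]) simp
  have ball: "R -` ball z \<epsilon> = ball z \<epsilon>"
    by (auto simp: R_def dist_norm scaleR_2 algebra_simps norm_minus_commute)
  have refl: "measure M (R -` A) = measure M A" if "A \<in> sets borel" for A
  proof -
    have "emeasure M (R -` A) = emeasure (kernel_measure s z) (R -` A - R -` ball z \<epsilon>)"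
      unfolding M_def ball by (rule emeasure_truncated_kernel_measure[OF mR[OF that]])
    also have "\<dots> = emeasure (kernel_measure s z) (R -` (A - ball z \<epsilon>))"
      by (simp add: vimage_Diff)
    also have "\<dots> = emeasure (kernel_measure s z) (A - ball z \<epsilon>)"
      unfolding R_def using that by (intro kernel_measure_reflect) simp
    also have "\<dots> = emeasure M A"
      unfolding M_def by (rule emeasure_truncated_kernel_measure[OF that, symmetric])
    finally show ?thesis by (simp add: measure_def)
  qed
  have N: "{y. y \<notin> G \<and> 2 *\<^sub>R z - y \<notin> G} = - (G \<union> R -` G)" by (auto simp: R_def)
  have "measure M B = measure M (B \<inter> (G \<union> R -` G)) + measure M (B - (G \<union> R -` G))"
    using B G mR by (subst finite_measure_Union[symmetric]) (auto simp: Int_Diff_Un)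
  also have "B - (G \<union> R -` G) = {y. y \<notin> G \<and> 2 *\<^sub>R z - y \<notin> G} \<inter> B" unfolding N by auto
  also have "measure M (B \<inter> (G \<union> R -` G)) = measure M (G \<inter> B) + measure M (R -` (G \<inter> B))"
  proof -
    have "B \<inter> (G \<union> R -` G) = (G \<inter> B) \<union> R -` (G \<inter> B)"
      using Bsym by (auto simp: R_def)
    thus ?thesis using B G mR[of "G \<inter> B"] disj
      by (subst finite_measure_Union[symmetric]) (auto simp: R_def)
  qed
  also have "measure M (R -` (G \<inter> B)) = measure M (G \<inter> B)"
    using B G by (intro refl) auto
  finally show ?thesis by simp
qed

text \<open>The preceding identity for \<open>- G\<close>. It serves half-spaces with
  \<open>z\<close> in the interior: the points that stay inside together with their reflection form
  a strip, and its mass enters with a negative sign.\<close>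

lemma truncated_kernel_measure_symmetrize_dual:
  fixes z :: "'a::euclidean_space"
  assumes s: "0 < s" "0 < \<epsilon>" and G: "G \<in> sets borel" and B: "B \<in> sets borel"
    and Bsym: "(\<lambda>y. 2 *\<^sub>R z - y) -` B = B" and cover: "\<And>y. y \<notin> G \<Longrightarrow> 2 *\<^sub>R z - y \<in> G"
  defines "M \<equiv> truncated_kernel_measure s z \<epsilon>"
  shows "measure M B - 2 * measure M (G \<inter> B) = - measure M ({y. y \<in> G \<and> 2 *\<^sub>R z - y \<in> G} \<inter> B)"
proof -
  interpret finite_measure M
    unfolding M_def using s by (intro finite_truncated_kernel_measure)
  have "measure M B - 2 * measure M (- G \<inter> B) =
      measure M ({y. y \<notin> - G \<and> 2 *\<^sub>R z - y \<notin> - G} \<inter> B)"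
    unfolding M_def using assms by (intro truncated_kernel_measure_symmetrize) auto
  moreover have "measure M B = measure M (G \<inter> B) + measure M (- G \<inter> B)"
    using B G by (subst finite_measure_Union[symmetric])
      (auto simp: M_def intro!: arg_cong[where f = "measure _"])
  ultimately show ?thesis by simp
qed

lemma reflect_ball: "(\<lambda>y. 2 *\<^sub>R z - y) -` ball z r = ball (z::'a::real_normed_vector) r"
  by (auto simp: dist_norm scaleR_2 algebra_simps norm_minus_commute)

lemma reflect_half_space:
  fixes z y \<nu> :: "'a::real_inner"
  shows "(2 *\<^sub>R z - y - z) \<bullet> \<nu> = - ((y - z) \<bullet> \<nu>)"
  by (simp add: scaleR_2 inner_diff_left)

lemma ball_reflection_disjoint:
  fixes c z y :: "'a::real_inner"
  assumes "norm (z - c) = T" "y \<in> ball c T"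
  shows "2 *\<^sub>R z - y \<notin> ball c T"
proof
  assume "2 *\<^sub>R z - y \<in> ball c T"
  hence "norm ((2 *\<^sub>R z - y) - c) < T" "norm (y - c) < T"
    using assms(2) by (auto simp: dist_norm norm_minus_commute)
  moreover have "norm (2 *\<^sub>R (z - c)) \<le> norm ((2 *\<^sub>R z - y) - c) + norm (y - c)"
    using norm_triangle_ineq[of "(2 *\<^sub>R z - y) - c" "y - c"] by (simp add: scaleR_2 algebra_simps)
  ultimately show False using assms(1) by simp
qed

section \<open>The curvature equation at contact points\<close>

text \<open>\<open>E\<close> is compared with the set that is the ball inside
  \<open>ball z r\<close> and the half-space outside. Symmetrised separately, the ball leaves its
  curvature term and the half-space leaves minus the mass of a strip; half-space points missing from
  \<open>E\<close> cost \<open>2 * B\<close>. The half-space enters only through this mass, so it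
  can be \<open>H\<close> as well as a tangent half-space.\<close>

lemma inner_touching_ball:
  assumes s: "0 < s" "s < 1" and dim: "2 \<le> DIM('a::euclidean_space)"
  shows "\<exists>c0>0. \<exists>C>0. \<forall>(E::'a set) z c T \<nu> t r B.
    E \<in> sets borel \<longrightarrow> has_frac_mean_curvature s E z 0 \<longrightarrow> ball c T - E \<in> null_sets lborel \<longrightarrow>
    norm (z - c) = T \<longrightarrow> 0 < T \<longrightarrow> norm \<nu> = 1 \<longrightarrow> 0 < t \<longrightarrow> 0 < r \<longrightarrow> 0 \<le> B \<longrightarrow>
    emeasure (kernel_measure s z) ({y. (y - z) \<bullet> \<nu> < t} - E - ball z r) \<le> ennreal B \<longrightarrow>
    c0 * min t r * r powr (- 1 - s) \<le> C * r powr (1 - s) / T + 2 * B"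
proof -
  obtain c0 where c0: "0 < c0" "\<And>(z::'a) \<nu> t r. norm \<nu> = 1 \<Longrightarrow> 0 < t \<Longrightarrow> 0 < r \<Longrightarrow>
    ennreal (c0 * min t r * r powr (- 1 - s)) \<le>
      emeasure (kernel_measure s z) ({y. \<bar>(y - z) \<bullet> \<nu>\<bar> < t} - ball z r)"
    using kernel_measure_slab_lower[OF s(1) dim] by blast
  obtain C where C: "0 < C" "\<And>(z::'a) c T r. norm (z - c) = T \<Longrightarrow> 0 < T \<Longrightarrow> 0 < r \<Longrightarrow>
    emeasure (kernel_measure s z) ({y. y \<notin> ball c T \<and> 2 *\<^sub>R z - y \<notin> ball c T} \<inter> ball z r)
      \<le> ennreal (C * r powr (1 - s) / T)"
    using kernel_measure_ball_curvature[OF s, where 'a='a] by blast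
  have "c0 * min t r * r powr (- 1 - s) \<le> C * r powr (1 - s) / T + 2 * B"
    if E: "E \<in> sets borel" and curv: "has_frac_mean_curvature s E z 0"
      and null: "ball c T - E \<in> null_sets lborel" and zc: "norm (z - c) = T" "0 < T"
      and \<nu>: "norm \<nu> = 1" and t: "0 < t" and r: "0 < r" and B0: "0 \<le> B"
      and B: "emeasure (kernel_measure s z) ({y. (y - z) \<bullet> \<nu> < t} - E - ball z r) \<le> ennreal B"
    for E :: "'a set" and z c \<nu> and T t r B
  proof -
    define Q where "Q = C * r powr (1 - s) / T + 2 * B - c0 * min t r * r powr (- 1 - s)"
    have key: "truncated_frac_mean_curvature s E z \<epsilon> \<le> Q" if \<epsilon>: "0 < \<epsilon>" "\<epsilon> < r" for \<epsilon>
    proof -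
      define M where "M = truncated_kernel_measure s z \<epsilon>"
      interpret finite_measure M
        unfolding M_def using s \<epsilon> by (intro finite_truncated_kernel_measure)
      have sM[simp]: "sets M = sets borel" by (simp add: M_def)
      define D where "D = ball z r"
      define G where "G = ball c T"
      define H where "H = {y. (y - z) \<bullet> \<nu> < t}"
      have mD[simp]: "D \<in> sets borel" and mG[simp]: "G \<in> sets borel" by (simp_all add: D_def G_def)
      have mH[simp]: "H \<in> sets borel" unfolding H_def by measurable
      note [simp] = E sets.Diff sets.Un sets.Int borel_comp
      have "emeasure M (G - E) \<le> emeasure (kernel_measure s z) (G - E)"
        unfolding M_def using E by (intro emeasure_truncated_kernel_measure_le) auto
      hence GE: "measure M (G - E) = 0"
        using kernel_measure_null_sets[OF null] by (simp add: G_def measure_def)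
      have "measure M (G \<inter> D) \<le> measure M ((E \<inter> D) \<union> (G - E))"
        using E by (intro finite_measure_mono) auto
      also have "\<dots> \<le> measure M (E \<inter> D) + measure M (G - E)"
        using E by (intro measure_Un_le) auto
      finally have 1: "measure M (G \<inter> D) \<le> measure M (E \<inter> D)" using GE by simp
      have "measure M (H \<inter> - D) \<le> measure M ((E \<inter> - D) \<union> (H - E - D))"
        using E by (intro finite_measure_mono) auto
      also have "\<dots> \<le> measure M (E \<inter> - D) + measure M (H - E - D)"
        using E by (intro measure_Un_le) auto
      finally have 2: "measure M (H \<inter> - D) \<le> measure M (E \<inter> - D) + measure M (H - E - D)" .
      have 3: "measure M D - 2 * measure M (G \<inter> D) = measure M ({y. y \<notin> G \<and> 2 *\<^sub>R z - y \<notin> G} \<inter> D)"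
        unfolding M_def
      proof (intro truncated_kernel_measure_symmetrize)
        show "2 *\<^sub>R z - y \<notin> G" if "y \<in> G" for y
          using ball_reflection_disjoint[OF zc(1)] that by (simp add: G_def)
      qed (use s \<epsilon> in \<open>auto simp: D_def reflect_ball\<close>)
      have mN: "{y. y \<notin> G \<and> 2 *\<^sub>R z - y \<notin> G} \<in> sets borel"
        unfolding G_def ball_def mem_Collect_eq by measurable
      have "emeasure M ({y. y \<notin> G \<and> 2 *\<^sub>R z - y \<notin> G} \<inter> D) \<le>
          emeasure (kernel_measure s z) ({y. y \<notin> G \<and> 2 *\<^sub>R z - y \<notin> G} \<inter> D)"
        unfolding M_def using mN by (intro emeasure_truncated_kernel_measure_le) simp
      also have "\<dots> \<le> ennreal (C * r powr (1 - s) / T)"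
        unfolding G_def D_def using zc r by (rule C(2))
      finally have 4: "measure M ({y. y \<notin> G \<and> 2 *\<^sub>R z - y \<notin> G} \<inter> D) \<le> C * r powr (1 - s) / T"
        using C(1) zc by (simp add: emeasure_eq_measure)
      have 5: "measure M (- D) - 2 * measure M (H \<inter> - D) = - measure M ({y. y \<in> H \<and> 2 *\<^sub>R z - y \<in> H} \<inter> - D)"
        unfolding M_def
      proof (intro truncated_kernel_measure_symmetrize_dual)
        show "2 *\<^sub>R z - y \<in> H" if "y \<notin> H" for y
          using that t by (simp add: H_def reflect_half_space)
      qed (use s \<epsilon> reflect_ball[of z r] in \<open>auto simp: D_def vimage_Compl\<close>)
      have "ennreal (c0 * min t r * r powr (- 1 - s)) \<le>
          emeasure (kernel_measure s z) ({y. \<bar>(y - z) \<bullet> \<nu>\<bar> < t} - D)"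
        unfolding D_def using \<nu> t r by (rule c0(2))
      also have "{y. \<bar>(y - z) \<bullet> \<nu>\<bar> < t} - D = ({y. y \<in> H \<and> 2 *\<^sub>R z - y \<in> H} \<inter> - D) - ball z \<epsilon>"
        using \<epsilon> by (auto simp: H_def reflect_half_space D_def)
      also have "emeasure (kernel_measure s z) \<dots> = emeasure M ({y. y \<in> H \<and> 2 *\<^sub>R z - y \<in> H} \<inter> - D)"
      proof -
        have "{y. y \<in> H \<and> 2 *\<^sub>R z - y \<in> H} \<in> sets borel"
          unfolding H_def mem_Collect_eq by measurable
        thus ?thesis unfolding M_def by (intro emeasure_truncated_kernel_measure[symmetric]) simp
      qed
      finally have 6: "c0 * min t r * r powr (- 1 - s) \<le> measure M ({y. y \<in> H \<and> 2 *\<^sub>R z - y \<in> H} \<inter> - D)"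
        by (simp add: emeasure_eq_measure)
      have "emeasure M (H - E - D) \<le> emeasure (kernel_measure s z) (H - E - D)"
        unfolding M_def using E by (intro emeasure_truncated_kernel_measure_le) auto
      also have "\<dots> \<le> ennreal B" using B by (simp add: H_def D_def)
      finally have 7: "measure M (H - E - D) \<le> B" using B0 by (simp add: emeasure_eq_measure)
      have 8: "measure M E = measure M (E \<inter> D) + measure M (E \<inter> - D)"
        using E by (subst finite_measure_Union[symmetric]) (auto intro!: arg_cong[where f = "measure _"])
      have 9: "measure M UNIV = measure M D + measure M (- D)"
        by (subst finite_measure_Union[symmetric]) auto
      have "truncated_frac_mean_curvature s E z \<epsilon> = measure M UNIV - 2 * measure M E"
        unfolding M_def using E s \<epsilon> by (intro truncated_frac_mean_curvature_eq)
      thus ?thesis using 1 2 3 4 5 6 7 8 9 unfolding Q_def by linarith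
    qed
    have "0 \<le> Q"
    proof (rule tendsto_upperbound)
      show "(truncated_frac_mean_curvature s E z \<longlongrightarrow> 0) (at_right 0)"
        using curv by (simp add: has_frac_mean_curvature_def)
      show "\<forall>\<^sub>F \<epsilon> in at_right 0. truncated_frac_mean_curvature s E z \<epsilon> \<le> Q"
        using eventually_at_right_less[of 0] eventually_at_right_field[of _ 0]
        by (auto simp: eventually_at_right_field intro!: exI[of _ r] r key)
    qed simp
    thus ?thesis by (simp add: Q_def)
  qed
  thus ?thesis using c0(1) C(1) by blast
qed

text \<open>The comparison set is the complement of the ball near \<open>z\<close> and the
  half-space far away. It contains \<open>E\<close>, so the equation is an exact balance: twice the
  truncated mass of the missing set \<open>X\<close> is the truncated curvature plus the curvature
  term of the ball plus the mass of the strip. The resulting bound reaches up to the singularity,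
  and this finiteness will decide on which side of the surface \<open>E\<close> lies.\<close>

lemma outer_touching_ball:
  assumes s: "0 < s" "s < 1"
  shows "\<exists>C>0. \<forall>(E::'a::euclidean_space set) z c T \<nu> t r.
    E \<in> sets borel \<longrightarrow> has_frac_mean_curvature s E z 0 \<longrightarrow> E \<inter> ball c T = {} \<longrightarrow>
    norm (z - c) = T \<longrightarrow> 0 < T \<longrightarrow> norm \<nu> = 1 \<longrightarrow> 0 < t \<longrightarrow> 0 < r \<longrightarrow> E \<subseteq> {y. (y - z) \<bullet> \<nu> < t} \<longrightarrow>
    emeasure (kernel_measure s z) ((- ball c T - E) \<inter> ball z r)
        \<le> ennreal (C * (r powr (1 - s) / T + t * r powr (- 1 - s))) \<and>
    emeasure (kernel_measure s z) ({y. (y - z) \<bullet> \<nu> < t} - E - ball z r)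
        \<le> ennreal (C * (r powr (1 - s) / T + t * r powr (- 1 - s)))"
proof -
  obtain C1 where C1: "0 < C1" "\<And>(z::'a) \<nu> a h r. norm \<nu> = 1 \<Longrightarrow> 0 < h \<Longrightarrow> 0 < r \<Longrightarrow>
    emeasure (kernel_measure s z) ({y. a \<le> (y - z) \<bullet> \<nu> \<and> (y - z) \<bullet> \<nu> \<le> a + h} - ball z r)
      \<le> ennreal (C1 * h * r powr (- 1 - s))"
    using kernel_measure_slab_outer[OF s(1), where 'a='a] by blast
  obtain C2 where C2: "0 < C2" "\<And>(z::'a) c T r. norm (z - c) = T \<Longrightarrow> 0 < T \<Longrightarrow> 0 < r \<Longrightarrow>
    emeasure (kernel_measure s z) ({y. y \<notin> ball c T \<and> 2 *\<^sub>R z - y \<notin> ball c T} \<inter> ball z r)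
      \<le> ennreal (C2 * r powr (1 - s) / T)"
    using kernel_measure_ball_curvature[OF s, where 'a='a] by blast
  define C where "C = 2 * C1 + C2"
  have main: "emeasure (kernel_measure s z) ((- ball c T - E) \<inter> ball z r \<union> ({y. (y - z) \<bullet> \<nu> < t} - E - ball z r))
        \<le> ennreal (C * (r powr (1 - s) / T + t * r powr (- 1 - s)))"
    if E: "E \<in> sets borel" and curv: "has_frac_mean_curvature s E z 0"
      and disj: "E \<inter> ball c T = {}" and zc: "norm (z - c) = T" "0 < T"
      and \<nu>: "norm \<nu> = 1" and t: "0 < t" and r: "0 < r" and EH: "E \<subseteq> {y. (y - z) \<bullet> \<nu> < t}"
    for E :: "'a set" and z c \<nu> and T t r
  proof -
    define D where "D = ball z r"
    define G where "G = ball c T"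
    define H where "H = {y. (y - z) \<bullet> \<nu> < t}"
    define X where "X = (- G - E) \<inter> D \<union> (H - E - D)"
    define Q where "Q = C2 * r powr (1 - s) / T + C1 * (2 * t) * r powr (- 1 - s)"
    have mD[simp]: "D \<in> sets borel" and mG[simp]: "G \<in> sets borel" by (simp_all add: D_def G_def)
    have mH[simp]: "H \<in> sets borel" unfolding H_def by measurable
    note [simp] = E sets.Diff sets.Un sets.Int borel_comp
    have mX[simp]: "X \<in> sets borel" by (simp add: X_def)
    have Q0: "0 \<le> Q" using C1(1) C2(1) t zc by (simp add: Q_def)
    have key: "2 * measure (truncated_kernel_measure s z \<epsilon>) X
        \<le> truncated_frac_mean_curvature s E z \<epsilon> + Q" if \<epsilon>: "0 < \<epsilon>" "\<epsilon> < r" for \<epsilon>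
    proof -
      define M where "M = truncated_kernel_measure s z \<epsilon>"
      interpret finite_measure M
        unfolding M_def using s \<epsilon> by (intro finite_truncated_kernel_measure)
      have sM[simp]: "sets M = sets borel" by (simp add: M_def)
      have 1: "measure M D = measure M (G \<inter> D) + measure M (E \<inter> D) + measure M ((- G - E) \<inter> D)"
      proof -
        have "measure M (G \<inter> D) + measure M (E \<inter> D) + measure M ((- G - E) \<inter> D) =
           measure M ((G \<inter> D \<union> E \<inter> D) \<union> (- G - E) \<inter> D)"
          using E disj by (subst finite_measure_Union, simp, simp, force, subst finite_measure_Union)
            (auto simp: G_def)
        also have "(G \<inter> D \<union> E \<inter> D) \<union> (- G - E) \<inter> D = D" by auto
        finally show ?thesis ..
      qed
      have 2: "measure M (H \<inter> - D) = measure M (E \<inter> - D) + measure M (H - E - D)"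
        using E EH by (subst finite_measure_Union[symmetric])
          (auto simp: H_def intro!: arg_cong[where f = "measure _"])
      have 3: "measure M D - 2 * measure M (G \<inter> D) = measure M ({y. y \<notin> G \<and> 2 *\<^sub>R z - y \<notin> G} \<inter> D)"
        unfolding M_def
      proof (intro truncated_kernel_measure_symmetrize)
        show "2 *\<^sub>R z - y \<notin> G" if "y \<in> G" for y
          using ball_reflection_disjoint[OF zc(1)] that by (simp add: G_def)
      qed (use s \<epsilon> in \<open>auto simp: D_def reflect_ball\<close>)
      have mN: "{y. y \<notin> G \<and> 2 *\<^sub>R z - y \<notin> G} \<in> sets borel"
        unfolding G_def ball_def mem_Collect_eq by measurable
      have "emeasure M ({y. y \<notin> G \<and> 2 *\<^sub>R z - y \<notin> G} \<inter> D) \<le>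
          emeasure (kernel_measure s z) ({y. y \<notin> G \<and> 2 *\<^sub>R z - y \<notin> G} \<inter> D)"
        unfolding M_def using mN by (intro emeasure_truncated_kernel_measure_le) simp
      also have "\<dots> \<le> ennreal (C2 * r powr (1 - s) / T)"
        unfolding G_def D_def using zc r by (rule C2(2))
      finally have 4: "measure M ({y. y \<notin> G \<and> 2 *\<^sub>R z - y \<notin> G} \<inter> D) \<le> C2 * r powr (1 - s) / T"
        using C2(1) zc by (simp add: emeasure_eq_measure)
      have 5: "measure M (- D) - 2 * measure M (H \<inter> - D) = - measure M ({y. y \<in> H \<and> 2 *\<^sub>R z - y \<in> H} \<inter> - D)"
        unfolding M_def
      proof (intro truncated_kernel_measure_symmetrize_dual)
        show "2 *\<^sub>R z - y \<in> H" if "y \<notin> H" for y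
          using that t by (simp add: H_def reflect_half_space)
      qed (use s \<epsilon> reflect_ball[of z r] in \<open>auto simp: D_def vimage_Compl\<close>)
      have mS: "{y. y \<in> H \<and> 2 *\<^sub>R z - y \<in> H} \<in> sets borel"
        unfolding H_def mem_Collect_eq by measurable
      have "emeasure M ({y. y \<in> H \<and> 2 *\<^sub>R z - y \<in> H} \<inter> - D) \<le>
          emeasure (kernel_measure s z) ({y. y \<in> H \<and> 2 *\<^sub>R z - y \<in> H} \<inter> - D)"
        unfolding M_def using mS by (intro emeasure_truncated_kernel_measure_le) simp
      also have "\<dots> \<le> emeasure (kernel_measure s z) ({y. - t \<le> (y - z) \<bullet> \<nu> \<and> (y - z) \<bullet> \<nu> \<le> - t + 2 * t} - D)"
      proof (rule emeasure_mono)
        show "{y. y \<in> H \<and> 2 *\<^sub>R z - y \<in> H} \<inter> - D \<subseteq> {y. - t \<le> (y - z) \<bullet> \<nu> \<and> (y - z) \<bullet> \<nu> \<le> - t + 2 * t} - D"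
          by (auto simp: H_def reflect_half_space)
        have "{y. - t \<le> (y - z) \<bullet> \<nu> \<and> (y - z) \<bullet> \<nu> \<le> - t + 2 * t} \<in> sets borel" by measurable
        thus "{y. - t \<le> (y - z) \<bullet> \<nu> \<and> (y - z) \<bullet> \<nu> \<le> - t + 2 * t} - D \<in> sets (kernel_measure s z)"
          by simp
      qed
      also have "\<dots> \<le> ennreal (C1 * (2 * t) * r powr (- 1 - s))"
        unfolding D_def using \<nu> t r by (intro C1(2)) auto
      finally have 6: "measure M ({y. y \<in> H \<and> 2 *\<^sub>R z - y \<in> H} \<inter> - D) \<le> C1 * (2 * t) * r powr (- 1 - s)"
        using C1(1) t by (simp add: emeasure_eq_measure)
      have 7: "measure M X = measure M ((- G - E) \<inter> D) + measure M (H - E - D)"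
        unfolding X_def using E by (subst finite_measure_Union) auto
      have 8: "measure M E = measure M (E \<inter> D) + measure M (E \<inter> - D)"
        using E by (subst finite_measure_Union[symmetric]) (auto intro!: arg_cong[where f = "measure _"])
      have 9: "measure M UNIV = measure M D + measure M (- D)"
        by (subst finite_measure_Union[symmetric]) auto
      have "truncated_frac_mean_curvature s E z \<epsilon> = measure M UNIV - 2 * measure M E"
        unfolding M_def using E s \<epsilon> by (intro truncated_frac_mean_curvature_eq)
      thus ?thesis using 1 2 3 4 5 6 7 8 9 unfolding Q_def M_def[symmetric] by linarith
    qed
    \<comment> \<open>Two radii are needed. The mass of \<open>X\<close> outside a fixed
      \<open>\<delta>\<close> is at most that outside any smaller \<open>\<epsilon>\<close>, so
      letting \<open>\<epsilon>\<close> tend to zero with \<open>\<delta>\<close> fixed uses the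
      vanishing principal value.\<close>
    have trunc: "emeasure (kernel_measure s z) (X - ball z \<delta>) \<le> ennreal Q" if \<delta>: "0 < \<delta>" for \<delta>
    proof -
      interpret finite_measure "truncated_kernel_measure s z \<delta>"
        using s \<delta> by (intro finite_truncated_kernel_measure)
      have "2 * measure (truncated_kernel_measure s z \<delta>) X \<le> 0 + Q"
      proof (rule tendsto_lowerbound)
        show "((\<lambda>\<epsilon>. truncated_frac_mean_curvature s E z \<epsilon> + Q) \<longlongrightarrow> 0 + Q) (at_right 0)"
          using curv by (intro tendsto_add tendsto_const) (simp add: has_frac_mean_curvature_def)
        have "2 * measure (truncated_kernel_measure s z \<delta>) X \<le> truncated_frac_mean_curvature s E z \<epsilon> + Q"
          if \<epsilon>: "0 < \<epsilon>" "\<epsilon> < min r \<delta>" for \<epsilon>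
        proof -
          interpret e: finite_measure "truncated_kernel_measure s z \<epsilon>"
            using s \<epsilon> by (intro finite_truncated_kernel_measure)
          have "emeasure (truncated_kernel_measure s z \<delta>) X \<le> emeasure (truncated_kernel_measure s z \<epsilon>) X"
            unfolding emeasure_truncated_kernel_measure[OF mX] using \<epsilon> by (intro emeasure_mono) auto
          thus ?thesis using key[of \<epsilon>] \<epsilon>
            by (simp add: emeasure_eq_measure e.emeasure_eq_measure)
        qed
        thus "\<forall>\<^sub>F \<epsilon> in at_right 0. 2 * measure (truncated_kernel_measure s z \<delta>) X \<le> truncated_frac_mean_curvature s E z \<epsilon> + Q"
          using r \<delta> by (auto simp: eventually_at_right_field intro!: exI[of _ "min r \<delta>"])
      qed simp
      hence "measure (truncated_kernel_measure s z \<delta>) X \<le> Q"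
        using measure_nonneg[of "truncated_kernel_measure s z \<delta>" X] by linarith
      thus ?thesis
        unfolding emeasure_truncated_kernel_measure[OF mX, symmetric] emeasure_eq_measure
        by (rule ennreal_leI)
    qed
    \<comment> \<open>Now \<open>\<delta>\<close> tends to zero along \<open>1 / Suc n\<close>:
      these sets increase to \<open>X\<close> without \<open>z\<close>, and the point
      \<open>z\<close> is null.\<close>
    have mU: "(\<Union>n. X - ball z (1 / Suc n)) \<in> sets borel"
      by (rule sets.countable_UN) auto
    have "emeasure (kernel_measure s z) X \<le> emeasure (kernel_measure s z) ((\<Union>n. X - ball z (1 / Suc n)) \<union> {z})"
    proof (rule emeasure_mono)
      show "X \<subseteq> (\<Union>n. X - ball z (1 / Suc n)) \<union> {z}"
      proof
        fix x assume x: "x \<in> X"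
        show "x \<in> (\<Union>n. X - ball z (1 / Suc n)) \<union> {z}"
        proof (cases "x = z")
          case False
          hence "0 < dist z x" by simp
          then obtain n where "inverse (real (Suc n)) < dist z x" using reals_Archimedean by blast
          thus ?thesis using x by (auto simp: inverse_eq_divide intro!: exI[of _ n])
        qed simp
      qed
      show "(\<Union>n. X - ball z (1 / Suc n)) \<union> {z} \<in> sets (kernel_measure s z)"
        using mU unfolding sets_kernel_measure by (intro sets.Un) auto
    qed
    also have "\<dots> \<le> emeasure (kernel_measure s z) (\<Union>n. X - ball z (1 / Suc n)) + emeasure (kernel_measure s z) {z}"
      using mU by (intro emeasure_subadditive) (simp_all only: sets_kernel_measure, simp)
    also have "emeasure (kernel_measure s z) {z} = 0"
      by (rule kernel_measure_null_sets) (simp add: null_sets_def)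
    also have "emeasure (kernel_measure s z) (\<Union>n. X - ball z (1 / Suc n)) =
        (SUP n. emeasure (kernel_measure s z) (X - ball z (1 / Suc n)))"
    proof (rule SUP_emeasure_incseq[symmetric])
      show "incseq (\<lambda>n. X - ball z (1 / real (Suc n)))"
      proof (intro incseq_SucI Diff_mono order_refl)
        fix n
        have "1 / real (Suc (Suc n)) \<le> 1 / real (Suc n)" by (intro divide_left_mono) auto
        thus "ball z (1 / real (Suc (Suc n))) \<subseteq> ball z (1 / real (Suc n))" by (rule subset_ball)
      qed
    qed auto
    also have "\<dots> \<le> ennreal Q"
      by (intro SUP_least trunc) simp
    finally have "emeasure (kernel_measure s z) X \<le> ennreal Q" by simp
    also have "Q \<le> C * (r powr (1 - s) / T + t * r powr (- 1 - s))"
    proof -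
      define A B where "A = r powr (1 - s) / T" and "B = t * r powr (- 1 - s)"
      have "0 \<le> C1 * A" "0 \<le> C2 * B" using C1(1) C2(1) t zc by (simp_all add: A_def B_def)
      moreover have "Q = C2 * A + 2 * C1 * B" by (simp add: Q_def A_def B_def)
      ultimately show ?thesis by (simp add: A_def[symmetric] B_def[symmetric] C_def algebra_simps)
    qed
    hence "ennreal Q \<le> ennreal (C * (r powr (1 - s) / T + t * r powr (- 1 - s)))" by (rule ennreal_leI)
    finally show ?thesis by (simp add: X_def G_def D_def H_def)
  qed
  have "emeasure (kernel_measure s z) ((- ball c T - E) \<inter> ball z r)
        \<le> ennreal (C * (r powr (1 - s) / T + t * r powr (- 1 - s))) \<and>
    emeasure (kernel_measure s z) ({y. (y - z) \<bullet> \<nu> < t} - E - ball z r)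
        \<le> ennreal (C * (r powr (1 - s) / T + t * r powr (- 1 - s)))"
    if asm: "E \<in> sets borel" "has_frac_mean_curvature s E z 0" "E \<inter> ball c T = {}" "norm (z - c) = T" "0 < T"
      "norm \<nu> = 1" "0 < t" "0 < r" "E \<subseteq> {y. (y - z) \<bullet> \<nu> < t}"
    for E :: "'a set" and z c \<nu> and T t r
  proof -
    have mH: "{y. (y - z) \<bullet> \<nu> < t} \<in> sets borel" by measurable
    have mW: "(- ball c T - E) \<inter> ball z r \<union> ({y. (y - z) \<bullet> \<nu> < t} - E - ball z r) \<in> sets (kernel_measure s z)"
      using asm(1) mH by (simp add: sets.Un sets.Int sets.Diff borel_comp)
    have "emeasure (kernel_measure s z) ((- ball c T - E) \<inter> ball z r) \<le>
       emeasure (kernel_measure s z) ((- ball c T - E) \<inter> ball z r \<union> ({y. (y - z) \<bullet> \<nu> < t} - E - ball z r))"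
      "emeasure (kernel_measure s z) ({y. (y - z) \<bullet> \<nu> < t} - E - ball z r) \<le>
       emeasure (kernel_measure s z) ((- ball c T - E) \<inter> ball z r \<union> ({y. (y - z) \<bullet> \<nu> < t} - E - ball z r))"
      by (rule emeasure_mono[OF Un_upper1 mW], rule emeasure_mono[OF Un_upper2 mW])
    thus ?thesis using main[OF asm] order_trans by blast
  qed
  moreover have "0 < C" using C1(1) C2(1) by (simp add: C_def)
  ultimately show ?thesis by (intro exI[of _ C] conjI[of "0 < C"] allI impI) assumption+
qed

section \<open>Measure theoretic support and boundary\<close>

text \<open>This is the support of Lebesgue measure restricted to \<open>A\<close>, a closed set
  that ignores null modifications. An open ball misses \<open>ess_support (- E)\<close> exactly when
  it lies in \<open>E\<close> up to a null set.\<close>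

definition ess_support :: "'a::euclidean_space set \<Rightarrow> 'a set" where
  "ess_support A = {x. \<forall>r>0. A \<inter> ball x r \<notin> null_sets lborel}"

text \<open>Every point of \<open>U\<close> has a ball in which \<open>A\<close> is null, and by
  Lindelof countably many such open sets suffice.\<close>

lemma ess_support_disjoint_null:
  fixes A :: "'a::euclidean_space set"
  assumes A: "A \<in> sets borel" and U: "open U" and disj: "U \<inter> ess_support A = {}"
  shows "A \<inter> U \<in> null_sets lborel"
proof -
  define F where "F = {B. open B \<and> A \<inter> B \<in> null_sets lborel}"
  obtain F' where F': "F' \<subseteq> F" "countable F'" "\<Union>F' = \<Union>F"
    using Lindelof[of F] by (auto simp: F_def)
  have "U \<subseteq> \<Union>F"
  proof
    fix x assume "x \<in> U"
    hence "x \<notin> ess_support A" using disj by blast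
    then obtain r where "r > 0" "A \<inter> ball x r \<in> null_sets lborel" by (auto simp: ess_support_def)
    thus "x \<in> \<Union>F" by (auto simp: F_def intro!: exI[of _ "ball x r"])
  qed
  hence "A \<inter> U = (\<Union>B\<in>F'. A \<inter> B) \<inter> U" using F'(3) by auto
  moreover have "(\<Union>B\<in>F'. A \<inter> B) \<in> null_sets lborel"
    using F' by (intro null_sets_UN') (auto simp: F_def)
  ultimately show ?thesis using U by (metis borel_open null_set_Int2 sets_lborel)
qed

lemma closed_ess_support: "closed (ess_support A)"
proof -
  have "open (- ess_support A)"
    unfolding open_contains_ball
  proof
    fix x assume "x \<in> - ess_support A"
    then obtain r where r: "r > 0" "A \<inter> ball x r \<in> null_sets lborel" by (auto simp: ess_support_def)
    have "ball x (r / 2) \<subseteq> - ess_support A"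
    proof
      fix y assume y: "y \<in> ball x (r / 2)"
      have sub: "ball y (r / 2) \<subseteq> ball x r"
      proof
        fix w assume "w \<in> ball y (r / 2)"
        thus "w \<in> ball x r" using y dist_triangle[of x w y] by simp
      qed
      have "A \<inter> ball y (r / 2) = (A \<inter> ball x r) \<inter> ball y (r / 2)"
        using sub by blast
      hence "A \<inter> ball y (r / 2) \<in> null_sets lborel"
        using r null_set_Int2[of "A \<inter> ball x r" lborel "ball y (r / 2)"] by simp
      moreover have "0 < r / 2" using r by simp
      ultimately show "y \<in> - ess_support A" unfolding ess_support_def by blast
    qed
    thus "\<exists>e>0. ball x e \<subseteq> - ess_support A"
      using r by (intro exI[of _ "r / 2"]) simp
  qed
  thus ?thesis by (simp add: closed_def)
qed

lemma open_not_null: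
  fixes U :: "'a::euclidean_space set"
  assumes "open U" "U \<noteq> {}"
  shows "U \<notin> null_sets lborel"
proof
  assume "U \<in> null_sets lborel"
  obtain x r where "r > 0" "ball x r \<subseteq> U" using assms by (metis all_not_in_conv open_contains_ball)
  hence "ball x r \<in> null_sets lborel"
    using \<open>U \<in> null_sets lborel\<close> by (auto intro: null_sets_subset)
  hence "ennreal (unit_ball_vol (real DIM('a)) * r ^ DIM('a)) = 0"
    using \<open>r > 0\<close> by (simp add: null_sets_def emeasure_ball)
  moreover have "0 < unit_ball_vol (real DIM('a)) * r ^ DIM('a)"
    using \<open>r > 0\<close> by simp
  ultimately show False unfolding ennreal_eq_0_iff by linarith
qed

lemma measure_boundary_iff:
  fixes E :: "'a::euclidean_space set"
  assumes E: "E \<in> sets borel"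
  shows "x \<in> measure_boundary E \<longleftrightarrow> x \<in> ess_support E \<and> x \<in> ess_support (- E)"
proof -
  have "0 < measure lebesgue (E \<inter> ball x r) \<longleftrightarrow> E \<inter> ball x r \<notin> null_sets lborel"
    "measure lebesgue (E \<inter> ball x r) < measure lebesgue (ball x r) \<longleftrightarrow> - E \<inter> ball x r \<notin> null_sets lborel" 
    if r: "0 < r" for r
  proof -
    have fin: "A \<inter> ball x r \<in> fmeasurable lborel" if "A \<in> sets borel" for A
    proof (rule fmeasurableI2)
      show "ball x r \<in> fmeasurable lborel"
        using r by (intro fmeasurableI) (auto simp: emeasure_ball)
    qed (use that in auto)
    have pos: "0 < measure lborel (A \<inter> ball x r) \<longleftrightarrow> A \<inter> ball x r \<notin> null_sets lborel" if "A \<in> sets borel" for A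
    proof -
      have "emeasure lborel (A \<inter> ball x r) = ennreal (measure lborel (A \<inter> ball x r))"
        using fin[OF that] by (simp add: emeasure_eq_measure2)
      thus ?thesis using that by (auto simp: null_sets_def zero_less_measure_iff)
    qed
    have eq: "measure lebesgue A = measure lborel A" if "A \<in> sets borel" for A
      using that by (simp add: measure_completion)
    show "0 < measure lebesgue (E \<inter> ball x r) \<longleftrightarrow> E \<inter> ball x r \<notin> null_sets lborel"
      using pos[OF E] E by (simp add: eq)
    have "measure lborel (ball x r) = measure lborel ((E \<inter> ball x r) \<union> (- E \<inter> ball x r))"
      by (intro arg_cong[where f = "measure _"]) auto
    also have "\<dots> = measure lborel (E \<inter> ball x r) + measure lborel (- E \<inter> ball x r)"
      using fin[OF E] fin[of "- E"] E by (intro measure_Un3[THEN trans]) (auto simp: Int_commute)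
    finally show "measure lebesgue (E \<inter> ball x r) < measure lebesgue (ball x r) \<longleftrightarrow> - E \<inter> ball x r \<notin> null_sets lborel"
      using pos[of "- E"] E by (simp add: eq)
  qed
  thus ?thesis unfolding measure_boundary_def ess_support_def by blast
qed

text \<open>The complements of the two essential supports are open, cover \<open>U\<close> because
  it avoids the boundary, and are disjoint because no nonempty open set is null. Connectedness
  leaves only one of them.\<close>

lemma connected_avoiding_measure_boundary:
  fixes E :: "'a::euclidean_space set"
  assumes E: "E \<in> sets borel" and U: "open U" "connected U" "U \<inter> measure_boundary E = {}"
  shows "E \<inter> U \<in> null_sets lborel \<or> - E \<inter> U \<in> null_sets lborel"
proof -
  have cover: "ess_support E \<union> ess_support (- E) = UNIV"
  proof (rule ccontr)
    define V where "V = - (ess_support E \<union> ess_support (- E))"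
    assume "ess_support E \<union> ess_support (- E) \<noteq> UNIV"
    hence "V \<noteq> {}" by (auto simp: V_def)
    have V: "open V" unfolding V_def by (intro open_Compl closed_Un closed_ess_support)
    have "E \<inter> V \<in> null_sets lborel" "- E \<inter> V \<in> null_sets lborel"
      using E V by (auto intro!: ess_support_disjoint_null simp: V_def)
    hence "E \<inter> V \<union> - E \<inter> V \<in> null_sets lborel" by (rule null_sets.Un)
    moreover have "E \<inter> V \<union> - E \<inter> V = V" by auto
    ultimately show False using open_not_null[OF V \<open>V \<noteq> {}\<close>] by simp
  qed
  have "(- ess_support E) \<inter> U = {} \<or> (- ess_support (- E)) \<inter> U = {}"
  proof (rule connectedD[OF U(2)])
    show "open (- ess_support E)" "open (- ess_support (- E))"
      by (intro open_Compl closed_ess_support)+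
    show "(- ess_support E) \<inter> (- ess_support (- E)) \<inter> U = {}" using cover by blast
    show "U \<subseteq> - ess_support E \<union> - ess_support (- E)"
      using U(3) measure_boundary_iff[OF E] by blast
  qed
  thus ?thesis
  proof
    assume "(- ess_support E) \<inter> U = {}"
    hence "U \<inter> ess_support (- E) = {}" using U(3) measure_boundary_iff[OF E] by blast
    thus ?thesis using E U(1) by (intro disjI2 ess_support_disjoint_null) auto
  next
    assume "(- ess_support (- E)) \<inter> U = {}"
    hence "U \<inter> ess_support E = {}" using U(3) measure_boundary_iff[OF E] by blast
    thus ?thesis using E U(1) by (intro disjI1 ess_support_disjoint_null) auto
  qed
qed

section \<open>Geometry of moving balls and of smooth hypersurfaces\<close>

text \<open>The intermediate value theorem for \<open>infdist (c l) D - R l\<close>: at any zero the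
  ball both misses \<open>D\<close> and touches it. Hence the balls may move without being nested,
  and the zero may be any one.\<close>

lemma first_touching_ball:
  fixes D :: "'a::euclidean_space set" and c :: "real \<Rightarrow> 'a" and R :: "real \<Rightarrow> real"
  assumes D: "closed D" and c: "continuous_on {0..1} c" and R: "continuous_on {0..1} R"
    and start: "ball (c 0) (R 0) \<inter> D = {}" and stop: "p \<in> D" "p \<in> ball (c 1) (R 1)"
  obtains l x where "0 \<le> l" "l \<le> 1" "x \<in> D" "norm (x - c l) = R l" "ball (c l) (R l) \<inter> D = {}"
proof -
  define h where "h l = infdist (c l) D - R l" for l
  have "D \<noteq> {}" using stop by auto
  have "R 0 \<le> infdist (c 0) D"
  proof (unfold infdist_notempty[OF \<open>D \<noteq> {}\<close>], rule cINF_greatest[OF \<open>D \<noteq> {}\<close>])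
    fix y assume "y \<in> D"
    thus "R 0 \<le> dist (c 0) y" using start by (meson disjoint_iff mem_ball not_le)
  qed
  hence 0: "0 \<le> h 0" by (simp add: h_def)
  have 1: "h 1 \<le> 0" using infdist_le[OF stop(1), of "c 1"] stop(2) by (simp add: h_def)
  have "continuous_on {0..1} h" unfolding h_def using c R by (intro continuous_intros)
  then obtain l where l: "0 \<le> l" "l \<le> 1" "h l = 0"
    using IVT2'[of h 1 0 0] 0 1 by auto
  obtain x where x: "x \<in> D" "infdist (c l) D = dist (c l) x"
    using infdist_attains_inf[OF D \<open>D \<noteq> {}\<close>] by metis
  have "norm (x - c l) = R l" using x l by (simp add: h_def dist_norm norm_minus_commute)
  moreover have "ball (c l) (R l) \<inter> D = {}"
  proof (rule ccontr)
    assume "ball (c l) (R l) \<inter> D \<noteq> {}"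
    then obtain y where "y \<in> D" "dist (c l) y < R l" by auto
    thus False using infdist_le[of y D "c l"] l by (simp add: h_def)
  qed
  ultimately show thesis using that l x by blast
qed

text \<open>The balls keep distance \<open>\<rho>\<close> from \<open>z\<close>, comparable to their
  own radius, so the first order expansion of a defining function at \<open>z\<close> already
  determines its sign on them.\<close>

lemma smooth_hypersurface_avoids_balls:
  fixes S :: "'a::euclidean_space set"
  assumes S: "smooth_hypersurface S" and z: "z \<in> S"
  obtains \<nu> \<rho>0 where "norm \<nu> = 1" "0 < \<rho>0"
    "\<And>\<rho>. 0 < \<rho> \<Longrightarrow> \<rho> < \<rho>0 \<Longrightarrow> ball (z + (2 * \<rho>) *\<^sub>R \<nu>) \<rho> \<inter> S = {} \<and> ball (z - (2 * \<rho>) *\<^sub>R \<nu>) \<rho> \<inter> S = {}"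
proof -
  obtain U and \<phi> :: "'a \<Rightarrow> real" where U: "open U" "z \<in> U" and sm: "smooth_on \<phi> U"
    and nz: "frechet_derivative \<phi> (at z) \<noteq> (\<lambda>v. 0)" and SU: "S \<inter> U = {x \<in> U. \<phi> x = 0}"
    using S z unfolding smooth_hypersurface_def by blast
  define L where "L = frechet_derivative \<phi> (at z)"
  have "C_k_on (Suc 0) \<phi> U" using sm by (simp only: smooth_on_def)
  hence "\<phi> differentiable (at z)" using U by simp
  hence L: "(\<phi> has_derivative L) (at z)" unfolding L_def by (simp add: frechet_derivative_works)
  hence lin: "linear L" by (rule has_derivative_linear)
  define g where "g = (\<Sum>b\<in>Basis. L b *\<^sub>R b)"
  have Lg: "L v = g \<bullet> v" for v
  proof -
    have "L v = L (\<Sum>b\<in>Basis. (v \<bullet> b) *\<^sub>R b)" by (simp add: euclidean_representation)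
    also have "\<dots> = (\<Sum>b\<in>Basis. (v \<bullet> b) * L b)"
      using lin by (simp add: linear_sum linear_cmul)
    also have "\<dots> = g \<bullet> v" unfolding g_def inner_sum_left
      by (intro sum.cong) (simp_all add: inner_commute mult.commute)
    finally show ?thesis .
  qed
  have g: "g \<noteq> 0" using nz unfolding L_def[symmetric] by (auto simp: Lg)
  define \<nu> where "\<nu> = g /\<^sub>R norm g"
  have \<nu>: "norm \<nu> = 1" using g by (simp add: \<nu>_def)
  have g\<nu>: "g \<bullet> \<nu> = norm g" using g by (simp add: \<nu>_def dot_square_norm power2_eq_square)
  \<comment> \<open>Points of the balls lie within \<open>3 * \<rho>\<close> of \<open>z\<close>, so
    this slope bounds the remainder by \<open>norm g * \<rho> / 2\<close>, against a linear part of
    size at least \<open>norm g * \<rho>\<close>.\<close>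
  have "norm g / 6 > 0" using g by simp
  then obtain d where d: "0 < d" "\<And>y. norm (y - z) < d \<Longrightarrow> norm (\<phi> y - \<phi> z - L (y - z)) \<le> norm g / 6 * norm (y - z)"
    using L unfolding has_derivative_at_alt by metis
  obtain e where e: "0 < e" "ball z e \<subseteq> U" using U open_contains_ball by blast
  have \<phi>z: "\<phi> z = 0" using SU z U by auto
  show thesis
  proof (rule that[OF \<nu>, of "min d e / 3"])
    show "0 < min d e / 3" using d e by simp
    fix \<rho> :: real assume \<rho>: "0 < \<rho>" "\<rho> < min d e / 3"
    have avoid: "y \<notin> S" if y: "y \<in> ball (z + (2 * \<rho> * \<sigma>) *\<^sub>R \<nu>) \<rho>" and \<sigma>: "\<bar>\<sigma>\<bar> = 1" for y \<sigma>
    proof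
      assume "y \<in> S"
      define w where "w = y - z - (2 * \<rho> * \<sigma>) *\<^sub>R \<nu>"
      have w: "norm w < \<rho>" using y by (simp add: w_def dist_norm norm_minus_commute algebra_simps)
      have yz: "y - z = w + (2 * \<rho> * \<sigma>) *\<^sub>R \<nu>" by (simp add: w_def)
      have "norm (y - z) \<le> norm w + norm ((2 * \<rho> * \<sigma>) *\<^sub>R \<nu>)" unfolding yz by (rule norm_triangle_ineq)
      also have "norm ((2 * \<rho> * \<sigma>) *\<^sub>R \<nu>) = 2 * \<rho>" using \<nu> \<sigma> \<rho> by (simp add: abs_mult)
      finally have n: "norm (y - z) < 3 * \<rho>" using w by simp
      hence "y \<in> U" using e \<rho> by (intro subsetD[OF e(2)]) (simp add: dist_norm norm_minus_commute)
      hence "\<phi> y = 0" using \<open>y \<in> S\<close> SU by blast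
      hence "\<bar>L (y - z)\<bar> \<le> norm g / 6 * norm (y - z)" using d(2)[of y] n \<rho> \<phi>z by simp
      also have "\<dots> \<le> norm g / 6 * (3 * \<rho>)" using n by (intro mult_left_mono) auto
      finally have 1: "\<bar>L (y - z)\<bar> \<le> norm g * \<rho> / 2" by (simp add: mult.commute)
      have "L (y - z) = g \<bullet> w + 2 * \<rho> * \<sigma> * norm g"
        unfolding Lg yz by (simp add: inner_add_right g\<nu>)
      moreover have "\<bar>g \<bullet> w\<bar> \<le> norm g * \<rho>"
        using Cauchy_Schwarz_ineq2[of g w] w mult_left_mono[of "norm w" \<rho> "norm g"] by simp
      moreover have "\<bar>2 * \<rho> * \<sigma> * norm g\<bar> = 2 * (norm g * \<rho>)" using \<sigma> \<rho> by (simp add: abs_mult)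
      moreover have "0 < norm g * \<rho>" using g \<rho> by simp
      ultimately show False using 1 by linarith
    qed
    show "ball (z + (2 * \<rho>) *\<^sub>R \<nu>) \<rho> \<inter> S = {} \<and> ball (z - (2 * \<rho>) *\<^sub>R \<nu>) \<rho> \<inter> S = {}"
      using avoid[of _ 1] avoid[of _ "-1"] by auto
  qed
qed

lemma norm_diff_scaleR_unit_square:
  fixes u \<nu> :: "'a::real_inner"
  assumes "norm \<nu> = 1"
  shows "(norm (u - k *\<^sub>R \<nu>))\<^sup>2 = (norm u)\<^sup>2 - 2 * k * (u \<bullet> \<nu>) + k\<^sup>2"
proof -
  have "\<nu> \<bullet> \<nu> = 1" using assms by (simp add: dot_square_norm)
  thus ?thesis
    unfolding power2_norm_eq_inner
    by (simp add: inner_diff_left inner_diff_right inner_commute[of \<nu> u] power2_eq_square algebra_simps)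
qed

section \<open>Standing assumptions and contact from outside\<close>

locale minimal_in_half_space =
  fixes s :: real and E :: "'a::euclidean_space set" and \<omega> :: 'a and a :: real
  assumes s: "0 < s" "s < 1" and dim: "2 \<le> DIM('a)"
    and openE: "open E" and \<omega>: "norm \<omega> = 1" and sub: "E \<subseteq> {y. y \<bullet> \<omega> < a}"
    and near: "\<And>\<eta>. 0 < \<eta> \<Longrightarrow> \<exists>q\<in>E. a - \<eta> < q \<bullet> \<omega>"
    and smooth: "smooth_hypersurface (measure_boundary E)"
    and curvature: "\<And>x. x \<in> measure_boundary E \<Longrightarrow> has_frac_mean_curvature s E x 0"
begin

lemma borelE [simp]: "E \<in> sets borel"
  using openE by simp

lemma \<omega>\<omega>: "\<omega> \<bullet> \<omega> = 1"
  using \<omega> by (simp add: dot_square_norm)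

lemma borel_half_space [simp]: "{y::'a. y \<bullet> \<nu> < b} \<in> sets borel"
  by measurable

text \<open>The foot \<open>q0\<close> of \<open>q\<close> on the hyperplane; a ball of radius \<open>T\<close> resting on the hyperplane at \<open>q0\<close>
  is lowered until it touches \<open>E\<close>.\<close>

lemma lowered_ball:
  assumes q: "q \<in> E" "a - \<eta> < q \<bullet> \<omega>" and \<eta>: "\<eta> \<le> T"
  defines "q0 \<equiv> q + (a - q \<bullet> \<omega>) *\<^sub>R \<omega>"
  obtains l z where "0 \<le> l" "l \<le> \<eta>" "z \<in> measure_boundary E"
    "norm (z - (q0 + (T - l) *\<^sub>R \<omega>)) = T" "E \<inter> ball (q0 + (T - l) *\<^sub>R \<omega>) T = {}"
    "(norm (z - q0))\<^sup>2 \<le> 2 * T * \<eta>" "a - \<eta> \<le> z \<bullet> \<omega>" "z \<bullet> \<omega> \<le> a"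
    "\<forall>y\<in>ball (q0 + (T - l) *\<^sub>R \<omega>) T. a - \<eta> \<le> y \<bullet> \<omega>"
proof -
  have qa: "q \<bullet> \<omega> < a" using q sub by blast
  have \<eta>0: "0 < \<eta>" using q qa by linarith
  have q0\<omega>: "q0 \<bullet> \<omega> = a" by (simp add: q0_def inner_add_left \<omega>\<omega>)
  \<comment> \<open>At \<open>l = 0\<close> the ball rests on the hyperplane and misses
    \<open>E\<close>. At \<open>l = 1\<close> it has sunk by \<open>\<eta>\<close>, more than the
    depth of \<open>q\<close>, and \<open>\<eta> \<le> T\<close> puts \<open>q\<close> inside
    it.\<close>
  define c where "c l = q0 + (T - \<eta> * l) *\<^sub>R \<omega>" for l
  have cyw: "(y - c l) \<bullet> \<omega> = y \<bullet> \<omega> - a - (T - \<eta> * l)" for y l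
    by (simp add: c_def inner_diff_left inner_add_left \<omega>\<omega> q0\<omega>)
  have low: "a - \<eta> * l \<le> y \<bullet> \<omega>" if "norm (y - c l) \<le> T" for y l
    using that Cauchy_Schwarz_ineq2[of "y - c l" \<omega>] \<omega> by (simp add: cyw)
  have clE: "y \<bullet> \<omega> \<le> a" if "y \<in> closure E" for y
  proof -
    have "closure E \<subseteq> {y. y \<bullet> \<omega> \<le> a}"
    proof (rule closure_minimal)
      show "closed {y. y \<bullet> \<omega> \<le> a}" by (intro closed_Collect_le continuous_intros)
    qed (use sub in auto)
    thus ?thesis using that by blast
  qed
  have st: "ball (c 0) T \<inter> closure E = {}"
  proof (rule ccontr)
    assume "ball (c 0) T \<inter> closure E \<noteq> {}"
    then obtain y where "y \<in> ball (c 0) T" "y \<in> E"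
      by (metis all_not_in_conv open_Int_closure_eq_empty open_ball disjoint_iff)
    thus False using low[of y 0] sub by (auto simp: dist_norm norm_minus_commute)
  qed
  have qb: "q \<in> ball (c 1) T"
  proof -
    have "c 1 - q = ((a - q \<bullet> \<omega>) + (T - \<eta>)) *\<^sub>R \<omega>" by (simp add: c_def q0_def scaleR_add_left)
    hence "dist (c 1) q = (a - q \<bullet> \<omega>) + (T - \<eta>)" using \<omega> qa \<eta> by (simp add: dist_norm)
    thus ?thesis using q by simp
  qed
  have contc: "continuous_on {0..1} c" unfolding c_def by (intro continuous_intros)
  have qcl: "q \<in> closure E" using q closure_subset by blast
  obtain l z where l:
    "0 \<le> l" "l \<le> 1" "z \<in> closure E" "norm (z - c l) = T" "ball (c l) T \<inter> closure E = {}"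
    by (rule first_touching_ball[of "closure E" c "\<lambda>_. T" q, OF closed_closure contc continuous_on_const st qcl qb])
  have T: "0 < T" using \<eta>0 \<eta> by linarith
  have l\<eta>: "\<eta> * l \<le> \<eta>" "0 \<le> \<eta> * l" using l \<eta>0 by (auto simp: mult_left_le)
  have za: "z \<bullet> \<omega> \<le> a" using clE l by blast
  have "z \<in> ess_support E"
    unfolding ess_support_def
  proof (intro CollectI allI impI)
    fix r :: real assume "0 < r"
    hence "E \<inter> ball z r \<noteq> {}"
      using l(3) by (metis Int_commute IntI centre_in_ball empty_iff open_Int_closure_eq_empty open_ball)
    thus "E \<inter> ball z r \<notin> null_sets lborel" using openE by (intro open_not_null) auto
  qed
  moreover have "z \<in> ess_support (- E)"
    unfolding ess_support_def
  proof (intro CollectI allI impI notI)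
    fix r :: real assume r: "0 < r" and null: "- E \<inter> ball z r \<in> null_sets lborel"
    have "z \<in> closure (ball (c l) T)" using l T by (simp add: dist_norm norm_minus_commute)
    hence "ball (c l) T \<inter> ball z r \<noteq> {}"
      using r by (metis Int_commute IntI centre_in_ball empty_iff open_Int_closure_eq_empty open_ball)
    moreover have "ball (c l) T \<inter> ball z r \<subseteq> - E \<inter> ball z r" using l(5) closure_subset[of E] by auto
    ultimately show False
      using open_not_null[of "ball (c l) T \<inter> ball z r"] null_sets_subset[OF null] by auto
  qed
  ultimately have zb: "z \<in> measure_boundary E" by (simp add: measure_boundary_iff)
  have c: "c l = q0 + (T - \<eta> * l) *\<^sub>R \<omega>" by (simp add: c_def)
  \<comment> \<open>Since \<open>z\<close> is not above the hyperplane, the term with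
    \<open>z \<bullet> \<omega> - a\<close> in the expansion is nonpositive; the drift of
    \<open>z\<close> from \<open>q0\<close> is thus controlled by the lowering alone.\<close>
  have "T\<^sup>2 = (norm ((z - q0) - (T - \<eta> * l) *\<^sub>R \<omega>))\<^sup>2"
    using l(4) by (simp add: c algebra_simps)
  also have "\<dots> = (norm (z - q0))\<^sup>2 - 2 * (T - \<eta> * l) * ((z - q0) \<bullet> \<omega>) + (T - \<eta> * l)\<^sup>2"
    by (rule norm_diff_scaleR_unit_square[OF \<omega>])
  also have "(z - q0) \<bullet> \<omega> = z \<bullet> \<omega> - a" by (simp add: inner_diff_left q0\<omega>)
  finally have "(norm (z - q0))\<^sup>2 = 2 * T * (\<eta> * l) - (\<eta> * l)\<^sup>2 + 2 * (T - \<eta> * l) * (z \<bullet> \<omega> - a)"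
    by (simp add: power2_eq_square algebra_simps)
  moreover have "2 * T * (\<eta> * l) \<le> 2 * T * \<eta>" using l\<eta> T by (intro mult_left_mono) auto
  moreover have "(T - \<eta> * l) * (z \<bullet> \<omega> - a) \<le> 0"
    using l\<eta> \<eta> za by (intro mult_nonneg_nonpos) auto
  ultimately have zq: "(norm (z - q0))\<^sup>2 \<le> 2 * T * \<eta>"
    using zero_le_power2[of "\<eta> * l"] by linarith
  show thesis
  proof (rule that[OF l\<eta>(2,1) zb _ _ zq])
    show "norm (z - (q0 + (T - \<eta> * l) *\<^sub>R \<omega>)) = T" using l(4) by (simp add: c)
    show "E \<inter> ball (q0 + (T - \<eta> * l) *\<^sub>R \<omega>) T = {}" using l(5) closure_subset[of E] by (auto simp: c)
    show "a - \<eta> \<le> z \<bullet> \<omega>" using low[of z l] l(4) l\<eta> by simp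
    show "z \<bullet> \<omega> \<le> a" by (rule za)
    show "\<forall>y\<in>ball (q0 + (T - \<eta> * l) *\<^sub>R \<omega>) T. a - \<eta> \<le> y \<bullet> \<omega>"
    proof
      fix y assume "y \<in> ball (q0 + (T - \<eta> * l) *\<^sub>R \<omega>) T"
      thus "a - \<eta> \<le> y \<bullet> \<omega>"
        using low[of y l] l\<eta> by (simp add: c dist_norm norm_minus_commute)
    qed
  qed
qed

end

section \<open>The half-space theorem\<close>

context minimal_in_half_space
begin

text \<open>The touching ball supplies mass of \<open>E\<close> next to \<open>x\<close>. Together
  with \<open>x \<in> ess_support (- E)\<close> this makes \<open>x\<close> a boundary point, where
  the curvature equation is available.\<close>

lemma touching_point_in_boundary:
  assumes x: "x \<in> ess_support (- E)" and R: "norm (x - c) = R" "0 < R"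
    and disj: "ball c R \<inter> ess_support (- E) = {}"
  shows "x \<in> measure_boundary E" "ball c R - E \<in> null_sets lborel"
proof -
  have "- E \<inter> ball c R \<in> null_sets lborel"
    using disj by (intro ess_support_disjoint_null borel_comp) auto
  moreover have "- E \<inter> ball c R = ball c R - E" by auto
  ultimately show null: "ball c R - E \<in> null_sets lborel" by simp
  have "x \<in> ess_support E"
    unfolding ess_support_def
  proof (intro CollectI allI impI notI)
    fix r :: real assume r: "0 < r" and nul: "E \<inter> ball x r \<in> null_sets lborel"
    have "x \<in> closure (ball c R)" using R by (simp add: dist_norm norm_minus_commute)
    hence ne: "ball c R \<inter> ball x r \<noteq> {}"
      using r by (metis Int_commute IntI centre_in_ball empty_iff open_Int_closure_eq_empty open_ball)
    have sub: "ball c R \<inter> ball x r \<subseteq> (E \<inter> ball x r) \<union> (ball c R - E)" by auto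
    have "(E \<inter> ball x r) \<union> (ball c R - E) \<in> null_sets lborel"
      using nul null by (rule null_sets.Un)
    hence "ball c R \<inter> ball x r \<in> null_sets lborel"
      by (rule null_sets_subset[OF _ _ sub]) simp
    thus False using open_not_null[OF _ ne] by auto
  qed
  thus "x \<in> measure_boundary E" using x by (simp add: measure_boundary_iff)
qed

text \<open>The error of an exterior contact at scale \<open>r\<close>: curvature of the ball near
  \<open>z\<close>, thickness of the slab farther out. The summands agree for
  \<open>T = r\<^sup>2 / \<eta>\<close>.\<close>

definition touching_bound :: "real \<Rightarrow> real \<Rightarrow> real \<Rightarrow> real" where
  "touching_bound T \<eta> r = r powr (1 - s) / T + \<eta> * r powr (- 1 - s)"

text \<open>\<open>C\<close> precedes \<open>q\<close>, \<open>\<eta>\<close>, \<open>T\<close> and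
  \<open>r\<close>, so the exterior ball and the scale may be picked after an interior contact point
  is known. The point \<open>z\<close> varies with them, but its distance from the foot of
  \<open>q\<close> is controlled, as the change of centre requires.\<close>

lemma exterior_ball_estimate:
  "\<exists>C>0. \<forall>q \<eta> T r. q \<in> E \<longrightarrow> a - \<eta> < q \<bullet> \<omega> \<longrightarrow> \<eta> \<le> T \<longrightarrow> 0 < r \<longrightarrow>
    (\<exists>z c. z \<in> measure_boundary E \<and> norm (z - c) = T \<and> E \<inter> ball c T = {} \<and>
      (norm (z - (q + (a - q \<bullet> \<omega>) *\<^sub>R \<omega>)))\<^sup>2 \<le> 2 * T * \<eta> \<and>
      norm (c - (q + (a - q \<bullet> \<omega>) *\<^sub>R \<omega>) - T *\<^sub>R \<omega>) \<le> \<eta> \<and>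
      (\<forall>y\<in>ball c T. a - \<eta> \<le> y \<bullet> \<omega>) \<and>
      emeasure (kernel_measure s z) ((- ball c T - E) \<inter> ball z r) \<le> ennreal (C * touching_bound T \<eta> r) \<and>
      emeasure (kernel_measure s z) ({y. y \<bullet> \<omega> < a} - E - ball z r) \<le> ennreal (C * touching_bound T \<eta> r))"
proof -
  obtain C where C: "0 < C" "\<And>(E::'a set) z c T \<nu> t r.
    E \<in> sets borel \<Longrightarrow> has_frac_mean_curvature s E z 0 \<Longrightarrow> E \<inter> ball c T = {} \<Longrightarrow>
    norm (z - c) = T \<Longrightarrow> 0 < T \<Longrightarrow> norm \<nu> = 1 \<Longrightarrow> 0 < t \<Longrightarrow> 0 < r \<Longrightarrow> E \<subseteq> {y. (y - z) \<bullet> \<nu> < t} \<Longrightarrow>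
    emeasure (kernel_measure s z) ((- ball c T - E) \<inter> ball z r)
        \<le> ennreal (C * (r powr (1 - s) / T + t * r powr (- 1 - s))) \<and>
    emeasure (kernel_measure s z) ({y. (y - z) \<bullet> \<nu> < t} - E - ball z r)
        \<le> ennreal (C * (r powr (1 - s) / T + t * r powr (- 1 - s)))"
    using outer_touching_ball[OF s, where 'a='a] by metis
  show ?thesis
  proof (intro exI[of _ C] conjI[of "0 < C"] allI impI C(1))
    fix q \<eta> T r assume q: "q \<in> E" "a - \<eta> < q \<bullet> \<omega>" and \<eta>: "\<eta> \<le> T" and r: "0 < (r::real)"
    define q0 where "q0 = q + (a - q \<bullet> \<omega>) *\<^sub>R \<omega>"
    have "q \<bullet> \<omega> < a" using q sub by blast
    hence \<eta>0: "0 < \<eta>" using q by linarith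
    obtain l z where zl: "0 \<le> l" "l \<le> \<eta>" "z \<in> measure_boundary E"
      "norm (z - (q0 + (T - l) *\<^sub>R \<omega>)) = T" "E \<inter> ball (q0 + (T - l) *\<^sub>R \<omega>) T = {}"
      "(norm (z - q0))\<^sup>2 \<le> 2 * T * \<eta>" "a - \<eta> \<le> z \<bullet> \<omega>" "z \<bullet> \<omega> \<le> a"
      "\<forall>y\<in>ball (q0 + (T - l) *\<^sub>R \<omega>) T. a - \<eta> \<le> y \<bullet> \<omega>"
      by (rule lowered_ball[OF q \<eta>, folded q0_def])
    define c where "c = q0 + (T - l) *\<^sub>R \<omega>"
    have "c - q0 - T *\<^sub>R \<omega> = - (l *\<^sub>R \<omega>)" by (simp add: c_def algebra_simps)
    hence cn: "norm (c - q0 - T *\<^sub>R \<omega>) \<le> \<eta>" using zl \<omega> by simp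
    have "E \<subseteq> {y. (y - z) \<bullet> \<omega> < \<eta>}" using sub zl(7) by (force simp: inner_diff_left)
    hence est: "emeasure (kernel_measure s z) ((- ball c T - E) \<inter> ball z r) \<le> ennreal (C * touching_bound T \<eta> r)"
      "emeasure (kernel_measure s z) ({y. (y - z) \<bullet> \<omega> < \<eta>} - E - ball z r) \<le> ennreal (C * touching_bound T \<eta> r)"
      using C(2)[of E z c T \<omega> \<eta> r] curvature[OF zl(3)] zl(4,5) \<omega> \<eta>0 \<eta> r
      by (simp_all add: c_def touching_bound_def)
    have "emeasure (kernel_measure s z) ({y. y \<bullet> \<omega> < a} - E - ball z r) \<le>
        emeasure (kernel_measure s z) ({y. (y - z) \<bullet> \<omega> < \<eta>} - E - ball z r)"
    proof (rule emeasure_mono)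
      show "{y. y \<bullet> \<omega> < a} - E - ball z r \<subseteq> {y. (y - z) \<bullet> \<omega> < \<eta>} - E - ball z r"
        using zl(7) by (auto simp: inner_diff_left)
      have "{y. (y - z) \<bullet> \<omega> < \<eta>} \<in> sets borel" by measurable
      thus "{y. (y - z) \<bullet> \<omega> < \<eta>} - E - ball z r \<in> sets (kernel_measure s z)"
        by (simp add: sets.Diff)
    qed
    hence "emeasure (kernel_measure s z) ({y. y \<bullet> \<omega> < a} - E - ball z r) \<le> ennreal (C * touching_bound T \<eta> r)"
      using est(2) by (rule order_trans)
    thus "\<exists>z c. z \<in> measure_boundary E \<and> norm (z - c) = T \<and> E \<inter> ball c T = {} \<and>
      (norm (z - (q + (a - q \<bullet> \<omega>) *\<^sub>R \<omega>)))\<^sup>2 \<le> 2 * T * \<eta> \<and>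
      norm (c - (q + (a - q \<bullet> \<omega>) *\<^sub>R \<omega>) - T *\<^sub>R \<omega>) \<le> \<eta> \<and>
      (\<forall>y\<in>ball c T. a - \<eta> \<le> y \<bullet> \<omega>) \<and>
      emeasure (kernel_measure s z) ((- ball c T - E) \<inter> ball z r) \<le> ennreal (C * touching_bound T \<eta> r) \<and>
      emeasure (kernel_measure s z) ({y. y \<bullet> \<omega> < a} - E - ball z r) \<le> ennreal (C * touching_bound T \<eta> r)"
      using zl cn est(1) unfolding q0_def[symmetric] by (intro exI[of _ z] exI[of _ c]) (auto simp: c_def)
  qed
qed

section \<open>The late stage: large balls about a fixed centre\<close>

text \<open>The conclusion \<open>T \<le> 0\<close> stands for a contradiction, as the lemma is
  applied with \<open>T \<ge> 1\<close>. The point \<open>v\<close> has half the depth of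
  \<open>p\<close>, and a ball of radius at most \<open>T\<close> about
  \<open>v - T *\<^sub>R \<omega>\<close> bends away from the hyperplane: contact at displacement
  \<open>u\<close> from \<open>v\<close> has depth at least
  \<open>\<tau> / 2 + (norm u)\<^sup>2 / (2 * T)\<close>. This quadratic gain absorbs the curvature
  error at a scale proportional to \<open>norm u\<close>.\<close>

lemma no_late_touching:
  assumes p: "p \<bullet> \<omega> < a"
  defines "v \<equiv> p + ((a - p \<bullet> \<omega>) / 2) *\<^sub>R \<omega>"
  shows "\<exists>T0. \<forall>T\<ge>T0. \<forall>R x. T / 4 \<le> R \<longrightarrow> R \<le> T \<longrightarrow> x \<in> ess_support (- E) \<longrightarrow>
    norm (x - (v - T *\<^sub>R \<omega>)) = R \<longrightarrow> ball (v - T *\<^sub>R \<omega>) R \<inter> ess_support (- E) = {} \<longrightarrow> T \<le> 0"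
proof -
  define \<tau> where "\<tau> = a - p \<bullet> \<omega>"
  have \<tau>: "0 < \<tau>" using p by (simp add: \<tau>_def)
  have v\<omega>: "v \<bullet> \<omega> = a - \<tau> / 2"
    by (simp add: v_def \<tau>_def inner_add_left \<omega>\<omega> field_simps)
  obtain c0 C1 where c0: "0 < c0" and C1: "0 < C1" and inner: "\<And>(E::'a set) z c T \<nu> t r B.
    E \<in> sets borel \<Longrightarrow> has_frac_mean_curvature s E z 0 \<Longrightarrow> ball c T - E \<in> null_sets lborel \<Longrightarrow>
    norm (z - c) = T \<Longrightarrow> 0 < T \<Longrightarrow> norm \<nu> = 1 \<Longrightarrow> 0 < t \<Longrightarrow> 0 < r \<Longrightarrow> 0 \<le> B \<Longrightarrow>
    emeasure (kernel_measure s z) ({y. (y - z) \<bullet> \<nu> < t} - E - ball z r) \<le> ennreal B \<Longrightarrow>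
    c0 * min t r * r powr (- 1 - s) \<le> C1 * r powr (1 - s) / T + 2 * B"
    using inner_touching_ball[OF s dim] by metis
  obtain C2 where C2: "0 < C2" and outer: "\<And>q \<eta> T r. q \<in> E \<Longrightarrow> a - \<eta> < q \<bullet> \<omega> \<Longrightarrow> \<eta> \<le> T \<Longrightarrow> 0 < r \<Longrightarrow>
    (\<exists>z c. z \<in> measure_boundary E \<and> norm (z - c) = T \<and> E \<inter> ball c T = {} \<and>
      (norm (z - (q + (a - q \<bullet> \<omega>) *\<^sub>R \<omega>)))\<^sup>2 \<le> 2 * T * \<eta> \<and>
      norm (c - (q + (a - q \<bullet> \<omega>) *\<^sub>R \<omega>) - T *\<^sub>R \<omega>) \<le> \<eta> \<and>
      (\<forall>y\<in>ball c T. a - \<eta> \<le> y \<bullet> \<omega>) \<and>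
      emeasure (kernel_measure s z) ((- ball c T - E) \<inter> ball z r) \<le> ennreal (C2 * touching_bound T \<eta> r) \<and>
      emeasure (kernel_measure s z) ({y. y \<bullet> \<omega> < a} - E - ball z r) \<le> ennreal (C2 * touching_bound T \<eta> r))"
    using exterior_ball_estimate by metis
  obtain C3 where C3: "0 < C3" and slab: "\<And>(z::'a) \<nu> a h r. norm \<nu> = 1 \<Longrightarrow> 0 < h \<Longrightarrow> 0 < r \<Longrightarrow>
    emeasure (kernel_measure s z) ({y. a \<le> (y - z) \<bullet> \<nu> \<and> (y - z) \<bullet> \<nu> \<le> a + h} - ball z r)
      \<le> ennreal (C3 * h * r powr (- 1 - s))"
    using kernel_measure_slab_outer[OF s(1), where 'a='a] by blast
  \<comment> \<open>Makes the curvature error at most a quarter of the main term once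
    \<open>r = \<theta> * norm u\<close>.\<close>
  define \<theta> where "\<theta> = min 1 (c0 / (32 * C1))"
  have \<theta>: "0 < \<theta>" "\<theta> \<le> 1" "32 * C1 * \<theta> \<le> c0"
    using c0 C1 by (auto simp: \<theta>_def min_def field_simps)
  \<comment> \<open>From \<open>norm (x - z) \<le> 2 * m + 2 * r\<close> with
    \<open>r = \<theta> * m\<close>, proved below.\<close>
  define K where "K = 2 + 2 / \<theta>"
  have K: "0 \<le> K" using \<theta> by (simp add: K_def)
  define k where "k = (1 + K) powr (real DIM('a) + s)"
  have k: "0 < k" using K by (simp add: k_def)
  define C4 where "C4 = k * (4 * C2) + C3"
  have C4: "0 < C4" using k C2 C3 by (simp add: C4_def add_pos_pos)
  \<comment> \<open>The errors from the missing mass and the slab then sum to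
    \<open>2 * C4 * \<eta> = c0 * \<tau> / 16\<close>, below a quarter of the main term, which is at
    least \<open>c0 * \<tau> / 2\<close>. Neither \<open>\<eta>\<close> nor the point
    \<open>q\<close> depends on \<open>T\<close>.\<close>
  define \<eta> where "\<eta> = c0 * \<tau> / (32 * C4)"
  have \<eta>: "0 < \<eta>" using c0 \<tau> C4 by (simp add: \<eta>_def)
  obtain q where q: "q \<in> E" "a - \<eta> < q \<bullet> \<omega>" using near[OF \<eta>] by blast
  define q0 where "q0 = q + (a - q \<bullet> \<omega>) *\<^sub>R \<omega>"
  \<comment> \<open>A floor for the scale: \<open>\<theta> * M\<close> is at least
    \<open>\<tau>\<close> and \<open>\<eta>\<close>, and \<open>q0\<close> is within
    \<open>M\<close> of \<open>v\<close>.\<close>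
  define M where "M = norm (v - q0) + \<tau> / \<theta> + \<eta> / \<theta>"
  have \<tau>\<theta>: "0 < \<tau> / \<theta>" "0 < \<eta> / \<theta>" using \<tau> \<eta> \<theta> by auto
  have M: "norm (v - q0) \<le> M" "\<tau> / \<theta> \<le> M" "\<eta> / \<theta> \<le> M" "0 < M"
    using \<tau>\<theta> norm_ge_zero[of "v - q0"] unfolding M_def by linarith+
  \<comment> \<open>Handles contacts near \<open>v\<close>, where the scale is the fixed number
    \<open>\<theta> * M\<close> and only a large \<open>T\<close> makes the curvature error
    small.\<close>
  define T0 where "T0 = 32 * C1 * (\<theta> * M)\<^sup>2 / (c0 * \<tau>)"
  have "T \<le> 0"
    if T: "T0 \<le> T" and R: "T / 4 \<le> R" "R \<le> T" and x: "x \<in> ess_support (- E)"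
      and xc: "norm (x - (v - T *\<^sub>R \<omega>)) = R" and free: "ball (v - T *\<^sub>R \<omega>) R \<inter> ess_support (- E) = {}"
    for T R x
  proof (rule ccontr)
    assume "\<not> T \<le> 0"
    hence Tpos: "0 < T" by simp
    hence Rpos: "0 < R" using R by linarith
    note bd = touching_point_in_boundary[OF x xc Rpos free]
    define u where "u = x - v"
    define t where "t = a - x \<bullet> \<omega>"
    have "(norm (u - (- T) *\<^sub>R \<omega>))\<^sup>2 \<le> T\<^sup>2"
      using xc R Rpos by (intro power_mono) (auto simp: u_def algebra_simps)
    hence "(norm u)\<^sup>2 + 2 * T * (u \<bullet> \<omega>) \<le> 0"
      unfolding norm_diff_scaleR_unit_square[OF \<omega>] by simp
    hence "(norm u)\<^sup>2 / (2 * T) \<le> - (u \<bullet> \<omega>)"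
      using Tpos by (simp add: field_simps)
    moreover have "t = \<tau> / 2 - u \<bullet> \<omega>" by (simp add: t_def u_def inner_diff_left v\<omega>)
    ultimately have t: "\<tau> / 2 + (norm u)\<^sup>2 / (2 * T) \<le> t" by simp
    have "0 \<le> (norm u)\<^sup>2 / (2 * T)" using Tpos by simp
    hence t1: "\<tau> / 2 \<le> t" "(norm u)\<^sup>2 / (2 * T) \<le> t" using t \<tau> by linarith+
    have "norm u \<le> norm (x - (v - T *\<^sub>R \<omega>)) + norm (T *\<^sub>R \<omega>)"
      using norm_triangle_ineq4[of "x - (v - T *\<^sub>R \<omega>)" "T *\<^sub>R \<omega>"] by (simp add: u_def algebra_simps)
    hence uT: "norm u \<le> 2 * T" using xc R Tpos \<omega> by simp
    define m where "m = max (norm u) M"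
    define r where "r = \<theta> * m"
    have m: "norm u \<le> m" "M \<le> m" "0 < m" using M by (auto simp: m_def)
    have r: "0 < r" using \<theta> m by (simp add: r_def)
    have "\<theta> * M \<le> r" using \<theta> m by (simp add: r_def)
    moreover have "\<tau> \<le> \<theta> * M" "\<eta> \<le> \<theta> * M" using M \<theta> by (auto simp: field_simps)
    ultimately have r\<tau>: "\<tau> \<le> r" "\<eta> \<le> r" by linarith+
    \<comment> \<open>Balances the two summands of \<open>touching_bound\<close> and keeps
      \<open>z\<close> within \<open>2 * r\<close> of \<open>q0\<close>.\<close>
    define T' where "T' = r\<^sup>2 / \<eta>"
    have T': "0 < T'" using r \<eta> by (simp add: T'_def)
    have "\<eta> * \<eta> \<le> r * r" using r\<tau> \<eta> by (intro mult_mono) auto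
    hence \<eta>T': "\<eta> \<le> T'" using \<eta> by (simp add: T'_def power2_eq_square field_simps)
    obtain z c where z: "z \<in> measure_boundary E" "norm (z - c) = T'"
        "(norm (z - q0))\<^sup>2 \<le> 2 * T' * \<eta>" and low: "\<And>y. y \<in> ball c T' \<Longrightarrow> a - \<eta> \<le> y \<bullet> \<omega>"
      and est1: "emeasure (kernel_measure s z) ((- ball c T' - E) \<inter> ball z r) \<le> ennreal (C2 * touching_bound T' \<eta> r)"
      and est2: "emeasure (kernel_measure s z) ({y. y \<bullet> \<omega> < a} - E - ball z r) \<le> ennreal (C2 * touching_bound T' \<eta> r)"
      using outer[OF q \<eta>T' r] unfolding q0_def by blast
    have tb: "touching_bound T' \<eta> r = 2 * (\<eta> * r powr (- 1 - s))"
    proof -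
      have "r powr (1 - s) = r powr 2 * r powr (- 1 - s)"
        unfolding powr_add[symmetric] by simp
      hence "r powr (1 - s) / T' = \<eta> * r powr (- 1 - s)"
        using r \<eta> by (simp add: T'_def)
      thus ?thesis by (simp add: touching_bound_def)
    qed
    have "2 * T' * \<eta> \<le> (2 * r)\<^sup>2" using \<eta> r by (simp add: T'_def power2_eq_square)
    hence "(norm (z - q0))\<^sup>2 \<le> (2 * r)\<^sup>2" using z by linarith
    hence zq: "norm (z - q0) \<le> 2 * r" using r by (intro power2_le_imp_le[of "norm (z - q0)"]) auto
    have "norm (x - z) \<le> norm u + norm (v - q0) + norm (z - q0)"
      using norm_triangle_ineq[of u "v - q0"] norm_triangle_ineq4[of "u + (v - q0)" "z - q0"]
      by (simp add: u_def)
    also have "\<dots> \<le> m + m + 2 * r" using m M zq by linarith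
    also have "m + m + 2 * r = K * r" using \<theta> by (simp add: K_def r_def field_simps)
    finally have xz: "norm (x - z) \<le> K * r" .
    define H where "H = {y. y \<bullet> \<omega> < a}"
    define P where "P = ball c T'"
    have mH [simp]: "H \<in> sets borel" and mP [simp]: "P \<in> sets borel" by (simp_all add: H_def P_def)
    note [simp] = sets.Diff sets.Un sets.Int borel_comp
    define S1 where "S1 = (- P - E) \<inter> ball z r \<union> (H - E - ball z r)"
    \<comment> \<open>The lowered ball \<open>P\<close> may reach below the hyperplane, and its
      points near \<open>z\<close> are not covered by \<open>S1\<close>. They have depth at most
      \<open>\<eta>\<close>, so this slab collects them.\<close>
    define S2 where "S2 = {y. (a - \<eta> - x \<bullet> \<omega>) \<le> (y - x) \<bullet> \<omega> \<and> (y - x) \<bullet> \<omega> \<le> (a - \<eta> - x \<bullet> \<omega>) + \<eta>}"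
    have mS1: "S1 \<in> sets borel" by (simp add: S1_def)
    have mS2: "S2 \<in> sets borel" unfolding S2_def by measurable
    define B where "B = C4 * (\<eta> * r powr (- 1 - s))"
    have "emeasure (kernel_measure s z) S1 \<le> ennreal (C2 * touching_bound T' \<eta> r) + ennreal (C2 * touching_bound T' \<eta> r)"
    proof -
      have "emeasure (kernel_measure s z) S1 \<le> emeasure (kernel_measure s z) ((- P - E) \<inter> ball z r) +
          emeasure (kernel_measure s z) (H - E - ball z r)"
        unfolding S1_def by (intro emeasure_subadditive) simp_all
      also have "\<dots> \<le> ennreal (C2 * touching_bound T' \<eta> r) + ennreal (C2 * touching_bound T' \<eta> r)"
        using est1 est2 unfolding P_def H_def by (rule add_mono)
      finally show ?thesis .
    qed
    also have "\<dots> = ennreal (4 * C2 * (\<eta> * r powr (- 1 - s)))"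
      using C2 \<eta> r unfolding tb by (subst ennreal_plus[symmetric]) auto
    finally have S1z: "emeasure (kernel_measure s z) S1 \<le> ennreal (4 * C2 * (\<eta> * r powr (- 1 - s)))" .
    have "emeasure (kernel_measure s x) (S1 - ball x r) \<le> ennreal k * emeasure (kernel_measure s z) (S1 - ball x r)"
      unfolding k_def using mS1 r s xz K by (intro kernel_measure_change_center[where r = r]) auto
    also have "\<dots> \<le> ennreal k * ennreal (4 * C2 * (\<eta> * r powr (- 1 - s)))"
      using S1z mS1 by (intro mult_left_mono order_trans[OF emeasure_mono S1z]) auto
    also have "\<dots> = ennreal (k * (4 * C2) * (\<eta> * r powr (- 1 - s)))"
      using k by (simp add: ennreal_mult'[symmetric] mult.assoc)
    finally have A1: "emeasure (kernel_measure s x) (S1 - ball x r) \<le> ennreal (k * (4 * C2) * (\<eta> * r powr (- 1 - s)))" .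
    have A2: "emeasure (kernel_measure s x) (S2 - ball x r) \<le> ennreal (C3 * (\<eta> * r powr (- 1 - s)))"
      using slab[OF \<omega> \<eta> r, where z = x and a = "a - \<eta> - x \<bullet> \<omega>"] unfolding S2_def by (simp add: mult.assoc)
    have "emeasure (kernel_measure s x) ({y. (y - x) \<bullet> \<omega> < t} - E - ball x r) \<le>
        emeasure (kernel_measure s x) ((S1 - ball x r) \<union> (S2 - ball x r))"
    proof (rule emeasure_mono)
      show "{y. (y - x) \<bullet> \<omega> < t} - E - ball x r \<subseteq> (S1 - ball x r) \<union> (S2 - ball x r)"
      proof
        fix y assume y: "y \<in> {y. (y - x) \<bullet> \<omega> < t} - E - ball x r"
        hence yH: "y \<in> H" by (simp add: H_def t_def inner_diff_left)
        show "y \<in> (S1 - ball x r) \<union> (S2 - ball x r)"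
        proof (cases "y \<in> P")
          case True
          hence "y \<in> S2" using low[of y] yH by (simp add: P_def S2_def H_def inner_diff_left)
          thus ?thesis using y by blast
        next
          case False
          thus ?thesis using y yH by (auto simp: S1_def)
        qed
      qed
    qed (use mS1 mS2 in simp)
    also have "\<dots> \<le> emeasure (kernel_measure s x) (S1 - ball x r) + emeasure (kernel_measure s x) (S2 - ball x r)"
      using mS1 mS2 by (intro emeasure_subadditive) auto
    also have "\<dots> \<le> ennreal (k * (4 * C2) * (\<eta> * r powr (- 1 - s))) + ennreal (C3 * (\<eta> * r powr (- 1 - s)))"
      using A1 A2 by (rule add_mono)
    also have "\<dots> = ennreal B"
      using k C2 C3 \<eta> by (subst ennreal_plus[symmetric]) (auto simp: B_def C4_def algebra_simps)
    finally have Best: "emeasure (kernel_measure s x) ({y. (y - x) \<bullet> \<omega> < t} - E - ball x r) \<le> ennreal B" .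
    have t0: "0 < t" using t1 \<tau> by linarith
    have "0 \<le> B" using C4 \<eta> by (simp add: B_def)
    from inner[OF borelE curvature[OF bd(1)] bd(2) xc Rpos \<omega> t0 r this Best]
    have "c0 * min t r * r powr (- 1 - s) \<le> C1 * r powr (1 - s) / R + 2 * B" .
    also have "C1 * r powr (1 - s) / R \<le> C1 * r powr (1 - s) / (T / 4)"
      using C1 R Tpos Rpos by (intro divide_left_mono) auto
    also have "C1 * r powr (1 - s) / (T / 4) = 4 * C1 * r\<^sup>2 / T * r powr (- 1 - s)"
    proof -
      have "r powr (1 - s) = r powr 2 * r powr (- 1 - s)"
        unfolding powr_add[symmetric] by simp
      thus ?thesis using r by simp
    qed
    finally have "c0 * min t r * r powr (- 1 - s) \<le> (4 * C1 * r\<^sup>2 / T + 2 * C4 * \<eta>) * r powr (- 1 - s)"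
      by (simp add: B_def algebra_simps)
    hence main: "c0 * min t r \<le> 4 * C1 * r\<^sup>2 / T + 2 * C4 * \<eta>"
      using r by (simp only: mult_le_cancel_right_pos powr_gt_zero)
    have "2 * C4 * \<eta> = c0 / 4 * (\<tau> / 4)" using C4 by (simp add: \<eta>_def)
    also have "\<dots> < c0 / 4 * min t r" using c0 t1 r\<tau> \<tau> by (intro mult_strict_left_mono) auto
    finally have 1: "2 * C4 * \<eta> < c0 / 4 * min t r" .
    \<comment> \<open>Away from \<open>v\<close> the bound by \<open>t\<close> comes from the
      quadratic depth and the bound by \<open>r\<close> from \<open>norm u \<le> 2 * T\<close>; near
      \<open>v\<close> both come from \<open>T0\<close>.\<close>
    have 2: "4 * C1 * r\<^sup>2 / T \<le> c0 / 4 * min t r"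
    proof (cases "M \<le> norm u")
      case True
      hence ru: "r = \<theta> * norm u" by (simp add: r_def m_def)
      have "4 * C1 * r\<^sup>2 / T = (32 * C1 * \<theta>) * (\<theta> * ((norm u)\<^sup>2 / (2 * T))) / 4"
        by (simp add: ru power2_eq_square)
      also have "\<dots> \<le> c0 * (1 * t) / 4"
        using \<theta> t1 c0 C1 Tpos by (intro divide_right_mono mult_mono) auto
      finally have a: "4 * C1 * r\<^sup>2 / T \<le> c0 / 4 * t" by simp
      have "4 * C1 * r\<^sup>2 / T = 4 * C1 * (\<theta> * r) * (norm u / T)"
        by (simp add: ru power2_eq_square)
      also have "\<dots> \<le> 4 * C1 * (\<theta> * r) * 2"
        using uT Tpos C1 \<theta> r by (intro mult_left_mono) (auto simp: field_simps)
      also have "\<dots> = (32 * C1 * \<theta>) * r / 4" by simp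
      also have "\<dots> \<le> c0 * r / 4" using \<theta> r by (intro divide_right_mono mult_right_mono) auto
      finally have "4 * C1 * r\<^sup>2 / T \<le> c0 / 4 * r" by simp
      with a show ?thesis by (simp add: min_def)
    next
      case False
      hence rM: "r = \<theta> * M" by (simp add: r_def m_def)
      have "4 * C1 * r\<^sup>2 = c0 / 4 * (\<tau> / 2) * T0" using c0 \<tau> by (simp add: T0_def rM)
      also have "\<dots> \<le> c0 / 4 * (\<tau> / 2) * T" using T c0 \<tau> by (intro mult_left_mono) auto
      finally have "4 * C1 * r\<^sup>2 / T \<le> c0 / 4 * (\<tau> / 2)" using Tpos by (simp add: pos_divide_le_eq)
      also have "\<dots> \<le> c0 / 4 * min t r" using c0 t1 r\<tau> \<tau> by (intro mult_left_mono) auto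
      finally show ?thesis .
    qed
    have "0 < c0 * min t r" using c0 t0 r by simp
    thus False using main 1 2 by linarith
  qed
  thus ?thesis by (intro exI[of _ T0]) blast
qed

end

section \<open>The early stage: from a tiny inner ball to radius \<open>T / 4\<close>\<close>

lemma kernel_measure_lower:
  fixes z :: "'a::euclidean_space"
  assumes A: "A \<in> sets borel" and sub: "A \<subseteq> ball z R" and s: "0 < s"
  shows "ennreal (R powr - (real DIM('a) + s)) * emeasure lborel A \<le> emeasure (kernel_measure s z) A"
proof -
  have "ennreal (R powr - (real DIM('a) + s)) * emeasure lborel A =
      (\<integral>\<^sup>+y. ennreal (R powr - (real DIM('a) + s)) * indicator A y \<partial>lborel)"
    using A by (subst nn_integral_cmult_indicator) auto
  also have "\<dots> \<le> (\<integral>\<^sup>+y. ennreal (norm (z - y) powr - (real DIM('a) + s)) * indicator A y \<partial>lborel)"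
  proof (rule nn_integral_mono_AE)
    \<comment> \<open>At the centre the kernel has the default value 0, which would violate the
      lower bound.\<close>
    have "AE y in lborel. y \<noteq> z" by (rule AE_lborel_singleton)
    thus "AE y in lborel. ennreal (R powr - (real DIM('a) + s)) * indicator A y \<le>
      ennreal (norm (z - y) powr - (real DIM('a) + s)) * indicator A y"
    proof eventually_elim
      case (elim y)
      show ?case
      proof (cases "y \<in> A")
        case True
        hence "norm (z - y) < R" using sub by (auto simp: dist_norm)
        hence "R powr - (real DIM('a) + s) \<le> norm (z - y) powr - (real DIM('a) + s)"
          using elim s by (intro powr_mono2') auto
        thus ?thesis by (intro mult_right_mono ennreal_leI) auto
      qed auto
    qed
  qed
  also have "\<dots> = emeasure (kernel_measure s z) A" by (rule emeasure_kernel_measure[OF A, symmetric])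
  finally show ?thesis .
qed

text \<open>Expanding the square of the distance from \<open>y\<close> to \<open>c\<close> leaves
  \<open>(norm (y - z))\<^sup>2\<close> below \<open>2 * T\<close> times the inner product, so the
  open ball lies strictly beyond its tangent plane at \<open>z\<close>.\<close>

lemma exterior_ball_in_half_space:
  fixes c y z :: "'a::real_inner"
  assumes "norm (z - c) = T" "0 < T" "y \<in> ball c T"
  shows "0 < (y - z) \<bullet> ((c - z) /\<^sub>R T)"
proof -
  have n: "norm (c - z) = T" using assms(1) by (simp add: norm_minus_commute)
  have n1: "norm ((c - z) /\<^sub>R T) = 1" using n assms(2) by simp
  have "norm ((y - z) - T *\<^sub>R ((c - z) /\<^sub>R T)) < T"
    using assms(2,3) by (simp add: dist_norm norm_minus_commute)
  hence "(norm ((y - z) - T *\<^sub>R ((c - z) /\<^sub>R T)))\<^sup>2 < T\<^sup>2"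
    by (intro power_strict_mono) auto
  hence "(norm (y - z))\<^sup>2 < 2 * T * ((y - z) \<bullet> ((c - z) /\<^sub>R T))"
    unfolding norm_diff_scaleR_unit_square[OF n1] by simp
  hence "0 < 2 * T * ((y - z) \<bullet> ((c - z) /\<^sub>R T))"
    using zero_le_power2[of "norm (y - z)"] by linarith
  thus ?thesis using assms(2) by (simp add: zero_less_mult_iff)
qed

context minimal_in_half_space
begin

text \<open>Smoothness enters only here. If the small balls on the inner side of \<open>z\<close> lay outside \<open>E\<close>,
  then the kernel would give the complement of \<open>E\<close> infinite mass near \<open>z\<close>.\<close>

lemma small_interior_ball:
  assumes z: "z \<in> measure_boundary E" and zc: "norm (z - c) = T" "0 < T"
    and B: "emeasure (kernel_measure s z) ((- ball c T - E) \<inter> ball z r) \<le> ennreal B" and r: "0 < r"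
    and \<delta>: "0 < \<delta>"
  obtains e \<rho> where "0 < \<rho>" "\<rho> < \<delta>" "norm (e - z) \<le> 5 * \<rho>" "\<rho> \<le> (z - e) \<bullet> ((c - z) /\<^sub>R T)"
    "ball e \<rho> \<inter> ess_support (- E) = {}"
proof -
  define \<nu> where "\<nu> = (c - z) /\<^sub>R T"
  have \<nu>: "norm \<nu> = 1" using zc by (simp add: \<nu>_def norm_minus_commute)
  have \<nu>\<nu>: "\<nu> \<bullet> \<nu> = 1" using \<nu> by (simp add: dot_square_norm)
  obtain n \<rho>0 where n: "norm n = 1" and \<rho>0: "0 < \<rho>0" and avoid:
    "\<And>\<rho>. 0 < \<rho> \<Longrightarrow> \<rho> < \<rho>0 \<Longrightarrow> ball (z + (2 * \<rho>) *\<^sub>R n) \<rho> \<inter> measure_boundary E = {} \<and>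
      ball (z - (2 * \<rho>) *\<^sub>R n) \<rho> \<inter> measure_boundary E = {}"
    using smooth_hypersurface_avoids_balls[OF smooth z] by metis
  \<comment> \<open>Of the two free sides of the surface, one that does not point towards the
    exterior ball.\<close>
  define n' where "n' = (if n \<bullet> \<nu> \<le> 0 then n else - n)"
  have n': "norm n' = 1" "n' \<bullet> \<nu> \<le> 0" using n by (auto simp: n'_def)
  define c1 where "c1 = 6 powr - (real DIM('a) + s) * unit_ball_vol (real DIM('a))"
  have c1: "0 < c1" by (simp add: c1_def)
  \<comment> \<open>A ball of radius \<open>\<rho>\<close> inside \<open>ball z (6 * \<rho>)\<close>
    has kernel mass at least \<open>c1 * \<rho> powr - s\<close>. For
    \<open>\<rho> \<le> X powr (- 1 / s)\<close> this exceeds \<open>B\<close>, so such a ball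
    cannot lie in the complement of \<open>E\<close>.\<close>
  define X where "X = \<bar>B\<bar> / c1 + 1"
  have X: "0 < X" "\<bar>B\<bar> < c1 * X" using c1 by (auto simp: X_def field_simps add_pos_nonneg)
  define \<rho> where "\<rho> = min (min (\<rho>0 / 4) (r / 8)) (min (\<delta> / 2) (X powr (- 1 / s)))"
  have \<rho>: "0 < \<rho>" "\<rho> < \<rho>0 / 2" "\<rho> < r / 6" "\<rho> < \<delta>" "\<rho> \<le> X powr (- 1 / s)"
    using \<rho>0 r \<delta> X by (auto simp: \<rho>_def min_def)
  have "X = (X powr (- 1 / s)) powr - s" using X s by (simp add: powr_powr)
  also have "\<dots> \<le> \<rho> powr - s" using \<rho> s by (intro powr_mono2') auto
  finally have X\<rho>: "X \<le> \<rho> powr - s" .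
  define e0 where "e0 = z + (2 * (2 * \<rho>)) *\<^sub>R n'"
  \<comment> \<open>As \<open>n' \<bullet> \<nu>\<close> may vanish, \<open>e0\<close> can lie on
    the tangent plane of the exterior ball. The shift puts the whole \<open>ball e \<rho>\<close> on
    the far side of that plane.\<close>
  define e where "e = e0 - \<rho> *\<^sub>R \<nu>"
  have "e0 - z = (4 * \<rho>) *\<^sub>R n'" by (simp add: e0_def)
  hence e0z: "norm (e0 - z) = 4 * \<rho>" using n' \<rho> by simp
  have "norm (e - z) \<le> norm (e0 - z) + norm (\<rho> *\<^sub>R \<nu>)"
    unfolding e_def using norm_triangle_ineq4[of "e0 - z" "\<rho> *\<^sub>R \<nu>"] by (simp add: algebra_simps)
  hence ez: "norm (e - z) \<le> 5 * \<rho>" using e0z \<nu> \<rho> by simp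
  have "(z - e) \<bullet> \<nu> = - (4 * \<rho>) * (n' \<bullet> \<nu>) + \<rho>"
    by (simp add: e_def e0_def inner_diff_left inner_add_left \<nu>\<nu>)
  moreover have "0 \<le> - (4 * \<rho>) * (n' \<bullet> \<nu>)" using n' \<rho> by (intro mult_nonpos_nonpos) auto
  ultimately have depth: "\<rho> \<le> (z - e) \<bullet> \<nu>" by linarith
  have eball: "ball e \<rho> \<subseteq> ball e0 (2 * \<rho>)"
  proof
    fix y assume y: "y \<in> ball e \<rho>"
    have "dist e0 e = \<rho>" using \<nu> \<rho> by (simp add: e_def dist_norm)
    thus "y \<in> ball e0 (2 * \<rho>)" using y dist_triangle[of e0 y e] by simp
  qed
  have "ball e0 (2 * \<rho>) \<inter> measure_boundary E = {}"
    using avoid[of "2 * \<rho>"] \<rho> by (cases "n \<bullet> \<nu> \<le> 0") (auto simp: e0_def n'_def)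
  hence "E \<inter> ball e0 (2 * \<rho>) \<in> null_sets lborel \<or> - E \<inter> ball e0 (2 * \<rho>) \<in> null_sets lborel"
    by (intro connected_avoiding_measure_boundary) auto
  moreover have "E \<inter> ball e0 (2 * \<rho>) \<notin> null_sets lborel"
  proof
    assume nulE: "E \<inter> ball e0 (2 * \<rho>) \<in> null_sets lborel"
    have "E \<inter> ball e \<rho> \<subseteq> E \<inter> ball e0 (2 * \<rho>)" using eball by blast
    hence nul: "E \<inter> ball e \<rho> \<in> null_sets lborel"
      by (rule null_sets_subset[OF nulE, rotated]) (simp add: sets.Int)
    have mG: "ball e \<rho> - E \<in> sets borel" by (simp add: sets.Diff)
    have sub6: "ball e \<rho> \<subseteq> ball z (6 * \<rho>)"
    proof
      fix y assume "y \<in> ball e \<rho>"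
      thus "y \<in> ball z (6 * \<rho>)" using ez dist_triangle[of z y e] by (simp add: dist_norm norm_minus_commute)
    qed
    have subF: "ball e \<rho> - E \<subseteq> (- ball c T - E) \<inter> ball z r"
    proof
      fix y assume y: "y \<in> ball e \<rho> - E"
      have "y \<notin> ball c T"
      proof
        assume "y \<in> ball c T"
        hence 1: "0 < (y - z) \<bullet> \<nu>" unfolding \<nu>_def by (rule exterior_ball_in_half_space[OF zc])
        have "(y - e) \<bullet> \<nu> \<le> norm (y - e)" using norm_cauchy_schwarz[of "y - e" \<nu>] \<nu> by simp
        hence "(y - e) \<bullet> \<nu> < \<rho>" using y by (simp add: dist_norm norm_minus_commute)
        thus False using 1 depth by (simp add: inner_diff_left)
      qed
      moreover have "y \<in> ball z r" using y sub6 subset_ball[of "6 * \<rho>" r z] \<rho> by auto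
      ultimately show "y \<in> (- ball c T - E) \<inter> ball z r" using y by blast
    qed
    have "emeasure lborel (ball e \<rho>) = emeasure lborel (ball e \<rho> - E)"
    proof -
      have "ball e \<rho> - E = ball e \<rho> - E \<inter> ball e \<rho>" by auto
      thus ?thesis using emeasure_Diff_null_set[OF nul, of "ball e \<rho>"] by simp
    qed
    have "ennreal (c1 * \<rho> powr - s) = ennreal ((6 * \<rho>) powr - (real DIM('a) + s)) * emeasure lborel (ball e \<rho>)"
    proof -
      have "\<rho> powr - s = \<rho> powr - (real DIM('a) + s) * \<rho> powr real DIM('a)"
        unfolding powr_add[symmetric] by simp
      hence "c1 * \<rho> powr - s = (6 * \<rho>) powr - (real DIM('a) + s) * (unit_ball_vol (real DIM('a)) * \<rho> ^ DIM('a))"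
        using \<rho> by (simp only: c1_def powr_mult powr_realpow mult_ac)
      thus ?thesis using \<rho> by (simp add: emeasure_ball ennreal_mult')
    qed
    also have "\<dots> = ennreal ((6 * \<rho>) powr - (real DIM('a) + s)) * emeasure lborel (ball e \<rho> - E)"
      by (simp only: \<open>emeasure lborel (ball e \<rho>) = emeasure lborel (ball e \<rho> - E)\<close>)
    also have "\<dots> \<le> emeasure (kernel_measure s z) (ball e \<rho> - E)"
      using sub6 s by (intro kernel_measure_lower mG) auto
    also have "\<dots> \<le> emeasure (kernel_measure s z) ((- ball c T - E) \<inter> ball z r)"
      using subF by (intro emeasure_mono) (simp_all add: sets.Diff sets.Int borel_comp)
    also have "\<dots> \<le> ennreal B" by (rule B)
    also have "\<dots> \<le> ennreal \<bar>B\<bar>" by (intro ennreal_leI) simp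
    finally have "c1 * \<rho> powr - s \<le> \<bar>B\<bar>" by simp
    moreover have "c1 * X \<le> c1 * \<rho> powr - s" using X\<rho> c1 by (intro mult_left_mono) auto
    ultimately show False using X by linarith
  qed
  ultimately have nul: "- E \<inter> ball e0 (2 * \<rho>) \<in> null_sets lborel" by blast
  have "ball e \<rho> \<inter> ess_support (- E) = {}"
  proof (rule ccontr)
    assume "ball e \<rho> \<inter> ess_support (- E) \<noteq> {}"
    then obtain x where x: "x \<in> ball e \<rho>" "x \<in> ess_support (- E)" by blast
    obtain h where h: "0 < h" "ball x h \<subseteq> ball e \<rho>" using x(1) by (meson open_ball open_contains_ball)
    have "- E \<inter> ball x h \<subseteq> - E \<inter> ball e0 (2 * \<rho>)" using h eball by blast
    hence "- E \<inter> ball x h \<in> null_sets lborel"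
      by (rule null_sets_subset[OF nul, rotated]) (simp add: sets.Int borel_comp)
    thus False using x h by (auto simp: ess_support_def)
  qed
  thus thesis using that[of \<rho> e] \<rho> ez depth by (simp add: \<nu>_def)
qed

text \<open>Centre and radius are interpolated from the small inner ball at \<open>z\<close>. The
  tangent half-space of the exterior ball at \<open>z\<close> takes the place of \<open>H\<close>;
  it avoids that ball, so the mass bound applies to all its missing points inside
  \<open>ball z r1\<close>. With \<open>r\<close> proportional to the interpolated size
  \<open>\<mu>\<close>, the gain and the curvature error are multiples of the same
  \<open>r powr - s\<close>, which makes the argument uniform down to arbitrarily small starting
  balls.\<close>

lemma interior_ball_below:
  fixes v :: 'a
  shows "\<exists>T0. \<forall>T\<ge>T0. ball (v - T *\<^sub>R \<omega>) (T / 4) \<inter> ess_support (- E) = {}"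
proof -
  obtain c0 C1 where c0: "0 < c0" and C1: "0 < C1" and inner: "\<And>(E::'a set) z c T \<nu> t r B.
    E \<in> sets borel \<Longrightarrow> has_frac_mean_curvature s E z 0 \<Longrightarrow> ball c T - E \<in> null_sets lborel \<Longrightarrow>
    norm (z - c) = T \<Longrightarrow> 0 < T \<Longrightarrow> norm \<nu> = 1 \<Longrightarrow> 0 < t \<Longrightarrow> 0 < r \<Longrightarrow> 0 \<le> B \<Longrightarrow>
    emeasure (kernel_measure s z) ({y. (y - z) \<bullet> \<nu> < t} - E - ball z r) \<le> ennreal B \<Longrightarrow>
    c0 * min t r * r powr (- 1 - s) \<le> C1 * r powr (1 - s) / T + 2 * B"
    using inner_touching_ball[OF s dim] by metis
  obtain C2 where C2: "0 < C2" and outer: "\<And>q \<eta> T r. q \<in> E \<Longrightarrow> a - \<eta> < q \<bullet> \<omega> \<Longrightarrow> \<eta> \<le> T \<Longrightarrow> 0 < r \<Longrightarrow>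
    (\<exists>z c. z \<in> measure_boundary E \<and> norm (z - c) = T \<and> E \<inter> ball c T = {} \<and>
      (norm (z - (q + (a - q \<bullet> \<omega>) *\<^sub>R \<omega>)))\<^sup>2 \<le> 2 * T * \<eta> \<and>
      norm (c - (q + (a - q \<bullet> \<omega>) *\<^sub>R \<omega>) - T *\<^sub>R \<omega>) \<le> \<eta> \<and>
      (\<forall>y\<in>ball c T. a - \<eta> \<le> y \<bullet> \<omega>) \<and>
      emeasure (kernel_measure s z) ((- ball c T - E) \<inter> ball z r) \<le> ennreal (C2 * touching_bound T \<eta> r) \<and>
      emeasure (kernel_measure s z) ({y. y \<bullet> \<omega> < a} - E - ball z r) \<le> ennreal (C2 * touching_bound T \<eta> r))"
    using exterior_ball_estimate by metis
  obtain C3 where C3: "0 < C3" and tail: "\<And>(z::'a) r. 0 < r \<Longrightarrow>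
    emeasure (kernel_measure s z) (- ball z r) \<le> ennreal (C3 * r powr - s)"
    using kernel_measure_tail[where 'a='a, OF s(1)] by blast
  \<comment> \<open>The bound \<open>1/8\<close> keeps \<open>r\<close> below the depth, which is at
    least \<open>\<mu> / 4\<close>, so \<open>min t r = r\<close>; the other one limits the
    curvature error to a quarter of the gain.\<close>
  define \<theta> where "\<theta> = min (1/8) (c0 / (16 * C1))"
  have \<theta>: "0 < \<theta>" "\<theta> \<le> 1/8" "16 * C1 * \<theta> \<le> c0"
    using c0 C1 by (auto simp: \<theta>_def min_def field_simps)
  define K where "K = 6 / \<theta>"
  have K: "0 \<le> K" using \<theta> by (simp add: K_def)
  define k where "k = (1 + K) powr (real DIM('a) + s)"
  have k: "0 < k" using K by (simp add: k_def)
  \<comment> \<open>Beyond distance \<open>L * T / 2\<close> from \<open>x\<close> only the tail of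
    the kernel is used, and \<open>L\<close> makes it small against the gain. The value
    \<open>12\<close> leaves \<open>ball x (r1 / 2)\<close> inside \<open>ball z r1\<close>, because
    \<open>norm (x - z) \<le> 6 * T\<close>.\<close>
  define L where "L = max 12 (2 * (16 * C3 / c0) powr (1 / s))"
  have L: "12 \<le> L" by (simp add: L_def)
  have "C3 * (L / 2) powr - s \<le> c0 / 16"
  proof -
    have "(16 * C3 / c0) powr (1 / s) \<le> L / 2" by (simp add: L_def)
    hence "((16 * C3 / c0) powr (1 / s)) powr s \<le> (L / 2) powr s"
      using s by (intro powr_mono2) auto
    hence "16 * C3 / c0 \<le> (L / 2) powr s" using c0 C3 s by (simp add: powr_powr)
    thus ?thesis using c0 C3 L by (simp add: powr_minus field_simps)
  qed
  note LC = this
  \<comment> \<open>Depth 1 suffices: in this stage the error is made small by a large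
    \<open>T\<close>, not by a small \<open>\<eta>\<close>.\<close>
  obtain q where q: "q \<in> E" "a - 1 < q \<bullet> \<omega>" using near[of 1] by auto
  define q0 where "q0 = q + (a - q \<bullet> \<omega>) *\<^sub>R \<omega>"
  define C4 where "C4 = k * (C2 * (512 * L\<^sup>2 + 1))"
  have C4: "0 < C4" using k C2 by (simp add: C4_def add_nonneg_pos)
  define T0 where "T0 = 1024 + 16 * norm (q0 - v) + 16 * C4 / c0"
  have "ball (v - T *\<^sub>R \<omega>) (T / 4) \<inter> ess_support (- E) = {}" if T: "T0 \<le> T" for T
  proof (rule ccontr)
    assume "ball (v - T *\<^sub>R \<omega>) (T / 4) \<inter> ess_support (- E) \<noteq> {}"
    then obtain p where p: "p \<in> ess_support (- E)" "p \<in> ball (v - T *\<^sub>R \<omega>) (T / 4)" by blast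
    have "0 \<le> 16 * C4 / c0" using C4 c0 by simp
    hence T1: "1024 \<le> T" "16 * norm (q0 - v) \<le> T" "16 * C4 / c0 \<le> T"
      using T norm_ge_zero[of "q0 - v"] unfolding T0_def by linarith+
    have Tpos: "0 < T" using T1 by simp
    \<comment> \<open>Then \<open>2 * T' = (T / 16)\<^sup>2\<close>, which puts \<open>z\<close>
      within \<open>T / 16\<close> of \<open>q0\<close>. The quadratic growth also brings the normal
      \<open>\<nu>\<close> at \<open>z\<close> close to \<open>\<omega>\<close>.\<close>
    define T' where "T' = T\<^sup>2 / 512"
    have TT': "2 * T \<le> T'" using T1 by (simp add: T'_def power2_eq_square)
    have T': "0 < T'" "1 \<le> T'" using TT' T1 by linarith+
    define r1 where "r1 = L * T"
    have r1: "0 < r1" "12 * T \<le> r1" using L T1 by (auto simp: r1_def)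
    obtain z c where z: "z \<in> measure_boundary E" "norm (z - c) = T'"
        "(norm (z - q0))\<^sup>2 \<le> 2 * T' * 1" "norm (c - q0 - T' *\<^sub>R \<omega>) \<le> 1"
      and est: "emeasure (kernel_measure s z) ((- ball c T' - E) \<inter> ball z r1) \<le> ennreal (C2 * touching_bound T' 1 r1)"
      using outer[OF q T'(2) r1(1)] unfolding q0_def by blast
    define B0 where "B0 = C2 * touching_bound T' 1 r1"
    have B0: "B0 = C2 * (512 * L\<^sup>2 + 1) * r1 powr (- 1 - s)"
    proof -
      have "r1 powr (1 - s) = r1 powr 2 * r1 powr (- 1 - s)"
        unfolding powr_add[symmetric] by simp
      hence "r1 powr (1 - s) / T' = 512 * L\<^sup>2 * r1 powr (- 1 - s)"
        using r1 T1 by (simp add: T'_def r1_def power_mult_distrib)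
      thus ?thesis by (simp add: B0_def touching_bound_def algebra_simps)
    qed
    have "(norm (z - q0))\<^sup>2 \<le> (T / 16)\<^sup>2" using z(3) by (simp add: T'_def power_divide)
    hence zq: "norm (z - q0) \<le> T / 16" using T1 by (intro power2_le_imp_le[of "norm (z - q0)"]) auto
    define \<nu> where "\<nu> = (c - z) /\<^sub>R T'"
    have \<nu>: "norm \<nu> = 1" using z T' by (simp add: \<nu>_def norm_minus_commute)
    have \<nu>\<omega>: "norm (\<nu> - \<omega>) \<le> 1 / 16"
    proof -
      have "T' *\<^sub>R (\<nu> - \<omega>) = (c - q0 - T' *\<^sub>R \<omega>) - (z - q0)"
        using T' by (simp add: \<nu>_def algebra_simps)
      hence "T' * norm (\<nu> - \<omega>) \<le> 1 + T / 16"
        using norm_triangle_ineq4[of "c - q0 - T' *\<^sub>R \<omega>" "z - q0"] z(4) zq T'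
        by (metis abs_of_pos add_mono norm_scaleR order_trans)
      also have "\<dots> \<le> T / 8" using T1 by simp
      also have "\<dots> \<le> T' / 16" using TT' by simp
      finally show ?thesis using T' by simp
    qed
    have zv: "norm (z - v) \<le> T / 8"
      using norm_triangle_ineq[of "z - q0" "q0 - v"] zq T1 by simp
    define c1 where "c1 = v - T *\<^sub>R \<omega>"
    have zc1: "norm (c1 - z) \<le> 2 * T"
      using norm_triangle_ineq4[of "v - z" "T *\<^sub>R \<omega>"] zv T1 \<omega>
      by (simp add: c1_def norm_minus_commute algebra_simps)
    have c1depth: "T / 2 \<le> (z - c1) \<bullet> \<nu>"
    proof -
      have "\<omega> \<bullet> \<nu> = 1 + \<omega> \<bullet> (\<nu> - \<omega>)" by (simp add: inner_diff_right \<omega>\<omega>)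
      moreover have "\<bar>\<omega> \<bullet> (\<nu> - \<omega>)\<bar> \<le> 1 / 16"
        using Cauchy_Schwarz_ineq2[of \<omega> "\<nu> - \<omega>"] \<omega> \<nu>\<omega> by simp
      ultimately have "15 / 16 \<le> \<omega> \<bullet> \<nu>" by linarith
      hence "T * (15 / 16) \<le> T * (\<omega> \<bullet> \<nu>)" using T1 by (intro mult_left_mono) auto
      moreover have "\<bar>(z - v) \<bullet> \<nu>\<bar> \<le> T / 8"
        using Cauchy_Schwarz_ineq2[of "z - v" \<nu>] \<nu> zv by simp
      moreover have "(z - c1) \<bullet> \<nu> = (z - v) \<bullet> \<nu> + T * (\<omega> \<bullet> \<nu>)"
        by (simp add: c1_def inner_diff_left)
      ultimately show ?thesis using T1 by linarith
    qed
    obtain e \<rho> where e: "0 < \<rho>" "\<rho> < T" "norm (e - z) \<le> 5 * \<rho>" "\<rho> \<le> (z - e) \<bullet> \<nu>"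
      "ball e \<rho> \<inter> ess_support (- E) = {}"
      using small_interior_ball[OF z(1,2) T'(1) est r1(1) Tpos] unfolding \<nu>_def by blast
    define C where "C l = (1 - l) *\<^sub>R e + l *\<^sub>R c1" for l
    define m where "m l = (1 - l) * \<rho> + l * T" for l
    \<comment> \<open>The radii are a quarter of \<open>m l\<close>, while the centres have depth at
      least \<open>m l / 2\<close> below the tangent plane at \<open>z\<close>; this leaves depth
      \<open>\<mu> / 4\<close> for the contact point.\<close>
    have st: "ball (C 0) (m 0 / 4) \<inter> ess_support (- E) = {}"
      using e(1,5) subset_ball[of "\<rho> / 4" \<rho> e] by (auto simp: C_def m_def)
    have fin: "p \<in> ball (C 1) (m 1 / 4)" using p(2) by (simp add: C_def m_def c1_def)
    obtain l x where l: "0 \<le> l" "l \<le> 1" and x: "x \<in> ess_support (- E)" "norm (x - C l) = m l / 4"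
      and free: "ball (C l) (m l / 4) \<inter> ess_support (- E) = {}"
    proof (rule first_touching_ball[of "ess_support (- E)" C "\<lambda>l. m l / 4" p, OF closed_ess_support _ _ st p(1) fin])
      show "continuous_on {0..1} C" unfolding C_def by (intro continuous_intros)
      show "continuous_on {0..1} (\<lambda>l. m l / 4)" unfolding m_def by (intro continuous_intros) auto
    qed
    define \<mu> where "\<mu> = m l"
    have \<mu>: "\<mu> = (1 - l) * \<rho> + l * T" by (simp add: \<mu>_def m_def)
    have l1: "0 \<le> (1 - l) * \<rho>" "0 \<le> l * T" using l e T1 by auto
    have \<mu>pos: "0 < \<mu>"
    proof (cases "l = 0")
      case True thus ?thesis using e by (simp add: \<mu>)
    next
      case False
      hence "0 < l * T" using l T1 by simp
      thus ?thesis using l1 by (simp add: \<mu>)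
    qed
    have "(1 - l) * \<rho> \<le> (1 - l) * T" using e l by (intro mult_left_mono) auto
    hence \<mu>T: "\<mu> \<le> T" by (simp add: \<mu> algebra_simps)
    have xC: "norm (x - C l) = \<mu> / 4" using x by (simp add: \<mu>_def)
    have bd: "x \<in> measure_boundary E" "ball (C l) (\<mu> / 4) - E \<in> null_sets lborel"
      using touching_point_in_boundary[OF x(1) xC _ free[folded \<mu>_def]] \<mu>pos by auto
    \<comment> \<open>With this \<open>t\<close> the half-space
      \<open>(y - x) \<bullet> \<nu> < t\<close> is
      \<open>(y - z) \<bullet> \<nu> < 0\<close>.\<close>
    define t where "t = (z - x) \<bullet> \<nu>"
    have t: "\<mu> / 4 \<le> t"
    proof -
      have "t = (1 - l) * ((z - e) \<bullet> \<nu>) + l * ((z - c1) \<bullet> \<nu>) - (x - C l) \<bullet> \<nu>"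
        by (simp add: t_def C_def inner_diff_left inner_add_left algebra_simps)
      moreover have "(1 - l) * \<rho> \<le> (1 - l) * ((z - e) \<bullet> \<nu>)" using l e by (intro mult_left_mono) auto
      moreover have "l * (T / 2) \<le> l * ((z - c1) \<bullet> \<nu>)" using l c1depth by (intro mult_left_mono) auto
      moreover have "(x - C l) \<bullet> \<nu> \<le> \<mu> / 4"
        using norm_cauchy_schwarz[of "x - C l" \<nu>] \<nu> xC by simp
      ultimately show ?thesis using l1 \<mu> by linarith
    qed
    have xz: "norm (x - z) \<le> 6 * \<mu>"
    proof -
      have split: "x - z = (x - C l) + ((1 - l) *\<^sub>R (e - z) + l *\<^sub>R (c1 - z))"
        by (simp add: C_def algebra_simps)
      have "norm (x - z) \<le> norm (x - C l) + (norm ((1 - l) *\<^sub>R (e - z)) + norm (l *\<^sub>R (c1 - z)))"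
        unfolding split using norm_triangle_ineq[of "x - C l" "(1 - l) *\<^sub>R (e - z) + l *\<^sub>R (c1 - z)"]
          norm_triangle_ineq[of "(1 - l) *\<^sub>R (e - z)" "l *\<^sub>R (c1 - z)"] by linarith
      also have "\<dots> = \<mu> / 4 + ((1 - l) * norm (e - z) + l * norm (c1 - z))" using l xC by simp
      also have "\<dots> \<le> \<mu> / 4 + ((1 - l) * (5 * \<rho>) + l * (2 * T))"
        using l e zc1 by (intro add_left_mono add_mono mult_left_mono) auto
      also have "\<dots> \<le> 6 * \<mu>" using l1 \<mu> by (simp add: algebra_simps)
      finally show ?thesis .
    qed
    define r where "r = \<theta> * \<mu>"
    have "r \<le> 1 / 8 * \<mu>" using \<theta> \<mu>pos unfolding r_def by (intro mult_right_mono) auto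
    moreover have "0 < r" using \<theta> \<mu>pos by (simp add: r_def)
    ultimately have r: "0 < r" "r \<le> \<mu> / 8" "r \<le> T" using \<mu>T \<mu>pos by linarith+
    have tr: "min t r = r" using t r \<mu>pos by simp
    have Kr: "K * r = 6 * \<mu>" using \<theta> by (simp add: K_def r_def)
    define F where "F = - ball c T' - E"
    have mF: "F \<inter> ball z r1 \<in> sets borel" by (simp add: F_def sets.Diff sets.Int borel_comp)
    have "emeasure (kernel_measure s x) (F \<inter> ball z r1 - ball x r) \<le>
        ennreal k * emeasure (kernel_measure s z) (F \<inter> ball z r1 - ball x r)"
      unfolding k_def using mF r s xz K Kr by (intro kernel_measure_change_center[where r = r]) (auto simp: sets.Diff)
    also have "\<dots> \<le> ennreal k * ennreal B0"
      using est mF unfolding B0_def F_def by (intro mult_left_mono order_trans[OF emeasure_mono est]) auto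
    also have "\<dots> = ennreal (k * B0)" using k by (simp add: ennreal_mult'[symmetric])
    also have "\<dots> \<le> ennreal (c0 / 16 * r powr - s)"
    proof (rule ennreal_leI)
      have "r1 powr (- 1 - s) \<le> T powr (- 1 - s)"
        using r1 T1 s by (intro powr_mono2') auto
      also have "T powr (- 1 - s) = T powr - s / T"
        using T1 powr_add[of T "-1" "- s"] by (simp add: powr_minus divide_inverse)
      also have "\<dots> \<le> r powr - s / T"
        using r T1 s by (intro divide_right_mono powr_mono2') auto
      finally have "C4 * r1 powr (- 1 - s) \<le> C4 * (r powr - s / T)" using C4 by (intro mult_left_mono) auto
      also have "\<dots> = C4 / T * r powr - s" by simp
      also have "\<dots> \<le> c0 / 16 * r powr - s"
        using T1 c0 by (intro mult_right_mono) (auto simp: field_simps)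
      finally show "k * B0 \<le> c0 / 16 * r powr - s" by (simp add: B0 C4_def mult_ac)
    qed
    finally have A1: "emeasure (kernel_measure s x) (F \<inter> ball z r1 - ball x r) \<le> ennreal (c0 / 16 * r powr - s)" .
    have "emeasure (kernel_measure s x) (- ball x (r1 / 2)) \<le> ennreal (C3 * (r1 / 2) powr - s)"
      using r1 by (intro tail) simp
    also have "\<dots> \<le> ennreal (c0 / 16 * r powr - s)"
    proof (rule ennreal_leI)
      have "L / 2 * r \<le> r1 / 2" using r L by (simp add: r1_def)
      hence "(r1 / 2) powr - s \<le> (L / 2 * r) powr - s"
        using r L s by (intro powr_mono2') auto
      hence "C3 * (r1 / 2) powr - s \<le> C3 * (L / 2 * r) powr - s" using C3 by simp
      also have "\<dots> = (C3 * (L / 2) powr - s) * r powr - s" by (simp only: powr_mult mult.assoc)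
      also have "\<dots> \<le> c0 / 16 * r powr - s" using LC by (intro mult_right_mono) auto
      finally show "C3 * (r1 / 2) powr - s \<le> c0 / 16 * r powr - s" .
    qed
    finally have A2: "emeasure (kernel_measure s x) (- ball x (r1 / 2)) \<le> ennreal (c0 / 16 * r powr - s)" .
    define B where "B = c0 / 8 * r powr - s"
    have "emeasure (kernel_measure s x) ({y. (y - x) \<bullet> \<nu> < t} - E - ball x r) \<le>
        emeasure (kernel_measure s x) ((F \<inter> ball z r1 - ball x r) \<union> - ball x (r1 / 2))"
    proof (rule emeasure_mono)
      show "{y. (y - x) \<bullet> \<nu> < t} - E - ball x r \<subseteq> (F \<inter> ball z r1 - ball x r) \<union> - ball x (r1 / 2)"
      proof
        fix y assume y: "y \<in> {y. (y - x) \<bullet> \<nu> < t} - E - ball x r"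
        hence "(y - z) \<bullet> \<nu> < 0" by (simp add: t_def inner_diff_left)
        hence "y \<notin> ball c T'"
          using exterior_ball_in_half_space[OF z(2) T'(1), of y] by (auto simp: \<nu>_def)
        hence "y \<in> F" using y by (simp add: F_def)
        moreover have "y \<in> ball z r1" if "y \<in> ball x (r1 / 2)"
        proof -
          have "norm (x - z) \<le> r1 / 2" using xz \<mu>T r1 by linarith
          thus ?thesis using that dist_triangle[of z y x] by (simp add: dist_norm norm_minus_commute)
        qed
        ultimately show "y \<in> (F \<inter> ball z r1 - ball x r) \<union> - ball x (r1 / 2)" using y by blast
      qed
    qed (use mF in \<open>simp add: sets.Un sets.Diff borel_comp\<close>)
    also have "\<dots> \<le> emeasure (kernel_measure s x) (F \<inter> ball z r1 - ball x r) + emeasure (kernel_measure s x) (- ball x (r1 / 2))"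
      using mF by (intro emeasure_subadditive) (auto simp: sets.Diff)
    also have "\<dots> \<le> ennreal (c0 / 16 * r powr - s) + ennreal (c0 / 16 * r powr - s)"
      using A1 A2 by (rule add_mono)
    also have "\<dots> = ennreal B"
      using c0 by (subst ennreal_plus[symmetric]) (auto simp: B_def)
    finally have Best: "emeasure (kernel_measure s x) ({y. (y - x) \<bullet> \<nu> < t} - E - ball x r) \<le> ennreal B" .
    have "0 \<le> B" using c0 by (simp add: B_def)
    moreover have "0 < t" "0 < \<mu> / 4" using t \<mu>pos by auto
    ultimately have "c0 * min t r * r powr (- 1 - s) \<le> C1 * r powr (1 - s) / (\<mu> / 4) + 2 * B"
      using inner[OF borelE curvature[OF bd(1)] bd(2) xC _ \<nu> _ r(1) _ Best] by blast
    moreover have "r * r powr (- 1 - s) = r powr - s"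
      using r powr_add[of r 1 "- 1 - s"] by simp
    moreover have "C1 * r powr (1 - s) / (\<mu> / 4) = 4 * C1 * \<theta> * r powr - s"
    proof -
      have "r powr (1 - s) = r * r powr - s" using r powr_add[of r 1 "- s"] by simp
      thus ?thesis using \<mu>pos by (simp add: r_def)
    qed
    \<comment> \<open>Curvature and missing mass each account for at most a quarter of
      \<open>c0\<close>.\<close>
    ultimately have "c0 * r powr - s \<le> (4 * C1 * \<theta> + c0 / 4) * r powr - s"
      unfolding tr by (simp add: B_def algebra_simps)
    hence "c0 \<le> 4 * C1 * \<theta> + c0 / 4" using r by (simp only: mult_le_cancel_right_pos powr_gt_zero)
    thus False using \<theta> c0 by linarith
  qed
  thus ?thesis by blast
qed

section \<open>Joining the stages and the conclusion\<close>

text \<open>About the centre \<open>v - T *\<^sub>R \<omega>\<close> the radius \<open>T / 4\<close>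
  is free by the early stage, while radius \<open>T\<close> would enclose \<open>p\<close>, whose
  distance from the centre is \<open>T - (a - p \<bullet> \<omega>) / 2\<close>. A contact in
  between is excluded by the late stage.\<close>

lemma half_space_minus_null: "{y. y \<bullet> \<omega> < a} - E \<in> null_sets lborel"
proof -
  define H where "H = {y. y \<bullet> \<omega> < a}"
  have "H \<inter> ess_support (- E) = {}"
  proof (rule ccontr)
    assume "H \<inter> ess_support (- E) \<noteq> {}"
    then obtain p where p: "p \<bullet> \<omega> < a" "p \<in> ess_support (- E)" by (auto simp: H_def)
    define v where "v = p + ((a - p \<bullet> \<omega>) / 2) *\<^sub>R \<omega>"
    obtain T1 where T1: "\<And>T R x. T1 \<le> T \<Longrightarrow> T / 4 \<le> R \<Longrightarrow> R \<le> T \<Longrightarrow> x \<in> ess_support (- E) \<Longrightarrow>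
      norm (x - (v - T *\<^sub>R \<omega>)) = R \<Longrightarrow> ball (v - T *\<^sub>R \<omega>) R \<inter> ess_support (- E) = {} \<Longrightarrow> T \<le> 0"
      using no_late_touching[OF p(1)] unfolding v_def by blast
    obtain T2 where T2: "\<And>T. T2 \<le> T \<Longrightarrow> ball (v - T *\<^sub>R \<omega>) (T / 4) \<inter> ess_support (- E) = {}"
      using interior_ball_below by blast
    define T where "T = max (max T1 T2) (max 1 (a - p \<bullet> \<omega>))"
    have T: "T1 \<le> T" "T2 \<le> T" "1 \<le> T" "a - p \<bullet> \<omega> \<le> T" by (auto simp: T_def)
    have "v - T *\<^sub>R \<omega> - p = - ((T - (a - p \<bullet> \<omega>) / 2) *\<^sub>R \<omega>)"
      by (simp add: v_def algebra_simps)
    hence "dist (v - T *\<^sub>R \<omega>) p = T - (a - p \<bullet> \<omega>) / 2"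
      using \<omega> T p(1) by (simp add: dist_norm)
    hence fin: "p \<in> ball (v - T *\<^sub>R \<omega>) (T / 4 + 1 * (3 * T / 4))" using p(1) T by simp
    have st: "ball (v - T *\<^sub>R \<omega>) (T / 4 + 0 * (3 * T / 4)) \<inter> ess_support (- E) = {}"
      using T2[OF T(2)] by simp
    obtain l x where l: "0 \<le> l" "l \<le> 1" and x: "x \<in> ess_support (- E)"
      "norm (x - (v - T *\<^sub>R \<omega>)) = T / 4 + l * (3 * T / 4)"
      and free: "ball (v - T *\<^sub>R \<omega>) (T / 4 + l * (3 * T / 4)) \<inter> ess_support (- E) = {}"
    proof (rule first_touching_ball[of "ess_support (- E)" "\<lambda>_. v - T *\<^sub>R \<omega>" "\<lambda>l. T / 4 + l * (3 * T / 4)" p,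
          OF closed_ess_support continuous_on_const _ st p(2) fin])
      show "continuous_on {0..1} (\<lambda>l. T / 4 + l * (3 * T / 4))" by (intro continuous_intros)
    qed
    have "0 \<le> l * (3 * T / 4)" "l * (3 * T / 4) \<le> 1 * (3 * T / 4)"
      using l T by (auto intro!: mult_right_mono mult_nonneg_nonneg)
    hence "T / 4 \<le> T / 4 + l * (3 * T / 4)" "T / 4 + l * (3 * T / 4) \<le> T" by linarith+
    hence "T \<le> 0" using T1[OF T(1) _ _ x free] by blast
    thus False using T by simp
  qed
  hence "- E \<inter> H \<in> null_sets lborel"
    by (intro ess_support_disjoint_null borel_comp) (auto simp: H_def intro!: open_Collect_less continuous_intros)
  moreover have "- E \<inter> H = H - E" by auto
  ultimately show ?thesis by (simp add: H_def)
qed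

end

theorem theorem1p2:
  fixes n :: nat and s :: real and E :: "(real ^ 'm::finite) set"
  assumes "n \<ge> 1" and "CARD('m) = n + 1"
    and "0 < s" and "s < 1"
    and "open E" and "E \<noteq> {}"
    and "\<exists>H. half_space H \<and> ae_subset E H"
    and "smooth_nonlocal_minimal_boundary s E"
  shows "\<exists>H. half_space H \<and> ae_equal E H"
proof -
  obtain \<omega> b where \<omega>: "norm \<omega> = 1" and Eb: "ae_subset E {x. x \<bullet> \<omega> < b}"
    using assms(7) unfolding half_space_def by blast
  have \<omega>\<omega>: "\<omega> \<bullet> \<omega> = 1" using \<omega> by (simp add: dot_square_norm)
  \<comment> \<open>The part of \<open>E\<close> beyond the hyperplane is open and null, hence
    empty: this turns the inclusion up to null sets into a pointwise one.\<close>
  have le: "y \<bullet> \<omega> \<le> b" if y: "y \<in> E" for y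
  proof (rule ccontr)
    assume "\<not> y \<bullet> \<omega> \<le> b"
    define U where "U = E \<inter> {x. b < x \<bullet> \<omega>}"
    have U: "open U" "U \<noteq> {}"
      using assms(5) y \<open>\<not> y \<bullet> \<omega> \<le> b\<close> by (auto simp: U_def intro!: open_Int open_Collect_less continuous_intros)
    have "U \<in> null_sets lebesgue"
      using Eb U unfolding ae_subset_def by (rule_tac null_sets_subset) (auto simp: U_def)
    hence "U \<in> null_sets lborel"
      using U by (auto simp: null_sets_def)
    thus False using open_not_null[OF U] by blast
  qed
  \<comment> \<open>The supremum replaces the given \<open>b\<close> so that \<open>E\<close> comes
    arbitrarily close to the hyperplane; it is not attained because \<open>E\<close> is
    open.\<close>
  define a where "a = (SUP y\<in>E. y \<bullet> \<omega>)"
  have bdd: "bdd_above ((\<lambda>y. y \<bullet> \<omega>) ` E)" using le by (auto intro!: bdd_aboveI)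
  have lt: "y \<bullet> \<omega> < a" if y: "y \<in> E" for y
  proof -
    obtain \<delta> where \<delta>: "0 < \<delta>" "ball y \<delta> \<subseteq> E" using y assms(5) open_contains_ball by blast
    have "y + (\<delta> / 2) *\<^sub>R \<omega> \<in> E" using \<delta> \<omega> by (intro subsetD[OF \<delta>(2)]) (simp add: dist_norm)
    hence "(y + (\<delta> / 2) *\<^sub>R \<omega>) \<bullet> \<omega> \<le> a" unfolding a_def by (intro cSUP_upper bdd)
    thus ?thesis using \<delta> by (simp add: inner_add_left \<omega>\<omega>)
  qed
  interpret minimal_in_half_space s E \<omega> a
  proof
    show "2 \<le> DIM(real ^ 'm)" using assms(1,2) by simp
    show "E \<subseteq> {y. y \<bullet> \<omega> < a}" using lt by blast
    show "\<exists>q\<in>E. a - \<eta> < q \<bullet> \<omega>" if "0 < \<eta>" for \<eta>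
      using that less_cSUP_iff[OF assms(6) bdd, of "a - \<eta>"] by (simp add: a_def)
  qed (use assms \<omega> in \<open>auto simp: smooth_nonlocal_minimal_boundary_def\<close>)
  have "(E - {y. y \<bullet> \<omega> < a}) \<union> ({y. y \<bullet> \<omega> < a} - E) = {y. y \<bullet> \<omega> < a} - E"
    using lt by blast
  moreover have "{y. y \<bullet> \<omega> < a} - E \<in> null_sets lebesgue"
    using half_space_minus_null by (auto simp: null_sets_def)
  ultimately have "ae_equal E {y. y \<bullet> \<omega> < a}" by (simp only: ae_equal_def)
  thus ?thesis using \<omega> unfolding half_space_def by blast
qed

end
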